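(* Let $G$ be a polycyclic group with a fixed polycycle structure. Every avofactor $Y$ of an II-avoshift $X$ on $G$ is an II-avoshift, and its forbidden patterns can be effectively computed: there is an algorithm which, given a finite set of forbidden patterns for $X$ and a local rule of a factor map $f:X\to Y$ whose graph is an avorelation, outputs a finite set of forbidden patterns defining $Y$.
   Context: Let $\Sigma$ be a finite alphabet; $G$ acts on $\Sigma^G$ by $(gx)_h=x_{g^{-1}h}$; a subshift is a closed $G$-invariant $X\subset \Sigma^G$. $X|C=\{x|C:x\in X\}$. A pattern is an element of $\Sigma^D$, $D\subset G$ finite; a set of forbidden patterns $\mathcal P$ defines the subshift of all $x\in\Sigma^G$ containing no translate of a pattern in $\mathcal P$. For a symbol $a$ and a position $c$, $a^c$ is the pattern with domain $\{c\}$ and value $a$; $\sqcup$ is union of patterns. $X$ is avo for $C\subset G\setminus\{e\}$ if there is a finite $B\subset C$ such that for all $x\in X|C$ and $a\in \Sigma$: $(x|B)\sqcup a^e\in X|(B\cup\{e\})\iff x\sqcup a^e\in X|(C\cup\{e\})$. An II-avoshift is a subshift that is avo for every inductive interval. Polycycle structure and inductive intervals: $1=H_0<H_1<\cdots<H_n=G$ are subgroups, each normal in the next, $H_i/H_{i-1}$ cyclic of order $k_i\le\infty$ generated by $h_iH_{i-1}$. An interval $I\subset\mathbb Z$ grazes $0$ if it has one of the forms $(-\infty,-1],[-m,-1],\emptyset,[1,m],[1,\infty)$. In $\mathbb Z_k$ ($k<\infty$) intervals are images of intervals of $\mathbb Z$, and such an interval grazes $0$ if it is empty, or contains $1$ or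 $-1$ but not $0$. An inductive interval is a set $I\subset G$ determined by a tuple $(I_1,\dots,I_n)$, $I_i$ an interval grazing $0$ in $\mathbb Z_{k_i}$ (in $\mathbb Z$ if $k_i=\infty$): $e\notin I$, and for $g\neq e$, letting $i$ be least with $g\in H_i$ and $t$ the exponent with $g\in h_i^tH_{i-1}$, $g\in I$ iff $t\in I_i$. Avorelations and avofactors: a closed, $G$-invariant $Z\subset\Sigma^{G\times\{1,2\}}$ ($G$ acting on the first coordinate) is an avorelation if for every inductive interval $C$ and each of the pairs $(D,c)=(C\times\{2\},(e,2))$ and $(D,c)=((G\times\{2\})\cup(C\times\{1\}),(e,1))$ there is a finite $B\subset D$ such that for all $z\in Z$, $a\in\Sigma$: $(z|B)\sqcup a^c\in Z|(B\cup\{c\})\iff(z|D)\sqcup a^c\in Z|(D\cup\{c\})$. A factor map $f:X\to Y$ is a continuous shift-commuting surjection; it is given by a local rule, i.e. a finite $N\subset G$ and a function computing $f(x)_e$ from $x|N$. $Y\subset\Sigma^G$ is an avofactor of the II-avoshift $X\subset\Sigma^G$ if there is a factor map $f:X\to Y$ whose graph $\{(x,f(x)):x\in X\}\subset\Sigma^{G\times\{1,2\}}$ ($x$ on $G\times\{1\}$, $f(x)$ on $G\times\{2\}$) is an avorelation. *)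

theory Defs
  imports "HOL-Analysis.Analysis" "HOL-Algebra.Elementary_Groups" "HOL-Library.Nat_Bijection"
begin

section \<open>Polycycle structures and inductive intervals\<close>

definition cyc_factor ::
  "('g, 'b) monoid_scheme \<Rightarrow> (nat \<Rightarrow> 'g set) \<Rightarrow> nat \<Rightarrow> 'g set monoid" where
  "cyc_factor G H i = (G\<lparr>carrier := H i\<rparr>) Mod (H (i - 1))"

text \<open>The inclusions \<open>H (i - 1) \<subseteq> H i\<close> are not required to be proper; a trivial factor is harmless,
  as no element of the group has the corresponding index as its level.\<close>

definition polycycle ::
  "('g, 'b) monoid_scheme \<Rightarrow> nat \<Rightarrow> (nat \<Rightarrow> 'g set) \<Rightarrow> (nat \<Rightarrow> 'g) \<Rightarrow> bool" where
  "polycycle G n H h \<longleftrightarrow>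
     group G \<and> H 0 = {\<one>\<^bsub>G\<^esub>} \<and> H n = carrier G \<and>
     (\<forall>i\<in>{1..n}. subgroup (H i) G \<and> H (i - 1) \<lhd> G\<lparr>carrier := H i\<rparr> \<and> h i \<in> H i \<and>
        carrier (cyc_factor G H i) = generate (cyc_factor G H i) {h i <#\<^bsub>G\<^esub> H (i - 1)})"

text \<open>The order \<open>k\<^sub>i\<close> of the \<open>i\<close>-th factor. As \<^const>\<open>order\<close> is a cardinality, the value \<open>0\<close> stands for
  an infinite factor.\<close>

definition cyc_order :: "('g, 'b) monoid_scheme \<Rightarrow> (nat \<Rightarrow> 'g set) \<Rightarrow> nat \<Rightarrow> nat" where
  "cyc_order G H i = order (cyc_factor G H i)"

definition int_interval :: "int set \<Rightarrow> bool" where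
  "int_interval J \<longleftrightarrow> (\<forall>a\<in>J. \<forall>b\<in>J. {a..b} \<subseteq> J)"

text \<open>Elements of \<open>\<int>\<^sub>k\<close> for \<open>0 < k\<close> are represented by their residues in \<open>{0..<k}\<close>; \<open>k = 0\<close> stands for \<open>\<int>\<close>.\<close>

definition grazing_interval :: "nat \<Rightarrow> int set \<Rightarrow> bool" where
  "grazing_interval k I \<longleftrightarrow>
     (if k = 0
      then I = {..-1} \<or> (\<exists>m\<ge>1. I = {-m..-1}) \<or> I = {} \<or> (\<exists>m\<ge>1. I = {1..m}) \<or> I = {1..}
      else (\<exists>J. int_interval J \<and> I = (\<lambda>t. t mod int k) ` J) \<and>
           (I = {} \<or> (1 mod int k \<in> I \<or> (-1) mod int k \<in> I) \<and> 0 \<notin> I))"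

text \<open>For an infinite factor the reduction \<open>t mod int 0\<close> below is \<open>t\<close> itself.\<close>

definition inductive_interval ::
  "('g, 'b) monoid_scheme \<Rightarrow> nat \<Rightarrow> (nat \<Rightarrow> 'g set) \<Rightarrow> (nat \<Rightarrow> 'g) \<Rightarrow> 'g set \<Rightarrow> bool" where
  "inductive_interval G n H h C \<longleftrightarrow>
     (\<exists>I. (\<forall>i\<in>{1..n}. grazing_interval (cyc_order G H i) (I i)) \<and>
        C = {g \<in> carrier G. g \<noteq> \<one>\<^bsub>G\<^esub> \<and>
               (let i = (LEAST i. g \<in> H i) in
                \<exists>t::int. g \<in> (h i [^]\<^bsub>G\<^esub> t) <#\<^bsub>G\<^esub> H (i - 1) \<and>
                  t mod int (cyc_order G H i) \<in> I i)})"


section \<open>Configurations, subshifts and avoshifts\<close>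

text \<open>Configurations over an index set \<open>I\<close> and an alphabet \<open>A\<close> are the extensional functions in
  \<open>I \<rightarrow>\<^sub>E A\<close>, and \<open>x|C\<close> is \<open>restrict x C\<close>. For \<open>c \<notin> B\<close> the pattern \<open>(x|B) \<squnion> a\<^sup>c\<close> is
  \<open>(restrict x B)(c := a)\<close>, which is extensional on \<open>insert c B\<close>.\<close>

definition restrictions :: "('i \<Rightarrow> 's) set \<Rightarrow> 'i set \<Rightarrow> ('i \<Rightarrow> 's) set" where
  "restrictions X C = (\<lambda>x. restrict x C) ` X"

definition config_topology :: "'s set \<Rightarrow> 'i set \<Rightarrow> ('i \<Rightarrow> 's) topology" where
  "config_topology A I = product_topology (\<lambda>_. discrete_topology A) I"

definition shift :: "('g, 'b) monoid_scheme \<Rightarrow> 'g \<Rightarrow> ('g \<Rightarrow> 's) \<Rightarrow> 'g \<Rightarrow> 's" where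
  "shift G g x = restrict (\<lambda>k. x (inv\<^bsub>G\<^esub> g \<otimes>\<^bsub>G\<^esub> k)) (carrier G)"

definition subshift :: "('g, 'b) monoid_scheme \<Rightarrow> 's set \<Rightarrow> ('g \<Rightarrow> 's) set \<Rightarrow> bool" where
  "subshift G A X \<longleftrightarrow>
     closedin (config_topology A (carrier G)) X \<and> (\<forall>g\<in>carrier G. \<forall>x\<in>X. shift G g x \<in> X)"

text \<open>Since \<open>B \<subseteq> D\<close>, quantifying over \<open>z \<in> Z\<close> is the same as quantifying over \<open>Z|D\<close>.\<close>

definition avo_at :: "'s set \<Rightarrow> ('i \<Rightarrow> 's) set \<Rightarrow> 'i set \<Rightarrow> 'i \<Rightarrow> bool" where
  "avo_at A Z D c \<longleftrightarrow>
     (\<exists>B. finite B \<and> B \<subseteq> D \<and>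
        (\<forall>z\<in>Z. \<forall>a\<in>A.
           (restrict z B)(c := a) \<in> restrictions Z (insert c B) \<longleftrightarrow>
           (restrict z D)(c := a) \<in> restrictions Z (insert c D)))"

definition II_avoshift ::
  "('g, 'b) monoid_scheme \<Rightarrow> nat \<Rightarrow> (nat \<Rightarrow> 'g set) \<Rightarrow> (nat \<Rightarrow> 'g) \<Rightarrow> 's set \<Rightarrow> ('g \<Rightarrow> 's) set \<Rightarrow> bool"
  where
  "II_avoshift G n H h A X \<longleftrightarrow>
     subshift G A X \<and> (\<forall>C. inductive_interval G n H h C \<longrightarrow> avo_at A X C \<one>\<^bsub>G\<^esub>)"

text \<open>A pattern is a pair \<open>(D, u)\<close> with \<open>u \<in> D \<rightarrow>\<^sub>E A\<close>; its translate by \<open>g\<close> has domain \<open>gD\<close> and value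
  \<open>u d\<close> at \<open>gd\<close>.\<close>

definition patterns :: "('g, 'b) monoid_scheme \<Rightarrow> 's set \<Rightarrow> ('g set \<times> ('g \<Rightarrow> 's)) set" where
  "patterns G A = {(D, u). finite D \<and> D \<subseteq> carrier G \<and> u \<in> D \<rightarrow>\<^sub>E A}"

definition subshift_forbidding ::
  "('g, 'b) monoid_scheme \<Rightarrow> 's set \<Rightarrow> ('g set \<times> ('g \<Rightarrow> 's)) set \<Rightarrow> ('g \<Rightarrow> 's) set" where
  "subshift_forbidding G A P =
     {x \<in> carrier G \<rightarrow>\<^sub>E A. \<forall>(D, u)\<in>P. \<forall>g\<in>carrier G. \<not> (\<forall>d\<in>D. x (g \<otimes>\<^bsub>G\<^esub> d) = u d)}"


section \<open>Avorelations and avofactors\<close>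

definition shift2 ::
  "('g, 'b) monoid_scheme \<Rightarrow> 'g \<Rightarrow> ('g \<times> nat \<Rightarrow> 's) \<Rightarrow> 'g \<times> nat \<Rightarrow> 's" where
  "shift2 G g z = restrict (\<lambda>(k, j). z (inv\<^bsub>G\<^esub> g \<otimes>\<^bsub>G\<^esub> k, j)) (carrier G \<times> {1, 2})"

definition avorelation ::
  "('g, 'b) monoid_scheme \<Rightarrow> nat \<Rightarrow> (nat \<Rightarrow> 'g set) \<Rightarrow> (nat \<Rightarrow> 'g) \<Rightarrow> 's set \<Rightarrow> ('g \<times> nat \<Rightarrow> 's) set \<Rightarrow> bool"
  where
  "avorelation G n H h A Z \<longleftrightarrow>
     closedin (config_topology A (carrier G \<times> {1, 2})) Z \<and>
     (\<forall>g\<in>carrier G. \<forall>z\<in>Z. shift2 G g z \<in> Z) \<and>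
     (\<forall>C. inductive_interval G n H h C \<longrightarrow>
        avo_at A Z (C \<times> {2}) (\<one>\<^bsub>G\<^esub>, 2) \<and>
        avo_at A Z ((carrier G \<times> {2}) \<union> (C \<times> {1})) (\<one>\<^bsub>G\<^esub>, 1))"

definition factor_map ::
  "('g, 'b) monoid_scheme \<Rightarrow> 's set \<Rightarrow> ('g \<Rightarrow> 's) set \<Rightarrow> ('g \<Rightarrow> 's) set \<Rightarrow> (('g \<Rightarrow> 's) \<Rightarrow> 'g \<Rightarrow> 's) \<Rightarrow> bool"
  where
  "factor_map G A X Y f \<longleftrightarrow>
     Y \<subseteq> carrier G \<rightarrow>\<^sub>E A \<and>
     continuous_map (subtopology (config_topology A (carrier G)) X)
                    (subtopology (config_topology A (carrier G)) Y) f \<and>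
     (\<forall>g\<in>carrier G. \<forall>x\<in>X. f (shift G g x) = shift G g (f x)) \<and>
     f ` X = Y"

definition graph ::
  "('g, 'b) monoid_scheme \<Rightarrow> ('g \<Rightarrow> 's) set \<Rightarrow> (('g \<Rightarrow> 's) \<Rightarrow> 'g \<Rightarrow> 's) \<Rightarrow> ('g \<times> nat \<Rightarrow> 's) set" where
  "graph G X f =
     (\<lambda>x. restrict (\<lambda>(k, j). if j = 1 then x k else f x k) (carrier G \<times> {1, 2})) ` X"

definition avofactor ::
  "('g, 'b) monoid_scheme \<Rightarrow> nat \<Rightarrow> (nat \<Rightarrow> 'g set) \<Rightarrow> (nat \<Rightarrow> 'g) \<Rightarrow> 's set \<Rightarrow>
     ('g \<Rightarrow> 's) set \<Rightarrow> ('g \<Rightarrow> 's) set \<Rightarrow> bool"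
  where
  "avofactor G n H h A X Y \<longleftrightarrow>
     (\<exists>f. factor_map G A X Y f \<and> avorelation G n H h A (graph G X f))"

definition local_rule ::
  "('g, 'b) monoid_scheme \<Rightarrow> 's set \<Rightarrow> ('g \<Rightarrow> 's) set \<Rightarrow> (('g \<Rightarrow> 's) \<Rightarrow> 'g \<Rightarrow> 's) \<Rightarrow>
     'g set \<Rightarrow> (('g \<Rightarrow> 's) \<Rightarrow> 's) \<Rightarrow> bool"
  where
  "local_rule G A X f N \<phi> \<longleftrightarrow>
     finite N \<and> N \<subseteq> carrier G \<and> \<phi> \<in> (N \<rightarrow>\<^sub>E A) \<rightarrow> A \<and> (\<forall>x\<in>X. f x \<one>\<^bsub>G\<^esub> = \<phi> (restrict x N))"


section \<open>Partial recursive functions\<close>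

text \<open>The partial recursive functions in one argument, tuples being coded by \<^const>\<open>prod_encode\<close>.
  The identity is \<open>pr_pair\<close> of the two projections.\<close>

definition pr_mu :: "(nat \<Rightarrow> nat option) \<Rightarrow> nat \<Rightarrow> nat option" where
  "pr_mu f m =
     (let Q = (\<lambda>k. f (prod_encode (m, k)) = Some 0 \<and>
                   (\<forall>j<k. \<exists>v. v \<noteq> 0 \<and> f (prod_encode (m, j)) = Some v))
      in if \<exists>k. Q k then Some (THE k. Q k) else None)"

primrec pr_rec ::
  "(nat \<Rightarrow> nat option) \<Rightarrow> (nat \<Rightarrow> nat option) \<Rightarrow> nat \<Rightarrow> nat \<Rightarrow> nat option" where
  "pr_rec f g m 0 = f m"
| "pr_rec f g m (Suc k) =
     Option.bind (pr_rec f g m k) (\<lambda>r. g (prod_encode (m, prod_encode (k, r))))"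

inductive partial_recursive :: "(nat \<Rightarrow> nat option) \<Rightarrow> bool" where
  pr_zero: "partial_recursive (\<lambda>m. Some 0)"
| pr_Suc: "partial_recursive (\<lambda>m. Some (Suc m))"
| pr_fst: "partial_recursive (\<lambda>m. Some (fst (prod_decode m)))"
| pr_snd: "partial_recursive (\<lambda>m. Some (snd (prod_decode m)))"
| pr_pair: "partial_recursive f \<Longrightarrow> partial_recursive g \<Longrightarrow>
     partial_recursive
       (\<lambda>m. Option.bind (f m) (\<lambda>a. Option.bind (g m) (\<lambda>b. Some (prod_encode (a, b)))))"
| pr_comp: "partial_recursive f \<Longrightarrow> partial_recursive g \<Longrightarrow>
     partial_recursive (\<lambda>m. Option.bind (g m) f)"
| pr_prim: "partial_recursive f \<Longrightarrow> partial_recursive g \<Longrightarrow>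
     partial_recursive (\<lambda>m. pr_rec f g (fst (prod_decode m)) (snd (prod_decode m)))"
| pr_min: "partial_recursive f \<Longrightarrow> partial_recursive (pr_mu f)"


section \<open>Codes of the finite data\<close>

text \<open>Codes are given by relations \<open>R m a\<close>, read ``the number \<open>m\<close> is a code of \<open>a\<close>''; an object may have
  several codes, for instance because a finite set is coded by any list of codes of its elements.\<close>

definition codes_pair ::
  "(nat \<Rightarrow> 'a \<Rightarrow> bool) \<Rightarrow> (nat \<Rightarrow> 'c \<Rightarrow> bool) \<Rightarrow> nat \<Rightarrow> 'a \<times> 'c \<Rightarrow> bool" where
  "codes_pair R S m p \<longleftrightarrow>
     (\<exists>m1 m2. m = prod_encode (m1, m2) \<and> R m1 (fst p) \<and> S m2 (snd p))"

definition codes_set :: "(nat \<Rightarrow> 'a \<Rightarrow> bool) \<Rightarrow> nat \<Rightarrow> 'a set \<Rightarrow> bool" where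
  "codes_set R m S \<longleftrightarrow> (\<exists>ms. m = list_encode ms \<and> rel_set R (set ms) S)"

text \<open>A group element \<open>h\<^sub>n\<^bsup>t\<^sub>n\<^esup> \<cdots> h\<^sub>1\<^bsup>t\<^sub>1\<^esup>\<close> is coded by the exponent list \<open>[t\<^sub>1, \<dots>, t\<^sub>n]\<close>. Every element has
  this form, and the exponents need not be reduced.\<close>

primrec exp_prod ::
  "('g, 'b) monoid_scheme \<Rightarrow> (nat \<Rightarrow> 'g) \<Rightarrow> (nat \<Rightarrow> int) \<Rightarrow> nat \<Rightarrow> 'g" where
  "exp_prod G h t 0 = \<one>\<^bsub>G\<^esub>"
| "exp_prod G h t (Suc i) = (h (Suc i) [^]\<^bsub>G\<^esub> t (Suc i)) \<otimes>\<^bsub>G\<^esub> exp_prod G h t i"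

definition codes_elt ::
  "('g, 'b) monoid_scheme \<Rightarrow> nat \<Rightarrow> (nat \<Rightarrow> 'g) \<Rightarrow> nat \<Rightarrow> 'g \<Rightarrow> bool" where
  "codes_elt G n h m g \<longleftrightarrow>
     (\<exists>ts. length ts = n \<and> m = list_encode (map int_encode ts) \<and>
           g = exp_prod G h (\<lambda>i. ts ! (i - 1)) n)"

text \<open>Symbols are coded through a numbering \<open>\<sigma>\<close> of the alphabet. A function on a finite set is
  coded as the set of its argument-value pairs.\<close>

definition codes_sym :: "('s \<Rightarrow> nat) \<Rightarrow> nat \<Rightarrow> 's \<Rightarrow> bool" where
  "codes_sym \<sigma> m a \<longleftrightarrow> m = \<sigma> a"

definition codes_pattern ::
  "('g, 'b) monoid_scheme \<Rightarrow> nat \<Rightarrow> (nat \<Rightarrow> 'g) \<Rightarrow> ('s \<Rightarrow> nat) \<Rightarrow> nat \<Rightarrow> 'g set \<times> ('g \<Rightarrow> 's) \<Rightarrow> bool" where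
  "codes_pattern G n h \<sigma> m p \<longleftrightarrow>
     codes_set (codes_pair (codes_elt G n h) (codes_sym \<sigma>)) m ((\<lambda>d. (d, snd p d)) ` fst p)"

definition codes_patterns ::
  "('g, 'b) monoid_scheme \<Rightarrow> nat \<Rightarrow> (nat \<Rightarrow> 'g) \<Rightarrow> ('s \<Rightarrow> nat) \<Rightarrow> nat \<Rightarrow> ('g set \<times> ('g \<Rightarrow> 's)) set \<Rightarrow> bool"
  where
  "codes_patterns G n h \<sigma> = codes_set (codes_pattern G n h \<sigma>)"

definition codes_rule ::
  "('g, 'b) monoid_scheme \<Rightarrow> nat \<Rightarrow> (nat \<Rightarrow> 'g) \<Rightarrow> 's set \<Rightarrow> ('s \<Rightarrow> nat) \<Rightarrow> nat \<Rightarrow>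
     'g set \<times> (('g \<Rightarrow> 's) \<Rightarrow> 's) \<Rightarrow> bool"
  where
  "codes_rule G n h A \<sigma> m r \<longleftrightarrow>
     codes_set (codes_pair (codes_pattern G n h \<sigma>) (codes_sym \<sigma>)) m
       ((\<lambda>u. ((fst r, u), snd r u)) ` (fst r \<rightarrow>\<^sub>E A))"

text \<open>The input of the algorithm: the size of the alphabet, the forbidden patterns and the local rule.\<close>

definition codes_input ::
  "('g, 'b) monoid_scheme \<Rightarrow> nat \<Rightarrow> (nat \<Rightarrow> 'g) \<Rightarrow> 's set \<Rightarrow> ('s \<Rightarrow> nat) \<Rightarrow> nat \<Rightarrow>
     nat \<times> ('g set \<times> ('g \<Rightarrow> 's)) set \<times> 'g set \<times> (('g \<Rightarrow> 's) \<Rightarrow> 's) \<Rightarrow> bool"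
  where
  "codes_input G n h A \<sigma> =
     codes_pair (=) (codes_pair (codes_patterns G n h \<sigma>) (codes_rule G n h A \<sigma>))"

end

theory Submission
  imports Defs "HOL-Algebra.Multiplicative_Group"
begin

text \<open>The restriction of the graph of \<open>f\<close> to its second coordinate is \<open>Y\<close>, so memory sets for the graph are
  memory sets for \<open>Y\<close>, which is therefore an II-avoshift.

  For the algorithm, call a pair \<open>(u, v)\<close> of patterns on a finite set \<open>M\<close> legal if \<open>u\<close> contains no forbidden
  pattern and \<open>v\<close> obeys the local rule, as far as this can be seen inside \<open>M\<close>. The output consists of the
  patterns \<open>v\<close> for which there is no legal \<open>(u, v)\<close>, where \<open>M\<close> is found by searching for a finite certificate
  that they suffice. Such a certificate is a set \<open>E\<close> with the following property: for every inductive interval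
  \<open>C\<close> of negative exponents, if all translates \<open>gM\<close> with \<open>g \<in> E\<close> of a configuration \<open>y\<close> and of a partial
  preimage \<open>x\<close> defined on \<open>C\<close> extend to legal pairs, then \<open>x\<close> can be extended to the identity such that this
  remains true. It follows by translation and compactness that every \<open>y\<close> without forbidden patterns has a
  preimage, which is built coset by coset along the polycycle structure.

  Conversely, the memory sets of an avorelation can be chosen uniformly for all inductive intervals, since a
  tuple of intervals only has smaller tuples in its neighbourhood. With a uniform memory, locally valid
  partial configurations are globally valid, again by filling in cosets, and a compactness argument yields a
  certificate. As multiplication and exponents in \<open>G\<close> are computable, certificates can be recognised.\<close>


section \<open>Total recursive functions\<close>

text \<open>The memory sets of the graph cannot be computed from the patterns and the rule: the avo
  property is a promise, and only its consequences can be searched for. Soundness of a certificate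
  rests on \<open>X\<close> being of finite type and on \<open>f\<close> having a local rule; the
  avo property of the graph serves to show that the search ends.

  A certificate speaks about infinitely many intervals, but in the finite set \<open>E\<close> an
  interval is visible only through the depths that occur there, so truncating its exponents makes
  the condition decidable. Finite exponents suffice because the construction of a preimage passes
  through finite tuples only and reaches infinite unions of cosets as limits. In the converse
  direction infinite exponents are essential: they are the limit points that make the space of
  tuples compact, which is what yields a uniform memory.

  The group is fixed, so orders of factors, normal forms of powers and conjugations by generators
  may be built into the algorithm as constants.\<close>

definition total_rec :: "(nat \<Rightarrow> nat) \<Rightarrow> bool" where
  "total_rec f \<longleftrightarrow> partial_recursive (\<lambda>m. Some (f m))"

definition dec_pred :: "(nat \<Rightarrow> bool) \<Rightarrow> bool" where
  "dec_pred P \<longleftrightarrow> total_rec (\<lambda>m. of_bool (P m))"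

abbreviation pr1 :: "nat \<Rightarrow> nat" where "pr1 m \<equiv> fst (prod_decode m)"
abbreviation pr2 :: "nat \<Rightarrow> nat" where "pr2 m \<equiv> snd (prod_decode m)"

lemma total_rec_comp: "total_rec f \<Longrightarrow> total_rec g \<Longrightarrow> total_rec (\<lambda>m. f (g m))"
  unfolding total_rec_def using pr_comp[of "\<lambda>m. Some (f m)" "\<lambda>m. Some (g m)"] by simp

lemma total_rec_pair:
  "total_rec f \<Longrightarrow> total_rec g \<Longrightarrow> total_rec (\<lambda>m. prod_encode (f m, g m))"
  unfolding total_rec_def using pr_pair[of "\<lambda>m. Some (f m)" "\<lambda>m. Some (g m)"] by simp

lemma total_rec_fst: "total_rec f \<Longrightarrow> total_rec (\<lambda>m. fst (prod_decode (f m)))"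
  by (rule total_rec_comp[of pr1]) (auto simp: total_rec_def intro: partial_recursive.intros)

lemma total_rec_snd: "total_rec f \<Longrightarrow> total_rec (\<lambda>m. snd (prod_decode (f m)))"
  by (rule total_rec_comp[of pr2]) (auto simp: total_rec_def intro: partial_recursive.intros)

lemma total_rec_id: "total_rec (\<lambda>m. m)"
proof -
  have "total_rec (\<lambda>m. pr1 m)" "total_rec (\<lambda>m. pr2 m)"
    by (auto simp: total_rec_def intro: partial_recursive.intros)
  from total_rec_pair[OF this] show ?thesis by simp
qed

lemma total_rec_Suc: "total_rec f \<Longrightarrow> total_rec (\<lambda>m. Suc (f m))"
  by (rule total_rec_comp[of Suc]) (auto simp: total_rec_def intro: partial_recursive.intros)

lemma total_rec_const: "total_rec (\<lambda>_. c)"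
proof (induction c)
  case 0 then show ?case by (auto simp: total_rec_def intro: partial_recursive.intros)
qed (rule total_rec_Suc)

text \<open>The step function sees the parameter \<open>m\<close>, coded together with the index and
  the previous value, so that data need not be carried through the recursion.\<close>

lemma total_rec_rec_nat:
  assumes "total_rec f" "total_rec b" "total_rec (\<lambda>p. g (pr1 p) (pr1 (pr2 p)) (pr2 (pr2 p)))"
  shows "total_rec (\<lambda>m. rec_nat (f m) (g m) (b m))"
proof -
  let ?g = "\<lambda>p. Some (g (pr1 p) (pr1 (pr2 p)) (pr2 (pr2 p)))"
  have "pr_rec (\<lambda>m. Some (f m)) ?g m k = Some (rec_nat (f m) (g m) k)" for m k
    by (induction k) auto
  then have "total_rec (\<lambda>p. rec_nat (f (pr1 p)) (g (pr1 p)) (pr2 p))"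
    using assms pr_prim[of "\<lambda>m. Some (f m)" ?g] unfolding total_rec_def by simp
  from total_rec_comp[OF this total_rec_pair[OF total_rec_id assms(2)]] show ?thesis by simp
qed

text \<open>Recursiveness of a term is proved by following its syntax with these rules; recursions
  are therefore first rewritten with \<open>rec_nat\<close>, and finite searches with bounded
  quantifiers.\<close>

named_theorems rec_intros
lemmas [rec_intros] = total_rec_pair total_rec_fst total_rec_snd total_rec_id total_rec_Suc
  total_rec_const total_rec_rec_nat

lemma total_rec_add [rec_intros]:
  assumes "total_rec f" "total_rec g" shows "total_rec (\<lambda>m. f m + g m)"
proof -
  have eq: "x + y = rec_nat x (\<lambda>k r. Suc r) y" for x y by (induction y) auto
  show ?thesis unfolding eq by (intro rec_intros assms)
qed

lemma total_rec_mult [rec_intros]: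
  assumes "total_rec f" "total_rec g" shows "total_rec (\<lambda>m. f m * g m)"
proof -
  have eq: "x * y = rec_nat 0 (\<lambda>k r. r + x) y" for x y by (induction y) auto
  show ?thesis unfolding eq by (intro rec_intros assms total_rec_comp[OF assms(1)])
qed

lemma total_rec_pred:
  assumes "total_rec f" shows "total_rec (\<lambda>m. f m - 1)"
proof -
  have eq: "x - 1 = rec_nat 0 (\<lambda>k r. k) x" for x by (cases x) auto
  show ?thesis unfolding eq by (intro rec_intros assms)
qed

lemma total_rec_diff [rec_intros]:
  assumes "total_rec f" "total_rec g" shows "total_rec (\<lambda>m. f m - g m)"
proof -
  have eq: "rec_nat x (\<lambda>k r. r - 1) y = x - y" for x y :: nat by (induction y) auto
  have "total_rec (\<lambda>m. rec_nat (f m) (\<lambda>k r. r - 1) (g m))"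
    by (intro rec_intros assms total_rec_pred)
  then show ?thesis by (simp only: eq)
qed

lemma total_rec_power [rec_intros]:
  assumes "total_rec f" "total_rec g" shows "total_rec (\<lambda>m. f m ^ g m)"
proof -
  have eq: "x ^ y = rec_nat 1 (\<lambda>k r. r * x) y" for x y :: nat by (induction y) auto
  show ?thesis unfolding eq by (intro rec_intros assms total_rec_comp[OF assms(1)])
qed

lemma total_rec_of_bool [rec_intros]: "dec_pred P \<Longrightarrow> total_rec (\<lambda>m. of_bool (P m))"
  by (simp add: dec_pred_def)

lemma dec_pred_eq [rec_intros]:
  assumes "total_rec f" "total_rec g" shows "dec_pred (\<lambda>m. f m = g m)"
proof -
  have eq: "of_bool (x = y) = 1 - ((x - y) + (y - x))" for x y :: nat by auto
  show ?thesis unfolding dec_pred_def eq by (intro rec_intros assms)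
qed

lemma dec_pred_less [rec_intros]:
  assumes "total_rec f" "total_rec g" shows "dec_pred (\<lambda>m. f m < g m)"
proof -
  have eq: "of_bool (x < y) = 1 - (1 - (y - x))" for x y :: nat by auto
  show ?thesis unfolding dec_pred_def eq by (intro rec_intros assms)
qed

lemma dec_pred_not [rec_intros]: "dec_pred P \<Longrightarrow> dec_pred (\<lambda>m. \<not> P m)"
proof -
  assume P: "dec_pred P"
  have eq: "of_bool (\<not> x) = 1 - (of_bool x :: nat)" for x by auto
  show ?thesis unfolding dec_pred_def eq by (intro rec_intros P)
qed

lemma dec_pred_conj [rec_intros]:
  assumes "dec_pred P" "dec_pred Q" shows "dec_pred (\<lambda>m. P m \<and> Q m)"
proof -
  have eq: "of_bool (x \<and> y) = of_bool x * (of_bool y :: nat)" for x y by auto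
  show ?thesis unfolding dec_pred_def eq by (intro rec_intros assms)
qed

lemma dec_pred_const [rec_intros]: "dec_pred (\<lambda>_. c)"
  by (simp add: dec_pred_def total_rec_const)

lemma dec_pred_imp [rec_intros]:
  assumes "dec_pred P" "dec_pred Q" shows "dec_pred (\<lambda>m. P m \<longrightarrow> Q m)"
proof -
  have eq: "(x \<longrightarrow> y) = (\<not> (x \<and> \<not> y))" for x y by auto
  show ?thesis unfolding eq by (intro rec_intros assms)
qed

lemma total_rec_if [rec_intros]:
  assumes "dec_pred P" "total_rec f" "total_rec g"
  shows "total_rec (\<lambda>m. if P m then f m else g m)"
proof -
  have eq: "(if x then a else b) = of_bool x * a + of_bool (\<not> x) * (b::nat)" for x a b by auto
  show ?thesis unfolding eq by (intro rec_intros assms)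
qed

lemma dec_pred_ball [rec_intros]:
  assumes "total_rec b" "dec_pred (\<lambda>p. P (pr1 p) (pr2 p))"
  shows "dec_pred (\<lambda>m. \<forall>j<b m. P m j)"
proof -
  have eq: "of_bool (\<forall>j<n. Q j) = rec_nat (1::nat) (\<lambda>k r. of_bool (Q k) * r) n" for Q :: "nat \<Rightarrow> bool" and n :: nat
  proof (induction n)
    case (Suc n)
    have "of_bool (\<forall>j<Suc n. Q j) = of_bool (Q n) * (of_bool (\<forall>j<n. Q j) :: nat)"
      by (auto simp: less_Suc_eq)
    then show ?case using Suc by simp
  qed simp
  \<comment> \<open>Inside the recursor the body receives parameter, index and accumulator; it is
    pulled back along the map that drops the accumulator.\<close>
  have *: "dec_pred (\<lambda>p. P (pr1 p) (pr1 (pr2 p)))"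
    using total_rec_comp[OF assms(2)[unfolded dec_pred_def],
        of "\<lambda>p. prod_encode (pr1 p, pr1 (pr2 p))"]
    unfolding dec_pred_def by (simp add: rec_intros)
  show ?thesis unfolding dec_pred_def eq by (intro rec_intros assms(1) *)
qed

lemma dec_pred_bex [rec_intros]:
  assumes "total_rec b" "dec_pred (\<lambda>p. P (pr1 p) (pr2 p))"
  shows "dec_pred (\<lambda>m. \<exists>j<b m. P m j)"
proof -
  have eq: "(\<exists>j<n. Q j) = (\<not> (\<forall>j<n. \<not> Q j))" for Q and n :: nat by auto
  show ?thesis unfolding eq by (intro rec_intros assms)
qed

lemma dec_pred_comp: "dec_pred P \<Longrightarrow> total_rec f \<Longrightarrow> dec_pred (\<lambda>m. P (f m))"
  unfolding dec_pred_def by (rule total_rec_comp)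

lemma dec_pred_comp2:
  assumes "dec_pred (\<lambda>p. P (pr1 p) (pr2 p))" "total_rec f" "total_rec g"
  shows "dec_pred (\<lambda>m. P (f m) (g m))"
  using dec_pred_comp[OF assms(1) total_rec_pair[OF assms(2,3)]] by simp

lemma total_rec_mod [rec_intros]:
  assumes "total_rec f" "total_rec g" shows "total_rec (\<lambda>m. f m mod g m)"
proof -
  \<comment> \<open>For \<open>y = 0\<close> the counter is never reset, in agreement with
    \<open>x mod 0 = x\<close>.\<close>
  have eq: "x mod y = rec_nat 0 (\<lambda>k r. if Suc r = y then 0 else Suc r) x" for x y :: nat
    by (induction x) (auto simp: mod_Suc)
  show ?thesis unfolding eq by (intro rec_intros assms total_rec_comp[OF assms(2)])
qed

lemma total_rec_div [rec_intros]:
  assumes "total_rec f" "total_rec g" shows "total_rec (\<lambda>m. f m div g m)"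
proof -
  have eq: "x div y = rec_nat 0 (\<lambda>k r. if Suc (k mod y) = y then Suc r else r) x" for x y :: nat
  proof (induction x)
    case (Suc x)
    have *: "Suc x mod y = 0 \<longleftrightarrow> Suc (x mod y) = y" by (metis mod_Suc nat.distinct(1))
    have "Suc x div y = (if Suc (x mod y) = y then Suc (x div y) else x div y)"
      by (subst div_Suc, subst *) (rule refl)
    also have "\<dots> = rec_nat 0 (\<lambda>k r. if Suc (k mod y) = y then Suc r else r) (Suc x)"
      by (simp only: Suc.IH old.nat.simps)
    finally show ?case .
  qed (simp only: div_0 old.nat.simps)
  show ?thesis unfolding eq by (intro rec_intros assms total_rec_comp[OF assms(2)])
qed

section \<open>Digit sequences and list codes\<close>

definition digit :: "nat \<Rightarrow> nat \<Rightarrow> nat \<Rightarrow> nat" where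
  "digit q p i = p div q ^ i mod q"

lemma total_rec_digit [rec_intros]:
  assumes "total_rec f" "total_rec g" "total_rec h" shows "total_rec (\<lambda>m. digit (f m) (g m) (h m))"
  unfolding digit_def by (intro rec_intros assms)

lemma digit_less: "0 < q \<Longrightarrow> digit q p i < q"
  by (simp add: digit_def)

text \<open>Patterns over an alphabet of size \<open>q\<close> thereby become numbers below
  \<open>q ^ r\<close>, and a quantifier over all patterns becomes a bounded one.\<close>

lemma ex_digits:
  assumes "\<And>i. i < r \<Longrightarrow> u i < q"
  shows "\<exists>p<q ^ r. \<forall>i<r. digit q p i = u i"
  using assms
proof (induction r arbitrary: u)
  case (Suc r)
  then obtain p where p: "p < q ^ r" "\<And>i. i < r \<Longrightarrow> digit q p i = u (Suc i)"
    using Suc.IH[of "\<lambda>i. u (Suc i)"] Suc.prems by (metis Suc_less_eq)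
  have u0: "u 0 < q" using Suc.prems by simp
  \<comment> \<open>Horner's rule: \<open>u 0\<close> is the lowest digit and \<open>p\<close>
    carries the sequence shifted by one.\<close>
  have "digit q (u 0 + q * p) i = u i" if "i < Suc r" for i
  proof (cases i)
    case (Suc j)
    have "(u 0 + q * p) div q ^ Suc j = (u 0 + q * p) div q div q ^ j"
      by (simp add: div_mult2_eq)
    also have "\<dots> = p div q ^ j" using u0 by simp
    finally show ?thesis using p(2)[of j] that Suc by (simp add: digit_def)
  qed (use u0 in \<open>simp add: digit_def\<close>)
  moreover have "u 0 + q * p < q ^ Suc r"
  proof -
    have "u 0 + q * p < q * Suc p" using u0 by simp
    also have "\<dots> \<le> q * q ^ r" using p(1) by (intro mult_le_mono2) simp
    finally show ?thesis by simp
  qed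
  ultimately show ?case by blast
qed auto

text \<open>The code of a nonempty list is the successor of the pair of its head and its tail.\<close>

definition drop_code :: "nat \<Rightarrow> nat \<Rightarrow> nat" where
  "drop_code c i = rec_nat c (\<lambda>_ r. pr2 (r - 1)) i"

definition nth_code :: "nat \<Rightarrow> nat \<Rightarrow> nat" where
  "nth_code c i = pr1 (drop_code c i - 1)"

text \<open>A list is never longer than its code, so the code itself bounds the recursion; the steps
  counted are those \<open>k\<close> after which something is left of the list.\<close>

definition length_code :: "nat \<Rightarrow> nat" where
  "length_code c = rec_nat 0 (\<lambda>k r. if drop_code c k = 0 then r else Suc r) c"

lemma total_rec_drop_code [rec_intros]:
  "total_rec f \<Longrightarrow> total_rec g \<Longrightarrow> total_rec (\<lambda>m. drop_code (f m) (g m))"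
  unfolding drop_code_def by (intro rec_intros)

lemma total_rec_nth_code [rec_intros]:
  "total_rec f \<Longrightarrow> total_rec g \<Longrightarrow> total_rec (\<lambda>m. nth_code (f m) (g m))"
  unfolding nth_code_def by (intro rec_intros)

lemma total_rec_length_code [rec_intros]:
  assumes "total_rec f" shows "total_rec (\<lambda>m. length_code (f m))"
  unfolding length_code_def by (intro rec_intros assms total_rec_comp[OF assms])

lemma drop_code_list_encode: "drop_code (list_encode xs) i = list_encode (drop i xs)"
proof (induction i)
  case (Suc i)
  have "pr2 (list_encode ys - 1) = list_encode (tl ys)" for ys
  proof (cases ys)
    case Nil
    \<comment> \<open>The truncated predecessor of the empty list's code 0 is again 0, so dropping
      from an empty list leaves it empty.\<close>
    have "prod_decode 0 = (0, 0)" by (simp add: prod_decode_def prod_decode_aux.simps)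
    with Nil show ?thesis by simp
  qed simp
  then show ?case using Suc by (simp add: drop_code_def drop_Suc tl_drop)
qed (simp add: drop_code_def)

lemma nth_code_list_encode: "i < length xs \<Longrightarrow> nth_code (list_encode xs) i = xs ! i"
  by (simp add: nth_code_def drop_code_list_encode flip: Cons_nth_drop_Suc)

lemma length_le_list_encode: "length xs \<le> list_encode xs"
proof (induction xs)
  case (Cons x xs)
  then show ?case using le_prod_encode_2[of "list_encode xs" x] by simp
qed simp

lemma length_code_list_encode: "length_code (list_encode xs) = length xs"
proof -
  have nz: "list_encode ys = 0 \<longleftrightarrow> ys = []" for ys by (cases ys) auto
  have "rec_nat 0 (\<lambda>k r. if drop_code (list_encode xs) k = 0 then r else Suc r) n = min n (length xs)" for n
    by (induction n) (auto simp: drop_code_list_encode nz)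
  then show ?thesis by (simp add: length_code_def length_le_list_encode min_absorb2)
qed

lemma length_code_eq: "length_code c = length (list_decode c)"
  by (metis length_code_list_encode list_decode_inverse)

lemma nth_code_eq: "i < length (list_decode c) \<Longrightarrow> nth_code c i = list_decode c ! i"
  by (metis nth_code_list_encode list_decode_inverse)

lemma set_list_decode: "set (list_decode c) = nth_code c ` {..<length_code c}"
  by (auto simp: set_conv_nth length_code_eq nth_code_eq)

text \<open>Minimisation demands a defined, nonzero value at every smaller argument. A decidable
  predicate provides it, with 0 standing for truth.\<close>

lemma partial_recursive_search:
  assumes "dec_pred (\<lambda>p. P (pr1 p) (pr2 p))"
  obtains F where "partial_recursive F"
    "\<And>m. \<exists>k. P m k \<Longrightarrow> \<exists>k. P m k \<and> F m = Some k"
proof -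
  let ?f = "\<lambda>p. Some (of_bool (\<not> P (pr1 p) (pr2 p)) :: nat)"
  have pr: "partial_recursive (pr_mu ?f)"
    using dec_pred_not[OF assms] by (intro pr_min) (simp add: dec_pred_def total_rec_def)
  have "\<exists>k. P m k \<and> pr_mu ?f m = Some k" if ex: "\<exists>k. P m k" for m
  proof -
    define Q where "Q k \<longleftrightarrow> P m k \<and> (\<forall>j<k. \<not> P m j)" for k
    have "Q (LEAST k. P m k)" unfolding Q_def using ex LeastI_ex not_less_Least by blast
    moreover have "\<exists>!k. Q k" unfolding Q_def using ex exists_least_iff[of "P m"]
      by (metis linorder_neqE_nat)
    ultimately have "(THE k. Q k) = (LEAST k. P m k)" and "\<exists>k. Q k" by (auto intro: the1_equality)
    moreover have "pr_mu ?f m = (if \<exists>k. Q k then Some (THE k. Q k) else None)"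
      unfolding pr_mu_def Let_def Q_def by simp
    ultimately show ?thesis using \<open>Q (LEAST k. P m k)\<close> \<open>\<exists>k. Q k\<close>
      unfolding Q_def by metis
  qed
  with pr that show ?thesis by blast
qed

section \<open>Polycycle structures\<close>

locale polycyclic =
  fixes G :: "('g, 'b) monoid_scheme" (structure)
    and n :: nat and H :: "nat \<Rightarrow> 'g set" and h :: "nat \<Rightarrow> 'g"
  assumes polycycle: "polycycle G n H h"
begin

sublocale group G
  using polycycle by (simp add: polycycle_def)

abbreviation gen :: "nat \<Rightarrow> 'g" where "gen i \<equiv> h (Suc i)"
abbreviation ord_factor :: "nat \<Rightarrow> nat" where "ord_factor i \<equiv> cyc_order G H (Suc i)"

lemma H_0 [simp]: "H 0 = {\<one>}"
  using polycycle by (simp add: polycycle_def)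

lemma H_n [simp]: "H n = carrier G"
  using polycycle by (simp add: polycycle_def)

lemma polycycle_step:
  assumes "i < n"
  shows "subgroup (H (Suc i)) G" "H i \<lhd> G\<lparr>carrier := H (Suc i)\<rparr>" "gen i \<in> H (Suc i)"
    "carrier (cyc_factor G H (Suc i)) = generate (cyc_factor G H (Suc i)) {gen i <# H i}"
proof -
  have "Suc i \<in> {1..n}" using assms by simp
  then show "subgroup (H (Suc i)) G" "H i \<lhd> G\<lparr>carrier := H (Suc i)\<rparr>" "gen i \<in> H (Suc i)"
    "carrier (cyc_factor G H (Suc i)) = generate (cyc_factor G H (Suc i)) {gen i <# H i}"
    using polycycle unfolding polycycle_def by (metis diff_Suc_1)+
qed

lemma subgroup_H: "i \<le> n \<Longrightarrow> subgroup (H i) G"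
proof (cases i)
  case 0
  then show ?thesis using triv_subgroup by simp
qed (simp add: polycycle_step)

lemma H_subset: "i \<le> n \<Longrightarrow> H i \<subseteq> carrier G"
  by (simp add: subgroup_H subgroup.subset)

lemma gen_carrier [simp]: "i < n \<Longrightarrow> gen i \<in> carrier G"
  using polycycle_step(3) H_subset[of "Suc i"] by auto

lemma H_Suc_mono: "i < n \<Longrightarrow> H i \<subseteq> H (Suc i)"
  using normal_imp_subgroup[OF polycycle_step(2)] subgroup.subset by fastforce

lemma H_mono: "i \<le> j \<Longrightarrow> j \<le> n \<Longrightarrow> H i \<subseteq> H j"
proof (induction j rule: dec_induct)
  case (step j)
  then show ?case using H_Suc_mono[of j] by force
qed simp

lemma gen_pow_H: "i < n \<Longrightarrow> gen i [^] (s::int) \<in> H (Suc i)"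
  using polycycle_step(1,3) subgroup_int_pow_closed by blast

lemma conj_H:
  assumes "i < n" "x \<in> H (Suc i)" "u \<in> H i"
  shows "x \<otimes> u \<otimes> inv x \<in> H i" "inv x \<otimes> u \<otimes> x \<in> H i"
proof -
  let ?K = "G\<lparr>carrier := H (Suc i)\<rparr>"
  have inv: "inv\<^bsub>?K\<^esub> x = inv x" using assms polycycle_step m_inv_consistent by blast
  have "x \<otimes>\<^bsub>?K\<^esub> u \<otimes>\<^bsub>?K\<^esub> inv\<^bsub>?K\<^esub> x \<in> H i" "inv\<^bsub>?K\<^esub> x \<otimes>\<^bsub>?K\<^esub> u \<otimes>\<^bsub>?K\<^esub> x \<in> H i"
    using assms polycycle_step(2)[OF assms(1)] normal.inv_op_closed1 normal.inv_op_closed2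
    by fastforce+
  then show "x \<otimes> u \<otimes> inv x \<in> H i" "inv x \<otimes> u \<otimes> x \<in> H i" by (simp_all add: inv)
qed

text \<open>Both \<open>group.ord\<close> and \<open>order\<close> take the value 0 in the infinite
  case, so one equation covers finite and infinite factors.\<close>

lemma factor_group:
  assumes "i < n"
  defines "K \<equiv> G\<lparr>carrier := H (Suc i)\<rparr>" and "Q \<equiv> cyc_factor G H (Suc i)"
  shows "group Q" "gen i <# H i \<in> carrier Q"
    "(gen i <# H i) [^]\<^bsub>Q\<^esub> (s::int) = H i #>\<^bsub>K\<^esub> gen i [^] s"
    "group.ord Q (gen i <# H i) = ord_factor i"
    "carrier Q = range (\<lambda>s::int. (gen i <# H i) [^]\<^bsub>Q\<^esub> s)"
proof -
  note st = polycycle_step[OF assms(1)]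
  interpret N: normal "H i" K using st(2) by (simp add: K_def)
  have Q: "Q = K Mod H i" by (simp add: Q_def cyc_factor_def K_def)
  show grp: "group Q" unfolding Q by (rule N.factorgroup_is_group)
  have aK: "gen i \<in> carrier K" using st(3) by (simp add: K_def)
  have coset: "gen i <# H i = H i #>\<^bsub>K\<^esub> gen i"
    using N.coset_eq aK by (simp add: l_coset_def K_def)
  show mem: "gen i <# H i \<in> carrier Q"
    unfolding coset Q using aK by (auto simp: FactGroup_def RCOSETS_def)
  show pow: "(gen i <# H i) [^]\<^bsub>Q\<^esub> (s::int) = H i #>\<^bsub>K\<^esub> gen i [^] s" for s
    unfolding coset Q using N.FactGroup_int_pow[OF aK, of s] int_pow_consistent[OF st(1) st(3)]
    by (simp add: K_def)
  interpret Q: group Q by (rule grp)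
  have gen: "carrier Q = generate Q {gen i <# H i}" using st(4) by (simp add: Q_def)
  then show "carrier Q = range (\<lambda>s::int. (gen i <# H i) [^]\<^bsub>Q\<^esub> s)"
    using Q.generate_pow[OF mem] by (auto simp: full_SetCompr_eq)
  show "Q.ord (gen i <# H i) = ord_factor i"
    using Q.generate_pow_card[OF mem] gen by (simp add: cyc_order_def Q_def order_def)
qed

text \<open>Divisibility by 0 means being 0; hence infinite factors need no separate
  treatment.\<close>

lemma gen_pow_mem_iff:
  assumes "i < n"
  shows "gen i [^] (s::int) \<in> H i \<longleftrightarrow> int (ord_factor i) dvd s"
proof -
  let ?K = "G\<lparr>carrier := H (Suc i)\<rparr>" and ?Q = "cyc_factor G H (Suc i)"
  note st = polycycle_step[OF assms(1)]
  interpret N: normal "H i" ?K by (rule st(2))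
  interpret Q: group ?Q by (rule factor_group[OF assms])
  have "int (ord_factor i) dvd s \<longleftrightarrow> (gen i <# H i) [^]\<^bsub>?Q\<^esub> s = \<one>\<^bsub>?Q\<^esub>"
    using Q.int_pow_eq_id factor_group(2,4)[OF assms] by simp
  also have "\<dots> \<longleftrightarrow> H i #>\<^bsub>?K\<^esub> gen i [^] s = H i"
    unfolding factor_group(3)[OF assms] by (simp add: cyc_factor_def)
  also have "\<dots> \<longleftrightarrow> gen i [^] s \<in> H i"
    using N.coset_join1 N.coset_join2 N.is_subgroup N.subset gen_pow_H[OF assms, of s]
    by (metis partial_object.select_convs(1) partial_object.surjective partial_object.update_convs(1))
  finally show ?thesis by simp
qed

section \<open>Cosets of a subgroup of the chain in the next one\<close>

definition coset :: "nat \<Rightarrow> int \<Rightarrow> 'g set" where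
  "coset i s = gen i [^] s <# H i"

lemma coset_iff:
  assumes "i < n"
  shows "g \<in> coset i s \<longleftrightarrow> g \<in> carrier G \<and> inv (gen i [^] s) \<otimes> g \<in> H i"
proof -
  have c: "gen i [^] s \<in> carrier G" using assms by simp
  show ?thesis
  proof
    assume "g \<in> coset i s"
    then obtain u where "u \<in> H i" "g = gen i [^] s \<otimes> u" by (auto simp: coset_def l_coset_def)
    then show "g \<in> carrier G \<and> inv (gen i [^] s) \<otimes> g \<in> H i"
      using c H_subset[of i] assms by (auto simp: m_assoc[symmetric])
  next
    assume "g \<in> carrier G \<and> inv (gen i [^] s) \<otimes> g \<in> H i"
    then show "g \<in> coset i s" using c unfolding coset_def l_coset_def
      by (auto simp: m_assoc[symmetric] intro!: bexI[of _ "inv (gen i [^] s) \<otimes> g"])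
  qed
qed

lemma cosetI: "u \<in> H i \<Longrightarrow> gen i [^] s \<otimes> u \<in> coset i s"
  by (auto simp: coset_def l_coset_def)

lemma cosetE:
  assumes "g \<in> coset i s" obtains u where "u \<in> H i" "g = gen i [^] s \<otimes> u"
  using assms by (auto simp: coset_def l_coset_def)

lemma coset_subset: "i < n \<Longrightarrow> coset i s \<subseteq> H (Suc i)"
  using gen_pow_H H_Suc_mono subgroup.m_closed[OF polycycle_step(1)]
  by (fastforce simp: coset_def l_coset_def)

lemma coset_carrier: "i < n \<Longrightarrow> coset i s \<subseteq> carrier G"
  using coset_subset H_subset[of "Suc i"] by fastforce

lemma coset_0: "i < n \<Longrightarrow> coset i 0 = H i"
  using H_subset[of i] by (force simp: coset_def l_coset_def)

lemma coset_translate: "i < n \<Longrightarrow> gen i [^] (r::int) <# coset i s = coset i (r + s)"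
  unfolding coset_def using H_subset[of i] by (simp add: lcos_m_assoc int_pow_mult)

text \<open>Normality makes each coset a right coset of \<open>H j\<close> as well, and
  \<open>g\<close> lies in \<open>H j\<close>. Thus motions at low levels leave the higher levels in
  place.\<close>

lemma coset_invariant:
  assumes "i \<le> j" "j < n" "g \<in> H i"
  shows "g <# coset j s = coset j s"
proof -
  have sub: "g' <# coset j s \<subseteq> coset j s" if g': "g' \<in> H j" for g'
  proof
    fix x assume "x \<in> g' <# coset j s"
    then obtain u where u: "u \<in> H j" "x = g' \<otimes> (gen j [^] s \<otimes> u)"
      by (auto simp: coset_def l_coset_def)
    let ?a = "gen j [^] s"
    have c: "?a \<in> carrier G" "u \<in> carrier G" "g' \<in> carrier G"
      using assms u(1) g' H_subset[of j] by auto
    have "x = ?a \<otimes> ((inv ?a \<otimes> g' \<otimes> ?a) \<otimes> u)"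
      using c u by (simp add: m_assoc[symmetric])
    moreover have "(inv ?a \<otimes> g' \<otimes> ?a) \<otimes> u \<in> H j"
      using conj_H(2)[OF assms(2) gen_pow_H[OF assms(2)] g'] u(1) subgroup_H[of j] assms(2)
      by (auto intro: subgroup.m_closed)
    ultimately show "x \<in> coset j s" by (simp add: cosetI)
  qed
  have g: "g \<in> H j" using assms H_mono[of i j] by auto
  then have ig: "inv g \<in> H j" using subgroup_H[of j] assms by (simp add: subgroup.m_inv_closed)
  have gc: "g \<in> carrier G" using g H_subset[of j] assms by auto
  have "coset j s = g <# (inv g <# coset j s)"
    using gc coset_carrier[OF assms(2)] by (simp add: lcos_m_assoc lcos_mult_one)
  also have "\<dots> \<subseteq> g <# coset j s" using sub[OF ig] by (auto simp: l_coset_def)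
  finally show ?thesis using sub[OF g] by auto
qed

lemma coset_eq_iff:
  assumes "i < n" "g \<in> coset i s"
  shows "g \<in> coset i r \<longleftrightarrow> int (ord_factor i) dvd s - r"
proof -
  have gc: "g \<in> carrier G" and c: "\<And>s::int. gen i [^] s \<in> carrier G"
    using assms coset_carrier by auto
  obtain u where u: "u \<in> H i" "g = gen i [^] s \<otimes> u" using assms(2) by (rule cosetE)
  have uc: "u \<in> carrier G" using u(1) H_subset[of i] assms(1) by auto
  interpret S: subgroup "H i" G using assms(1) by (simp add: subgroup_H)
  have eq: "inv (gen i [^] r) \<otimes> g = gen i [^] (s - r) \<otimes> u"
  proof -
    have "gen i [^] (s - r) = inv (gen i [^] r) \<otimes> gen i [^] s"
      using assms(1) int_pow_mult[of "gen i" "-r" s] by (simp add: int_pow_neg)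
    then show ?thesis using u c uc by (simp add: m_assoc)
  qed
  have "gen i [^] (s - r) \<otimes> u \<in> H i \<longleftrightarrow> gen i [^] (s - r) \<in> H i"
  proof
    assume "gen i [^] (s - r) \<otimes> u \<in> H i"
    then have "(gen i [^] (s - r) \<otimes> u) \<otimes> inv u \<in> H i" using u(1) by simp
    then show "gen i [^] (s - r) \<in> H i" using c uc by (simp add: m_assoc)
  qed (use u(1) in simp)
  then show ?thesis using gc by (simp add: coset_iff assms(1) eq gen_pow_mem_iff)
qed

lemma coset_cong:
  assumes "i < n" "int (ord_factor i) dvd s - r"
  shows "coset i s = coset i r"
  using assms coset_eq_iff dvd_diff_commute by blast

lemma H_Suc_eq: assumes "i < n" shows "H (Suc i) = (\<Union>s. coset i s)"
proof -
  let ?K = "G\<lparr>carrier := H (Suc i)\<rparr>" and ?Q = "cyc_factor G H (Suc i)"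
  note st = polycycle_step[OF assms(1)]
  interpret N: normal "H i" ?K by (rule st(2))
  have "g \<in> (\<Union>s. coset i s)" if g: "g \<in> H (Suc i)" for g
  proof -
    have "H i #>\<^bsub>?K\<^esub> g \<in> carrier ?Q"
      using g by (auto simp: cyc_factor_def FactGroup_def RCOSETS_def)
    then obtain s :: int where "H i #>\<^bsub>?K\<^esub> g = H i #>\<^bsub>?K\<^esub> gen i [^] s"
      using factor_group(3,5)[OF assms] by auto
    moreover have "g \<in> H i #>\<^bsub>?K\<^esub> g"
      using N.rcos_self[OF _ N.is_subgroup, of g] g by simp
    moreover have "H i #>\<^bsub>?K\<^esub> gen i [^] s = gen i [^] s <# H i"
      using N.coset_eq gen_pow_H[OF assms, of s] by (simp add: l_coset_def)
    ultimately show ?thesis by (auto simp: coset_def)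
  qed
  then show ?thesis using coset_subset[OF assms] by blast
qed

section \<open>Inductive intervals of negative exponents\<close>

text \<open>Levels are counted from \<open>0\<close>, so that level \<open>i\<close> refers to the factor with generator \<^term>\<open>h (Suc i)\<close>.\<close>

definition depth :: "'g \<Rightarrow> nat \<Rightarrow> nat \<Rightarrow> bool" where
  "depth g i t \<longleftrightarrow> i < n \<and> 1 \<le> t \<and> (ord_factor i = 0 \<or> t < ord_factor i) \<and> g \<in> coset i (- int t)"

text \<open>The inequality is strict: at level \<open>i\<close> the values 0 and 1 give the empty
  interval, \<open>Suc m\<close> gives the exponents from \<open>-m\<close> to \<open>-1\<close>,
  and infinity gives all depths. In a finite factor every nontrivial residue has a depth; in an
  infinite one only negative exponents do.\<close>

definition lower :: "(nat \<Rightarrow> enat) \<Rightarrow> 'g set" where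
  "lower mv = {g. \<exists>i t. depth g i t \<and> enat t < mv i}"

lemma depth_not_H: assumes "depth g i t" shows "g \<in> H (Suc i)" "g \<notin> H i"
proof -
  show "g \<in> H (Suc i)" using assms coset_subset by (auto simp: depth_def)
  have "\<not> ord_factor i dvd t" using assms by (auto simp: depth_def dest: dvd_imp_le)
  then have "\<not> int (ord_factor i) dvd - int t - 0" by simp
  then show "g \<notin> H i"
    using assms coset_eq_iff[of i g "- int t" 0] by (auto simp: depth_def coset_0)
qed

lemma depth_unique:
  assumes "depth g i t" "depth g i' t'"
  shows "i = i' \<and> t = t'"
proof -
  have "\<not> i < i'" if "depth g i t" "depth g i' t'" for i i' t t'
  proof
    assume "i < i'"
    then have "H (Suc i) \<subseteq> H i'" using that by (intro H_mono) (auto simp: depth_def)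
    then show False using that depth_not_H by blast
  qed
  then have i: "i = i'" using assms by (metis linorder_neqE_nat)
  have "g \<in> coset i (- int t)" "g \<in> coset i (- int t')" "i < n"
    using assms i by (auto simp: depth_def)
  then have "int (ord_factor i) dvd - int t - - int t'"
    using coset_eq_iff by blast
  moreover have "- int t - - int t' = int t' - int t" by simp
  ultimately have "int (ord_factor i) dvd int t' - int t" by metis
  moreover have "\<bar>int t' - int t\<bar> < int (ord_factor i)" if "ord_factor i \<noteq> 0"
    using assms i that by (auto simp: depth_def)
  ultimately have "int t' - int t = 0"
    using dvd_imp_le_int[of "int t' - int t" "int (ord_factor i)"] by (cases "ord_factor i = 0") force+
  then show ?thesis using i by simp
qed

lemma depth_carrier: "depth g i t \<Longrightarrow> g \<in> carrier G"
  using coset_carrier by (auto simp: depth_def)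

lemma lower_carrier: "lower mv \<subseteq> carrier G"
  by (auto simp: lower_def dest: depth_carrier)

lemma one_not_lower: "\<one> \<notin> lower mv"
proof
  assume "\<one> \<in> lower mv"
  then obtain i t where d: "depth \<one> i t" by (auto simp: lower_def)
  then have "\<one> \<in> H i" using subgroup_H[of i] by (auto simp: depth_def subgroup.one_closed)
  with depth_not_H(2)[OF d] show False by simp
qed

lemma lower_mono: "(\<And>i. mv i \<le> mv' i) \<Longrightarrow> lower mv \<subseteq> lower mv'"
  unfolding lower_def using order.strict_trans2 by blast

text \<open>The algorithm draws on the avo conditions through these sets alone. Intervals of
  positive exponents can be avoided because a coset that is to be filled can be translated onto the
  subgroup.\<close>

lemma inductive_interval_lower: "inductive_interval G n H h (lower mv)"
proof -
  define J where "J i = {- int t | t. 1 \<le> t \<and> (ord_factor i = 0 \<or> t < ord_factor i) \<and> enat t < mv i}" for i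
  \<comment> \<open>Intervals are indexed from 1 in the definition and levels from 0, hence the
    shift by one.\<close>
  define I where "I i = (\<lambda>s. s mod int (cyc_order G H i)) ` J (i - 1)" for i
  have graz: "grazing_interval (cyc_order G H j) (I j)" if j: "j \<in> {1..n}" for j
  proof -
    obtain i where i: "j = Suc i" using j by (cases j) auto
    show ?thesis
    proof (cases "ord_factor i = 0")
      case True
      have Ieq: "I j = J i" using True by (simp add: I_def i)
      show ?thesis
      proof (cases "mv i")
        case infinity
        have "J i = {..-1}"
        proof -
          have "s \<in> J i" if "s \<le> -1" for s
            unfolding J_def using that True infinity by (auto intro!: exI[of _ "nat (- s)"])
          then show ?thesis by (auto simp: J_def)
        qed
        then show ?thesis using True Ieq by (simp add: grazing_interval_def i)
      next
        case (enat m)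
        have "J i = {- (int m - 1) .. -1}"
        proof -
          have "s \<in> J i" if "s \<le> -1" "- (int m - 1) \<le> s" for s
            unfolding J_def using that True enat by (auto intro!: exI[of _ "nat (- s)"])
          then show ?thesis using enat by (auto simp: J_def)
        qed
        moreover have "{- (int m - 1) .. -1} = {} \<or> int m - 1 \<ge> 1" by auto
        ultimately have "I j = {} \<or> (\<exists>m\<ge>1. I j = {-m..-1})" using Ieq by metis
        then show ?thesis using True unfolding grazing_interval_def i by auto
      qed
    next
      case False
      have int: "int_interval (J i)"
        unfolding int_interval_def
      proof (intro ballI subsetI)
        fix a b x assume *: "a \<in> J i" "b \<in> J i" "x \<in> {a..b}"
        then obtain t u where t: "a = - int t" "t < ord_factor i" "enat t < mv i" "b = - int u" "1 \<le> u"
          using False by (auto simp: J_def)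
        have "nat (- x) \<le> t" using * t by auto
        then have "enat (nat (- x)) < mv i" using t(3) by (meson enat_ord_simps(1) order_le_less_trans)
        moreover have "x = - int (nat (- x))" "1 \<le> nat (- x)" "nat (- x) < ord_factor i" using * t by auto
        ultimately show "x \<in> J i" unfolding J_def by blast
      qed
      have I: "I (Suc i) = (\<lambda>s. s mod int (ord_factor i)) ` J i" by (simp add: I_def)
      have "0 \<notin> I (Suc i)"
      proof
        assume "0 \<in> I (Suc i)"
        then have "\<exists>s\<in>J i. 0 = s mod int (ord_factor i)" by (simp only: I image_iff)
        then obtain s where s: "s \<in> J i" "s mod int (ord_factor i) = 0" by (elim bexE) (metis)
        then obtain t where t: "1 \<le> t" "t < ord_factor i" "s = - int t"
          using False unfolding J_def by blast
        then have "int (ord_factor i) dvd int t" using s(2) by (simp add: mod_eq_0_iff_dvd)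
        then show False using t by (auto dest: dvd_imp_le)
      qed
      moreover have "- 1 mod int (ord_factor i) \<in> I (Suc i)" if ne: "I (Suc i) \<noteq> {}"
      proof -
        obtain t where t: "1 \<le> t" "t < ord_factor i" "enat t < mv i"
          using ne False by (auto simp: I J_def)
        have "enat 1 < mv i" using t by (meson enat_ord_simps(1) order_le_less_trans)
        then have "- int 1 \<in> J i" unfolding J_def using t by fastforce
        then show ?thesis unfolding I by force
      qed
      ultimately show ?thesis using False int I unfolding grazing_interval_def i by auto
    qed
  qed
  have eq: "g \<in> lower mv \<longleftrightarrow> g \<in> carrier G \<and> g \<noteq> \<one> \<and> (let i = (LEAST i. g \<in> H i) in
                \<exists>t::int. g \<in> (h i [^] t) <# H (i - 1) \<and> t mod int (cyc_order G H i) \<in> I i)"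
    (is "_ \<longleftrightarrow> ?R") for g
  proof
    assume "g \<in> lower mv"
    then obtain i t where d: "depth g i t" and t: "enat t < mv i" by (auto simp: lower_def)
    have i: "i < n" using d by (simp add: depth_def)
    have least: "(LEAST i. g \<in> H i) = Suc i"
    proof (rule Least_equality)
      fix y assume "g \<in> H y"
      then show "Suc i \<le> y" using H_mono[of y i] depth_not_H(2)[OF d] i by (meson in_mono less_Suc_eq_le less_imp_le_nat not_less)
    qed (rule depth_not_H(1)[OF d])
    have "- int t \<in> J i" using d t by (auto simp: depth_def J_def)
    then have "\<exists>t::int. g \<in> gen i [^] t <# H i \<and> t mod int (ord_factor i) \<in> I (Suc i)"
      using d by (auto simp: depth_def coset_def I_def intro!: exI[of _ "- int t"])
    then show ?R using depth_carrier[OF d] \<open>g \<in> lower mv\<close> one_not_lower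
      by (auto simp: least Let_def)
  next
    assume R: ?R
    define L where "L = (LEAST i. g \<in> H i)"
    have "g \<in> H n" using R by simp
    then have L: "g \<in> H L" "L \<le> n"
      unfolding L_def by (rule LeastI[of "\<lambda>i. g \<in> H i"], rule Least_le[of "\<lambda>i. g \<in> H i"])
    have "L \<noteq> 0" using L R by (metis H_0 singletonD)
    then obtain i where i: "L = Suc i" by (cases L) auto
    obtain t :: int where t: "g \<in> coset i t" "t mod int (ord_factor i) \<in> I (Suc i)"
      using R unfolding L_def[symmetric] Let_def i by (auto simp: coset_def)
    then obtain u where u: "t mod int (ord_factor i) = (- int u) mod int (ord_factor i)" "1 \<le> u"
      "ord_factor i = 0 \<or> u < ord_factor i" "enat u < mv i" by (auto simp: I_def J_def)
    have "coset i t = coset i (- int u)"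
      using u(1) L(2) i by (intro coset_cong) (auto simp: mod_eq_dvd_iff)
    then have "depth g i u" using u t L i by (simp add: depth_def)
    then show "g \<in> lower mv" using u(4) by (auto simp: lower_def)
  qed
  show ?thesis
    unfolding inductive_interval_def using graz eq by (intro exI[of _ I]) (auto simp: Let_def)
qed

end

context polycyclic
begin

lemma lower_eq_UN:
  "lower mv = (\<Union>(j, t)\<in>{(j, t). j < n \<and> 1 \<le> t \<and> (ord_factor j = 0 \<or> t < ord_factor j) \<and> enat t < mv j}.
     coset j (- int t))"
  by (auto simp: lower_def depth_def)

lemma l_coset_UN: "g <# (\<Union>x\<in>I. B x) = (\<Union>x\<in>I. g <# B x)"
  by (auto simp: l_coset_def)

lemma l_coset_Un: "g <# (B \<union> C) = (g <# B) \<union> (g <# C)"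
  by (auto simp: l_coset_def)

text \<open>Only cosets at levels \<open>i\<close> and above contribute to \<open>lower mv\<close>,
  and each of them is invariant under \<open>H i\<close>.\<close>

lemma lower_invariant:
  assumes "i \<le> n" "\<And>j. j < i \<Longrightarrow> mv j = 0" "g \<in> H i"
  shows "g <# lower mv = lower mv"
proof -
  have "i \<le> j" if "enat t < mv j" for j t using that assms(2)[of j] by (metis not_less not_less_zero)
  then have "g <# coset j (- int t) = coset j (- int t)" if "j < n" "enat t < mv j" for j t
    using that coset_invariant assms(3) by blast
  then show ?thesis unfolding lower_eq_UN l_coset_UN by (intro SUP_cong refl) auto
qed

lemma lower_upd:
  assumes "i < n" "mv i = 0" "ord_factor i = 0 \<or> m < ord_factor i"
  shows "lower (mv(i := enat (Suc m))) = lower mv \<union> (\<Union>t\<in>{1..m}. coset i (- int t))"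
proof -
  have "depth g i t \<longleftrightarrow> g \<in> coset i (- int t)" if "t \<in> {1..m}" for g t
    using that assms by (auto simp: depth_def)
  then have "g \<in> (\<Union>t\<in>{1..m}. coset i (- int t)) \<longleftrightarrow> (\<exists>t\<in>{1..m}. depth g i t)" for g by auto
  moreover have "g \<in> lower (mv(i := enat (Suc m))) \<longleftrightarrow> g \<in> lower mv \<or> (\<exists>t\<in>{1..m}. depth g i t)" for g
  proof
    assume "g \<in> lower (mv(i := enat (Suc m)))"
    then obtain j t where "depth g j t" "enat t < (mv(i := enat (Suc m))) j" by (auto simp: lower_def)
    then show "g \<in> lower mv \<or> (\<exists>t\<in>{1..m}. depth g i t)"
      by (cases "j = i") (auto simp: lower_def depth_def)
  next
    assume "g \<in> lower mv \<or> (\<exists>t\<in>{1..m}. depth g i t)"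
    then show "g \<in> lower (mv(i := enat (Suc m)))"
    proof
      assume "g \<in> lower mv"
      then obtain j t where "depth g j t" "enat t < mv j" by (auto simp: lower_def)
      moreover from this have "j \<noteq> i" using assms(2) by auto
      ultimately show ?thesis by (auto simp: lower_def)
    next
      assume "\<exists>t\<in>{1..m}. depth g i t"
      then show ?thesis by (force simp: lower_def)
    qed
  qed
  ultimately have *: "g \<in> lower (mv(i := enat (Suc m))) \<longleftrightarrow>
      g \<in> lower mv \<union> (\<Union>t\<in>{1..m}. coset i (- int t))" for g
    by (simp only: Un_iff)
  show ?thesis by (rule Set.set_eqI, rule *)
qed

text \<open>The generator moves exponent \<open>-t\<close> to \<open>-(t - 1)\<close>, so the first
  block lands on \<open>H i\<close>. Read backwards, filling \<open>H i\<close> beside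
  \<open>m\<close> blocks is the same as creating one more block.\<close>

lemma block_translate:
  assumes "i < n" "\<And>j. j \<le> i \<Longrightarrow> mv j = 0"
  shows "gen i <# (lower mv \<union> (\<Union>t\<in>{1..Suc m}. coset i (- int t))) =
    lower mv \<union> (\<Union>t\<in>{1..m}. coset i (- int t)) \<union> H i"
proof -
  have "gen i <# lower mv = lower mv"
    using assms polycycle_step(3) by (intro lower_invariant[of "Suc i"]) auto
  moreover have "gen i <# coset i (- int t) = coset i (- int (t - 1))" if "t \<in> {1..Suc m}" for t
    using coset_translate[OF assms(1), of 1 "- int t"] assms(1) that by (simp add: of_nat_diff)
  then have "gen i <# (\<Union>t\<in>{1..Suc m}. coset i (- int t)) = (\<Union>t\<in>{1..Suc m}. coset i (- int (t - 1)))"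
    unfolding l_coset_UN by (intro SUP_cong refl)
  moreover have "(\<lambda>t. t - 1) ` {1..Suc m} = insert 0 {1..m}"
  proof
    show "insert 0 {1..m} \<subseteq> (\<lambda>t. t - 1) ` {1..Suc m}"
    proof
      fix x assume "x \<in> insert 0 {1..m}"
      then have "x = Suc x - 1" "Suc x \<in> {1..Suc m}" by auto
      then show "x \<in> (\<lambda>t. t - 1) ` {1..Suc m}" by (rule image_eqI)
    qed
  qed auto
  moreover have "(\<Union>t\<in>{1..Suc m}. coset i (- int (t - 1))) =
      (\<Union>t\<in>(\<lambda>t. t - 1) ` {1..Suc m}. coset i (- int t))"
    by (simp only: UN_simps)
  ultimately show ?thesis
    using coset_0[OF assms(1)] by (simp only: l_coset_Un UN_insert of_nat_0 minus_zero) blast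
qed

end

text \<open>The relation \<open>Psi D E\<close> is to be read as ``configurations on \<open>D\<close> extend to \<open>E\<close>''. One extends
  along the negative powers of a generator, one coset at a time: the new coset is the translate of the
  subgroup \<open>H\<^sub>i\<close>, which is filled inductively.\<close>

locale filling = polycyclic +
  fixes Psi :: "'a set \<Rightarrow> 'a set \<Rightarrow> bool" and W :: "(nat \<Rightarrow> enat) set"
  assumes Psi_refl: "D \<subseteq> carrier G \<Longrightarrow> Psi D D"
    and Psi_trans: "\<lbrakk>D \<subseteq> E; E \<subseteq> F; F \<subseteq> carrier G; Psi D E; Psi E F\<rbrakk> \<Longrightarrow> Psi D F"
    and Psi_translate:
      "\<lbrakk>g \<in> carrier G; D \<subseteq> E; E \<subseteq> carrier G; Psi D E\<rbrakk> \<Longrightarrow> Psi (g <#\<^bsub>G\<^esub> D) (g <#\<^bsub>G\<^esub> E)"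
    and Psi_limit:
      "\<lbrakk>\<And>m. C m \<subseteq> carrier G; \<And>m. D \<subseteq> C m; \<And>m. C m \<subseteq> C (Suc m); \<And>m. Psi D (C m)\<rbrakk>
        \<Longrightarrow> Psi D (\<Union>m::nat. C m)"
    and Psi_base: "mv \<in> W \<Longrightarrow> Psi (lower mv) (insert \<one>\<^bsub>G\<^esub> (lower mv))"
    and W_upd: "mv \<in> W \<Longrightarrow> mv(i := enat m) \<in> W"
begin

text \<open>Each new block is obtained by filling \<open>H i\<close> and translating back. As
  \<open>mv\<close> vanishes up to level \<open>i\<close>, the set \<open>lower mv\<close> is
  invariant under the generator and the blocks can be moved past it.\<close>

lemma fill_blocks:
  assumes "i < n" and fill: "\<And>mv. mv \<in> W \<Longrightarrow> (\<And>j. j < i \<Longrightarrow> mv j = 0) \<Longrightarrow> Psi (lower mv) (lower mv \<union> H i)"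
    and mv: "mv \<in> W" "\<And>j. j \<le> i \<Longrightarrow> mv j = 0" and m: "ord_factor i = 0 \<or> m < ord_factor i"
  shows "Psi (lower mv) (lower (mv(i := enat (Suc m))))"
  using m
proof (induction m)
  case 0
  then show ?case using lower_upd[of i mv 0] assms Psi_refl lower_carrier by (metis (no_types, lifting)
    SUP_empty Un_empty_right atLeastatMost_empty less_one order_refl)
next
  case (Suc m)
  let ?B = "\<lambda>m. lower (mv(i := enat (Suc m)))"
  have m: "ord_factor i = 0 \<or> m < ord_factor i" using Suc.prems by auto
  have B: "?B m = lower mv \<union> (\<Union>t\<in>{1..m}. coset i (- int t))"
    "?B (Suc m) = lower mv \<union> (\<Union>t\<in>{1..Suc m}. coset i (- int t))"
    using lower_upd[of i mv] assms m Suc.prems by simp_all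
  have Hc: "H i \<subseteq> carrier G" using assms(1) H_subset by simp
  have "Psi (?B m) (?B m \<union> H i)" using assms by (intro fill W_upd) auto
  moreover have sub: "lower mv \<subseteq> ?B m" using mv by (intro lower_mono) auto
  moreover have car: "?B m \<union> H i \<subseteq> carrier G" using lower_carrier Hc by blast
  ultimately have "Psi (lower mv) (?B m \<union> H i)"
    using Psi_trans[of "lower mv" "?B m" "?B m \<union> H i"] Suc.IH[OF m] by blast
  \<comment> \<open>The inverse generator turns the freshly filled \<open>H i\<close> into the first
    block and pushes the old blocks one step further.\<close>
  then have "Psi (inv (gen i) <# lower mv) (inv (gen i) <# (?B m \<union> H i))"
    using assms(1) sub car by (intro Psi_translate) auto
  moreover have "?B m \<union> H i = gen i <# ?B (Suc m)"
    unfolding B using block_translate[OF assms(1) mv(2), where m = m] by simp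
  moreover have "inv (gen i) <# lower mv = lower mv"
    using assms polycycle_step(1,3) by (intro lower_invariant[of "Suc i"]) (auto simp: subgroup.m_inv_closed)
  moreover have "inv (gen i) <# (gen i <# ?B (Suc m)) = ?B (Suc m)"
    using assms(1) lower_carrier by (simp add: lcos_m_assoc lcos_mult_one)
  ultimately show ?case by (simp only:)
qed

text \<open>The induction is for all \<open>mv\<close>, since \<open>H i\<close> is filled beside
  blocks of its own level. In a finite factor the blocks and \<open>H i\<close> exhaust
  \<open>H (Suc i)\<close>; in an infinite one a limit of translated blocks is taken.\<close>

lemma fill_H:
  assumes "i \<le> n" "mv \<in> W" "\<And>j. j < i \<Longrightarrow> mv j = 0"
  shows "Psi (lower mv) (lower mv \<union> H i)"
  using assms
proof (induction i arbitrary: mv)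
  case 0
  then show ?case using Psi_base[of mv] by simp
next
  case (Suc i)
  have i: "i < n" using Suc.prems by simp
  let ?k = "ord_factor i"
  let ?B = "\<lambda>m. lower (mv(i := enat (Suc m)))"
  have B: "?B m = lower mv \<union> (\<Union>t\<in>{1..m}. coset i (- int t))" if "?k = 0 \<or> m < ?k" for m
    using lower_upd[of i mv m] Suc.prems i that by simp
  have blocks: "Psi (lower mv) (?B m)" if "?k = 0 \<or> m < ?k" for m
    using fill_blocks[of i mv m] Suc i that by auto
  have Hc: "H i \<subseteq> carrier G" "H (Suc i) \<subseteq> carrier G" using i H_subset by simp_all
  have fB: "Psi (lower mv) (?B m \<union> H i)" if "?k = 0 \<or> m < ?k" for m
  proof -
    have "Psi (?B m) (?B m \<union> H i)" using Suc i by (intro Suc.IH W_upd) auto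
    moreover have "lower mv \<subseteq> ?B m" using Suc.prems by (intro lower_mono) auto
    moreover have "?B m \<union> H i \<subseteq> carrier G" using lower_carrier Hc by blast
    ultimately show ?thesis
      using Psi_trans[of "lower mv" "?B m" "?B m \<union> H i"] blocks[OF that] by blast
  qed
  show ?case
  proof (cases "?k = 0")
    case False
    have "?B (?k - 1) \<union> H i = lower mv \<union> H (Suc i)"
    proof -
      have "coset i s \<subseteq> (\<Union>t\<in>{1..?k - 1}. coset i (- int t)) \<union> H i" for s
      proof -
        \<comment> \<open>The exponent \<open>s\<close> is congruent to \<open>-t\<close>; the
          residue 0 belongs to \<open>H i\<close> itself.\<close>
        define t where "t = nat ((- s) mod int ?k)"
        have t: "int t = (- s) mod int ?k" "t < ?k" using False by (auto simp: t_def nat_less_iff)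
        have "int t = - s - int ?k * ((- s) div int ?k)"
          unfolding t(1) by (rule minus_mult_div_eq_mod[symmetric])
        then have "s - - int t = int ?k * (- ((- s) div int ?k))" by simp
        then have "int ?k dvd s - - int t" by (metis dvd_triv_left)
        then have "coset i s = coset i (- int t)" using i by (intro coset_cong)
        moreover have "t = 0 \<or> t \<in> {1..?k - 1}" using t(2) by auto
        ultimately show ?thesis using coset_0[OF i] by auto
      qed
      moreover have "coset i s \<subseteq> H (Suc i)" for s using coset_subset[OF i] .
      ultimately have "(\<Union>t\<in>{1..?k - 1}. coset i (- int t)) \<union> H i = H (Suc i)"
        using H_Suc_mono[OF i] unfolding H_Suc_eq[OF i] by blast
      then show ?thesis using B[of "?k - 1"] False by auto
    qed
    then show ?thesis using fB[of "?k - 1"] False by simp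
  next
    case True
    \<comment> \<open>Moving \<open>2 * m\<close> blocks forward by \<open>m\<close> gives the
      exponents from \<open>-m\<close> to \<open>m - 1\<close>, which eventually cover all
      integers.\<close>
    define C where "C m = gen i [^] m <# ?B (2 * m)" for m :: nat
    have inv: "gen i [^] m <# lower mv = lower mv" for m :: nat
      using Suc.prems i gen_pow_H[OF i, of "int m"]
      by (intro lower_invariant[of "Suc i"]) (auto simp: int_pow_int)
    have C: "C m = lower mv \<union> (\<Union>t\<in>{1..2 * m}. coset i (int m - int t))" for m
    proof -
      have "gen i [^] m <# coset i (- int t) = coset i (int m - int t)" for t
        using coset_translate[OF i, of "int m" "- int t"] by (simp add: int_pow_int)
      then show ?thesis unfolding C_def using B[of "2 * m"] True inv[of m]
        by (simp add: l_coset_Un l_coset_UN)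
    qed
    have "Psi (lower mv) (C m)" for m
    proof -
      have "Psi (gen i [^] m <# lower mv) (C m)" unfolding C_def
        using blocks[of "2 * m"] B[of "2 * m"] True i lower_carrier by (intro Psi_translate) auto
      then show ?thesis by (simp add: inv)
    qed
    moreover have "C m \<subseteq> C (Suc m)" for m
    proof -
      have "(\<Union>t\<in>{1..2 * m}. coset i (int m - int t)) \<subseteq> (\<Union>t\<in>{1..2 * Suc m}. coset i (int (Suc m) - int t))"
      proof (rule UN_least)
        fix t assume "t \<in> {1..2 * m}"
        then have "Suc t \<in> {1..2 * Suc m}" "int m - int t = int (Suc m) - int (Suc t)" by auto
        then show "coset i (int m - int t) \<subseteq> (\<Union>t\<in>{1..2 * Suc m}. coset i (int (Suc m) - int t))"
          by (metis UN_upper)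
      qed
      then show ?thesis unfolding C by blast
    qed
    moreover have "C m \<subseteq> carrier G" for m
      unfolding C using lower_carrier coset_carrier[OF i] by blast
    ultimately have "Psi (lower mv) (\<Union>m. C m)" by (intro Psi_limit) (auto simp: C)
    moreover have "(\<Union>m. C m) = lower mv \<union> H (Suc i)"
    proof -
      have "coset i s \<subseteq> (\<Union>m. C m)" for s
      proof -
        define m where "m = nat \<bar>s\<bar> + 1"
        define t where "t = nat (int m - s)"
        have "t \<in> {1..2 * m}" "s = int m - int t" by (auto simp: t_def m_def)
        then have "coset i s \<subseteq> C m" unfolding C by blast
        then show ?thesis by blast
      qed
      moreover have "lower mv \<subseteq> C 0" by (auto simp: C)
      moreover have "C m \<subseteq> lower mv \<union> H (Suc i)" for m unfolding C using coset_subset[OF i] by blast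
      ultimately show ?thesis unfolding H_Suc_eq[OF i] by blast
    qed
    ultimately show ?thesis by simp
  qed
qed

lemma lower_empty: "(\<And>j. j < n \<Longrightarrow> mv j = 0) \<Longrightarrow> lower mv = {}"
  unfolding lower_def depth_def by force

text \<open>From the zero tuple on, entries are only ever changed to finite values. Hence
  \<open>W\<close> may consist of the finite tuples, as it does for certificates.\<close>

lemma fill_carrier: "(\<lambda>_. 0) \<in> W \<Longrightarrow> Psi {} (carrier G)"
  using fill_H[of n "\<lambda>_. 0"] lower_empty[of "\<lambda>_. 0"] by simp

text \<open>Levels are added from the top down: when level \<open>i\<close> is added, all entries up
  to \<open>i\<close> vanish and blocks can be created. An infinite entry over an infinite factor is
  a limit of finite ones.\<close>

lemma fill_lower:
  assumes "W = UNIV"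
  shows "Psi {} (lower mv)"
proof -
  have "Psi {} (lower (\<lambda>j. if j < i then 0 else mv j))" if "i \<le> n" for i
    using that
  proof (induction i rule: inc_induct)
    case base
    show ?case using Psi_refl[of "{}"] by (subst lower_empty) auto
  next
    case (step i)
    let ?mv = "\<lambda>j. if j < Suc i then 0 else mv j" and ?k = "ord_factor i"
    have mv: "(\<lambda>j. if j < i then 0 else mv j) = ?mv(i := mv i)" by auto
    have i: "i < n" using step by simp
    have blocks: "Psi (lower ?mv) (lower (?mv(i := enat (Suc m))))" if "?k = 0 \<or> m < ?k" for m
      using that i fill_H[of i] assms by (intro fill_blocks) auto
    have sub: "lower ?mv \<subseteq> lower (?mv(i := x))" for x by (rule lower_mono) auto
    have "Psi (lower ?mv) (lower (?mv(i := mv i)))"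
    proof (cases "mv i = \<infinity> \<and> ?k = 0")
      case True
      have eq: "lower (?mv(i := \<infinity>)) = (\<Union>m. lower (?mv(i := enat (Suc m))))" (is "?l = ?r")
      proof
        show "?r \<subseteq> ?l" by (intro UN_least lower_mono) auto
        show "?l \<subseteq> ?r"
        proof
          fix g assume "g \<in> ?l"
          then obtain j t where "depth g j t" "enat t < (?mv(i := \<infinity>)) j" by (auto simp: lower_def)
          then have "g \<in> lower (?mv(i := enat (Suc t)))"
            unfolding lower_def by (intro CollectI exI[of _ j] exI[of _ t]) (auto split: if_splits)
          then show "g \<in> ?r" by blast
        qed
      qed
      have "lower (?mv(i := enat (Suc m))) \<subseteq> lower (?mv(i := enat (Suc (Suc m))))" for m
        by (rule lower_mono) auto
      then have "Psi (lower ?mv) (\<Union>m. lower (?mv(i := enat (Suc m))))"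
        using blocks True sub lower_carrier by (intro Psi_limit) blast+
      then show ?thesis using eq True by simp
    next
      case False
      \<comment> \<open>An entry above the order of a finite factor acts like the order itself, and
        0 acts like 1, so some admissible \<open>Suc m\<close> has the same effect.\<close>
      obtain m where m: "?k = 0 \<or> m < ?k"
        "\<And>t. 1 \<le> t \<Longrightarrow> ?k = 0 \<or> t < ?k \<Longrightarrow> enat t < mv i \<longleftrightarrow> t < Suc m"
      proof (cases "mv i")
        case infinity
        then show ?thesis using False by (intro that[of "?k - 1"]) auto
      next
        case (enat M)
        show ?thesis
        proof (cases "?k = 0")
          case True
          then show ?thesis using enat by (intro that[of "M - 1"]) auto
        next
          case False
          then show ?thesis using enat by (intro that[of "min (M - 1) (?k - 1)"]) auto
        qed
      qed
      have "lower (?mv(i := mv i)) = lower (?mv(i := enat (Suc m)))"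
      proof -
        have "depth g j t \<and> enat t < (?mv(i := mv i)) j \<longleftrightarrow>
              depth g j t \<and> enat t < (?mv(i := enat (Suc m))) j" for g j t
          using m(2)[of t] by (cases "j = i") (auto simp: depth_def)
        then show ?thesis unfolding lower_def by simp
      qed
      then show ?thesis using blocks[OF m(1)] by simp
    qed
    then show ?case
      unfolding mv using step.IH sub lower_carrier Psi_trans[of "{}" "lower ?mv"] by blast
  qed
  from this[of 0] show ?thesis by simp
qed

end

section \<open>Uniformity over all inductive intervals\<close>

text \<open>Finite values are isolated and infinity is approached by large ones: \<open>enat\<close>
  is treated as the one-point compactification of the naturals.\<close>

definition near :: "nat \<Rightarrow> enat \<Rightarrow> enat \<Rightarrow> bool" where
  "near N a b \<longleftrightarrow> (if a = \<infinity> then enat N \<le> b else b = a)"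

lemma near_mono: "near N' a b \<Longrightarrow> N \<le> N' \<Longrightarrow> near N a b"
  unfolding near_def by (metis enat_ord_simps(1) order_trans)

text \<open>Tube lemma for the compact space of tuples over \<^typ>\<open>enat\<close>, in which the points
  \<^term>\<open>near N \<infinity>\<close> form the neighbourhoods of infinity.\<close>

lemma finite_uniform:
  fixes Phi :: "(nat \<Rightarrow> enat) \<Rightarrow> 'c set \<Rightarrow> bool"
  assumes loc: "\<And>mv. \<exists>B N. finite B \<and> B \<subseteq> U \<and> (\<forall>mv'. (\<forall>j<n. near N (mv j) (mv' j)) \<longrightarrow> Phi mv' B)"
    and mono: "\<And>mv B B'. \<lbrakk>Phi mv B; B \<subseteq> B'; finite B'; B' \<subseteq> U\<rbrakk> \<Longrightarrow> Phi mv B'"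
  shows "\<exists>B. finite B \<and> B \<subseteq> U \<and> (\<forall>mv. Phi mv B)"
proof -
  \<comment> \<open>Coordinates are freed one at a time: those below \<open>k\<close> are arbitrary,
    the others have to stay near \<open>mv\<close>.\<close>
  have "\<exists>B N. finite B \<and> B \<subseteq> U \<and> (\<forall>mv'. (\<forall>j. k \<le> j \<longrightarrow> j < n \<longrightarrow> near N (mv j) (mv' j)) \<longrightarrow> Phi mv' B)" for k mv
  proof (induction k arbitrary: mv)
    case 0
    then show ?case using loc[of mv] by simp
  next
    case (Suc k)
    have "\<forall>x. \<exists>B N. finite B \<and> B \<subseteq> U \<and>
      (\<forall>mv'. (\<forall>j. k \<le> j \<longrightarrow> j < n \<longrightarrow> near N ((mv(k := x)) j) (mv' j)) \<longrightarrow> Phi mv' B)"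
      using Suc by blast
    then obtain B N where BN: "\<And>x. finite (B x)" "\<And>x. B x \<subseteq> U"
      "\<And>x mv'. (\<And>j. k \<le> j \<Longrightarrow> j < n \<Longrightarrow> near (N x) ((mv(k := x)) j) (mv' j)) \<Longrightarrow> Phi mv' (B x)"
      by metis
    \<comment> \<open>The neighbourhood found for infinity takes care of all values from
      \<open>N \<infinity>\<close> on, which leaves finitely many values of coordinate
      \<open>k\<close>.\<close>
    define S where "S = insert \<infinity> (enat ` {..<N \<infinity>})"
    have fin: "finite S" by (simp add: S_def)
    have UB: "finite (\<Union>x\<in>S. B x)" "(\<Union>x\<in>S. B x) \<subseteq> U" using fin BN(1,2) by blast+
    have "Phi mv' (\<Union>x\<in>S. B x)"
      if mv': "\<And>j. Suc k \<le> j \<Longrightarrow> j < n \<Longrightarrow> near (\<Sum>x\<in>S. N x) (mv j) (mv' j)" for mv'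
    proof -
      have N: "N x \<le> (\<Sum>x\<in>S. N x)" if "x \<in> S" for x using that fin by (intro member_le_sum) auto
      define x where "x = (if enat (N \<infinity>) \<le> mv' k then \<infinity> else mv' k)"
      have x: "x \<in> S" by (cases "mv' k") (auto simp: x_def S_def)
      have "near (N x) ((mv(k := x)) j) (mv' j)" if "k \<le> j" "j < n" for j
      proof (cases "j = k")
        case True
        then show ?thesis by (auto simp: near_def x_def)
      next
        case False
        then show ?thesis using mv'[of j] that N[OF x] near_mono by auto
      qed
      then have "Phi mv' (B x)" by (rule BN(3))
      moreover have "B x \<subseteq> (\<Union>x\<in>S. B x)" using x by blast
      ultimately show ?thesis using UB mono by blast
    qed
    then show ?case using UB by (intro exI[of _ "\<Union>x\<in>S. B x"] exI[of _ "\<Sum>x\<in>S. N x"]) auto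
  qed
  from this[of n] show ?thesis by (meson not_less)
qed

section \<open>Effective numberings of polycyclic groups\<close>

context polycyclic
begin

definition eff_group :: "'g set \<Rightarrow> (nat \<Rightarrow> 'g) \<Rightarrow> bool" where
  "eff_group K d \<longleftrightarrow> subgroup K G \<and> range d = K \<and>
     (\<exists>mul. total_rec mul \<and> (\<forall>a b. d (mul (prod_encode (a, b))) = d a \<otimes> d b)) \<and>
     (\<exists>iv. total_rec iv \<and> (\<forall>a. d (iv a) = inv (d a)))"

text \<open>Multiplying normal forms requires conjugation by the next generator on codes.
  Computability of all homomorphisms is the stronger property that passes from \<open>H i\<close> to
  \<open>H (Suc i)\<close>: a homomorphism is determined by its restriction to \<open>H i\<close>
  and its value at one generator.\<close>

definition eff_homs :: "'g set \<Rightarrow> (nat \<Rightarrow> 'g) \<Rightarrow> bool" where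
  "eff_homs K d \<longleftrightarrow> (\<forall>K' e f. eff_group K' e \<longrightarrow> f ` K \<subseteq> K' \<longrightarrow>
     (\<forall>x\<in>K. \<forall>y\<in>K. f (x \<otimes> y) = f x \<otimes> f y) \<longrightarrow>
     (\<exists>F. total_rec F \<and> (\<forall>c. e (F c) = f (d c))))"

text \<open>A first component \<open>0\<close> of \<open>ld c\<close> marks the identity; a second component \<open>0\<close> marks the elements that
  lie in no \<^const>\<open>lower\<close> set because their leading exponent is positive.\<close>

definition eff_depth :: "(nat \<Rightarrow> 'g) \<Rightarrow> bool" where
  "eff_depth d \<longleftrightarrow> (\<exists>ld. total_rec ld \<and> (\<forall>c. (d c = \<one> \<longleftrightarrow> pr1 (ld c) = 0) \<and>
     (\<forall>j t. depth (d c) j t \<longleftrightarrow> ld c = prod_encode (Suc j, t) \<and> 1 \<le> t)))"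

lemma eff_group_carrier: "eff_group K d \<Longrightarrow> d c \<in> carrier G"
  unfolding eff_group_def using subgroup.subset by blast

text \<open>An integer exponent is given as a difference of two naturals, which avoids signed
  arithmetic in the recursive functions.\<close>

lemma eff_group_pow:
  assumes "eff_group K d"
  obtains pw where "total_rec pw"
    "\<And>c a b. d (pw (prod_encode (c, prod_encode (a, b)))) = d c [^] (int a - int b)"
proof -
  note dc [simp] = eff_group_carrier[OF assms]
  obtain mul iv where mul: "total_rec mul" "\<And>a b. d (mul (prod_encode (a, b))) = d a \<otimes> d b"
    and iv: "total_rec iv" "\<And>a. d (iv a) = inv (d a)" and K: "subgroup K G" "range d = K"
    using assms unfolding eff_group_def by blast
  obtain o1 where o1: "d o1 = \<one>" using K subgroup.one_closed[OF K(1)] by (metis imageE)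
  define np where "np c a = rec_nat o1 (\<lambda>k r. mul (prod_encode (r, c))) a" for c a
  have np: "d (np c a) = d c [^] a" for c a
    by (induction a) (simp_all add: np_def o1 mul)
  let ?pw = "\<lambda>p. mul (prod_encode (np (pr1 p) (pr1 (pr2 p)), np (iv (pr1 p)) (pr2 (pr2 p))))"
  have "total_rec ?pw"
    unfolding np_def by (intro total_rec_comp[OF mul(1)] total_rec_comp[OF iv(1)] rec_intros)
  moreover have "d (?pw (prod_encode (c, prod_encode (a, b)))) = d c [^] (int a - int b)" for c a b
    by (simp add: mul np iv nat_pow_inv int_pow_diff int_pow_int)
  ultimately show thesis using that by blast
qed

text \<open>By normality, conjugation by the generator and by its inverse are endomorphisms of
  \<open>H i\<close>, hence recursive on codes by \<open>eff_homs\<close>; powers are handled by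
  iteration.\<close>

lemma gen_pow_conj:
  assumes "i < n" "eff_group (H i) d" "eff_homs (H i) d"
  obtains cj where "total_rec cj"
    "\<And>c a b. d (cj (prod_encode (c, prod_encode (a, b)))) =
       inv (gen i [^] (int a - int b)) \<otimes> d c \<otimes> gen i [^] (int a - int b)"
proof -
  note dc [simp] = eff_group_carrier[OF assms(2)]
  have sub: "subgroup (H i) G" using assms(1) subgroup_H by simp
  have Hc: "x \<in> carrier G" if "x \<in> H i" for x using that subgroup.mem_carrier[OF sub] by blast
  have a: "gen i \<in> carrier G" using assms(1) by simp
  have "\<exists>F. total_rec F \<and> (\<forall>c. d (F c) = x \<otimes> d c \<otimes> inv x)"
    if x: "x \<in> H (Suc i)" for x
  proof -
    have xc: "x \<in> carrier G" using x H_subset[of "Suc i"] assms(1) by auto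
    have "(x \<otimes> y \<otimes> inv x) \<otimes> (x \<otimes> z \<otimes> inv x) = x \<otimes> (y \<otimes> z) \<otimes> inv x"
      if "y \<in> H i" "z \<in> H i" for y z
      using Hc[OF that(1)] Hc[OF that(2)] xc by (simp add: m_assoc inv_solve_left')
    then show ?thesis
      using assms(3)[unfolded eff_homs_def, rule_format, OF assms(2), of "\<lambda>y. x \<otimes> y \<otimes> inv x"]
        conj_H(1)[OF assms(1) x] by auto
  qed
  from this[OF polycycle_step(3)[OF assms(1)]]
    this[OF subgroup.m_inv_closed[OF polycycle_step(1,3)[OF assms(1)]]]
  obtain fm fp where fm: "total_rec fm" "\<And>c. d (fm c) = gen i \<otimes> d c \<otimes> inv (gen i)"
    and fp: "total_rec fp" "\<And>c. d (fp c) = inv (gen i) \<otimes> d c \<otimes> gen i"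
    using a by auto
  define cp where "cp c a = rec_nat c (\<lambda>k r. fp r) a" for c a
  define cm where "cm c a = rec_nat c (\<lambda>k r. fm r) a" for c a
  have cp: "d (cp c s) = inv (gen i [^] s) \<otimes> d c \<otimes> gen i [^] s" for c s
    using a by (induction s) (simp_all add: cp_def fp m_assoc inv_mult_group)
  have comm: "gen i \<otimes> gen i [^] s = gen i [^] s \<otimes> gen i" for s :: nat
    using a by (metis nat_pow_Suc nat_pow_Suc2)
  have cm: "d (cm c s) = gen i [^] s \<otimes> d c \<otimes> inv (gen i [^] s)" for c s
  proof (induction s)
    case (Suc s)
    have "d (cm c (Suc s)) = gen i \<otimes> (gen i [^] s \<otimes> d c \<otimes> inv (gen i [^] s)) \<otimes> inv (gen i)"
      using Suc by (simp add: cm_def fm)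
    also have "\<dots> = (gen i \<otimes> gen i [^] s) \<otimes> d c \<otimes> inv (gen i \<otimes> gen i [^] s)"
      using a by (simp add: m_assoc inv_mult_group)
    finally show ?case by (simp add: comm)
  qed (simp add: cm_def)
  let ?cj = "\<lambda>p. cm (cp (pr1 p) (pr1 (pr2 p))) (pr2 (pr2 p))"
  have "total_rec ?cj" unfolding cm_def cp_def
    by (intro total_rec_comp[OF fm(1)] total_rec_comp[OF fp(1)] rec_intros)
  moreover have "d (?cj (prod_encode (c, prod_encode (s, t)))) =
      inv (gen i [^] (int s - int t)) \<otimes> d c \<otimes> gen i [^] (int s - int t)" for c s t
  proof -
    have e1: "gen i [^] (int s - int t) = gen i [^] s \<otimes> inv (gen i [^] t)"
      using a by (simp add: int_pow_diff int_pow_int)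
    show ?thesis using a unfolding e1 by (simp add: cm cp m_assoc inv_mult_group)
  qed
  ultimately show thesis using that by blast
qed

text \<open>With \<open>a\<close> for the generator, the product of \<open>a^s u\<close> and
  \<open>a^t v\<close> is \<open>a^(s+t)\<close> times \<open>a^(-t) u a^t\<close> times
  \<open>v\<close>. Exponents are left unreduced, so the same formula serves for finite
  factors.\<close>

lemma eff_group_Suc:
  assumes "i < n" "eff_group (H i) d" "eff_homs (H i) d"
  defines "d' \<equiv> \<lambda>c. gen i [^] (int (pr1 (pr1 c)) - int (pr2 (pr1 c))) \<otimes> d (pr2 c)"
  shows "eff_group (H (Suc i)) d'" "eff_homs (H (Suc i)) d'"
proof -
  note dc [simp] = eff_group_carrier[OF assms(2)]
  have a [simp]: "gen i \<in> carrier G" using assms(1) by simp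
  obtain mul iv where mul: "total_rec mul" "\<And>a b. d (mul (prod_encode (a, b))) = d a \<otimes> d b"
    and iv: "total_rec iv" "\<And>a. d (iv a) = inv (d a)" and K: "range d = H i"
    using assms(2) unfolding eff_group_def by blast
  obtain cj where cj: "total_rec cj" "\<And>c a b. d (cj (prod_encode (c, prod_encode (a, b)))) =
       inv (gen i [^] (int a - int b)) \<otimes> d c \<otimes> gen i [^] (int a - int b)"
    using gen_pow_conj[OF assms(1-3)] by metis
  have "range d' = H (Suc i)"
  proof
    show "range d' \<subseteq> H (Suc i)"
      using K H_Suc_mono[OF assms(1)] gen_pow_H[OF assms(1)] subgroup.m_closed[OF polycycle_step(1)[OF assms(1)]]
      unfolding d'_def by blast
    show "H (Suc i) \<subseteq> range d'"
    proof
      fix g assume "g \<in> H (Suc i)"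
      then obtain s u where u: "u \<in> H i" "g = gen i [^] (s::int) \<otimes> u"
        unfolding H_Suc_eq[OF assms(1)] by (auto elim: cosetE)
      obtain c where "u = d c" using u(1) K by auto
      then have "g = d' (prod_encode (prod_encode (nat s, nat (- s)), c))"
        using u by (cases "0 \<le> s") (simp_all add: d'_def)
      then show "g \<in> range d'" by blast
    qed
  qed
  moreover have "\<exists>mul. total_rec mul \<and> (\<forall>x y. d' (mul (prod_encode (x, y))) = d' x \<otimes> d' y)"
  proof -
    let ?m = "\<lambda>p. prod_encode (prod_encode (pr1 (pr1 (pr1 p)) + pr1 (pr1 (pr2 p)), pr2 (pr1 (pr1 p)) + pr2 (pr1 (pr2 p))),
        mul (prod_encode (cj (prod_encode (pr2 (pr1 p), prod_encode (pr1 (pr1 (pr2 p)), pr2 (pr1 (pr2 p))))), pr2 (pr2 p))))"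
    have "total_rec ?m" by (intro total_rec_comp[OF mul(1)] total_rec_comp[OF cj(1)] rec_intros)
    moreover have "d' (?m (prod_encode (x, y))) = d' x \<otimes> d' y" for x y
    proof -
      define s where "s = int (pr1 (pr1 x)) - int (pr2 (pr1 x))"
      define t where "t = int (pr1 (pr1 y)) - int (pr2 (pr1 y))"
      have st: "int (pr1 (pr1 x) + pr1 (pr1 y)) - int (pr2 (pr1 x) + pr2 (pr1 y)) = s + t"
        by (simp add: s_def t_def)
      have "d' (?m (prod_encode (x, y))) = gen i [^] (s + t) \<otimes>
          ((inv (gen i [^] t) \<otimes> d (pr2 x) \<otimes> gen i [^] t) \<otimes> d (pr2 y))"
        unfolding d'_def using cj(2)[of "pr2 x" "pr1 (pr1 y)" "pr2 (pr1 y)"]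
        by (simp add: mul st[simplified] t_def[symmetric])
      also have "\<dots> = (gen i [^] s \<otimes> d (pr2 x)) \<otimes> (gen i [^] t \<otimes> d (pr2 y))"
      proof -
        have "x \<otimes> (inv x \<otimes> y) = y" if "x \<in> carrier G" "y \<in> carrier G" for x y
          using that by (simp add: m_assoc[symmetric])
        then show ?thesis by (simp add: int_pow_mult m_assoc)
      qed
      finally show ?thesis by (simp add: d'_def s_def t_def)
    qed
    ultimately show ?thesis by blast
  qed
  moreover have "\<exists>iv. total_rec iv \<and> (\<forall>x. d' (iv x) = inv (d' x))"
  proof -
    let ?v = "\<lambda>p. prod_encode (prod_encode (pr2 (pr1 p), pr1 (pr1 p)),
        cj (prod_encode (iv (pr2 p), prod_encode (pr2 (pr1 p), pr1 (pr1 p)))))"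
    have "total_rec ?v" by (intro total_rec_comp[OF iv(1)] total_rec_comp[OF cj(1)] rec_intros)
    moreover have "d' (?v x) = inv (d' x)" for x
    proof -
      define s where "s = int (pr1 (pr1 x)) - int (pr2 (pr1 x))"
      have st: "int (pr2 (pr1 x)) - int (pr1 (pr1 x)) = - s" by (simp add: s_def)
      have "d' (?v x) = gen i [^] (- s) \<otimes> (inv (gen i [^] (- s)) \<otimes> inv (d (pr2 x)) \<otimes> gen i [^] (- s))"
        unfolding d'_def by (simp add: cj iv st)
      also have "\<dots> = inv (d (pr2 x)) \<otimes> inv (gen i [^] s)"
        by (simp add: int_pow_neg m_assoc[symmetric])
      also have "\<dots> = inv (d' x)" by (simp add: d'_def s_def inv_mult_group)
      finally show ?thesis .
    qed
    ultimately show ?thesis by blast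
  qed
  ultimately show eff: "eff_group (H (Suc i)) d'"
    unfolding eff_group_def using polycycle_step(1)[OF assms(1)] by blast
  show "eff_homs (H (Suc i)) d'"
    unfolding eff_homs_def
  proof (intro allI impI)
    fix K e f
    assume e: "eff_group K e" and img: "f ` H (Suc i) \<subseteq> K"
      and hom: "\<forall>x\<in>H (Suc i). \<forall>y\<in>H (Suc i). f (x \<otimes> y) = f x \<otimes> f y"
    note ec [simp] = eff_group_carrier[OF e]
    obtain mule where mule: "total_rec mule" "\<And>a b. e (mule (prod_encode (a, b))) = e a \<otimes> e b"
      and Ke: "range e = K" "subgroup K G"
      using e unfolding eff_group_def by blast
    obtain pw where pw: "total_rec pw"
      "\<And>c a b. e (pw (prod_encode (c, prod_encode (a, b)))) = e c [^] (int a - int b)"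
      using eff_group_pow[OF e] by metis
    have sub: "H i \<subseteq> H (Suc i)" using H_Suc_mono[OF assms(1)] .
    obtain F where F: "total_rec F" "\<And>c. e (F c) = f (d c)"
    proof -
      have "f ` H i \<subseteq> K" "\<forall>x\<in>H i. \<forall>y\<in>H i. f (x \<otimes> y) = f x \<otimes> f y"
        using img hom sub by blast+
      then show thesis using assms(3) e that unfolding eff_homs_def by blast
    qed
    obtain w where w: "e w = f (gen i)"
      using img polycycle_step(3)[OF assms(1)] Ke(1) by (metis image_subset_iff rangeE)
    let ?K = "G\<lparr>carrier := H (Suc i)\<rparr>"
    have "f \<in> hom ?K G"
      using hom img subgroup.subset[OF Ke(2)] by (auto simp: hom_def)
    then have fp: "f (gen i [^] s) = f (gen i) [^] s" for s :: int
      using hom_int_pow[of f ?K G "gen i" s] polycycle_step(1,3)[OF assms(1)]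
        int_pow_consistent[OF polycycle_step(1,3)[OF assms(1)], of s]
      by (simp add: subgroup.subgroup_is_group subgroup_imp_group)
    let ?F = "\<lambda>c. mule (prod_encode (pw (prod_encode (w, pr1 c)), F (pr2 c)))"
    have "total_rec ?F"
      by (intro total_rec_comp[OF mule(1)] total_rec_comp[OF pw(1)] total_rec_comp[OF F(1)] rec_intros)
    moreover have "e (?F c) = f (d' c)" for c
    proof -
      have "d (pr2 c) \<in> H (Suc i)" using K sub by blast
      then have "f (d' c) = f (gen i [^] (int (pr1 (pr1 c)) - int (pr2 (pr1 c)))) \<otimes> f (d (pr2 c))"
        using hom gen_pow_H[OF assms(1)] by (simp add: d'_def)
      moreover have "e (pw (prod_encode (w, pr1 c))) = f (gen i) [^] (int (pr1 (pr1 c)) - int (pr2 (pr1 c)))"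
        using pw(2)[of w "pr1 (pr1 c)" "pr2 (pr1 c)"] by (simp add: w)
      ultimately show ?thesis by (simp add: mule F fp)
    qed
    ultimately show "\<exists>F. total_rec F \<and> (\<forall>c. e (F c) = f (d' c))" by blast
  qed
qed

text \<open>An exponent that is no multiple of the order puts \<open>g\<close> outside
  \<open>H i\<close> but inside \<open>H (Suc i)\<close>, which excludes every other level.\<close>

lemma depth_leading:
  assumes "i < n" "g \<in> coset i s" "\<not> int (ord_factor i) dvd s"
  shows "g \<noteq> \<one>" "depth g j t \<longleftrightarrow> j = i \<and> 1 \<le> t \<and> (ord_factor i = 0 \<or> t < ord_factor i) \<and>
    int (ord_factor i) dvd s + int t"
proof -
  have nH: "g \<notin> H i" using coset_eq_iff[OF assms(1,2), of 0] assms coset_0 by simp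
  have gH: "g \<in> H (Suc i)" using coset_subset[OF assms(1)] assms(2) by blast
  show "g \<noteq> \<one>" using nH subgroup.one_closed[OF subgroup_H[of i]] assms(1) by auto
  have ji: "j = i" if "depth g j t"
  proof (rule ccontr)
    assume "j \<noteq> i"
    then consider "Suc j \<le> i" | "Suc i \<le> j" by linarith
    then show False
    proof cases
      case 1
      then show False using H_mono[of "Suc j" i] depth_not_H(1)[OF that] nH assms(1) by auto
    next
      case 2
      then show False using H_mono[of "Suc i" j] depth_not_H(2)[OF that] gH that
        by (auto simp: depth_def)
    qed
  qed
  have "g \<in> coset i (- int t) \<longleftrightarrow> int (ord_factor i) dvd s + int t"
    using coset_eq_iff[OF assms(1,2), of "- int t"] by simp
  then show "depth g j t \<longleftrightarrow> j = i \<and> 1 \<le> t \<and> (ord_factor i = 0 \<or> t < ord_factor i) \<and>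
      int (ord_factor i) dvd s + int t"
  proof (cases "j = i")
    case False
    then show ?thesis using ji by blast
  qed (use assms(1) in \<open>auto simp: depth_def\<close>)
qed

text \<open>If the leading exponent is trivial in its factor, the power of the generator is absorbed
  into \<open>H i\<close> and the question passes one level down.\<close>

lemma eff_depth_Suc:
  assumes "i < n" "eff_group (H i) d" "eff_depth d"
  defines "d' \<equiv> \<lambda>c. gen i [^] (int (pr1 (pr1 c)) - int (pr2 (pr1 c))) \<otimes> d (pr2 c)"
  shows "eff_depth d'"
proof -
  note dc [simp] = eff_group_carrier[OF assms(2)]
  have a [simp]: "gen i \<in> carrier G" using assms(1) by simp
  obtain mul where mul: "total_rec mul" "\<And>a b. d (mul (prod_encode (a, b))) = d a \<otimes> d b"
    and K: "range d = H i"
    using assms(2) unfolding eff_group_def by blast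
  obtain pw where pw: "total_rec pw"
    "\<And>c a b. d (pw (prod_encode (c, prod_encode (a, b)))) = d c [^] (int a - int b)"
    using eff_group_pow[OF assms(2)] by metis
  obtain ld where ld: "total_rec ld" "\<And>c. d c = \<one> \<longleftrightarrow> pr1 (ld c) = 0"
    "\<And>c j t. depth (d c) j t \<longleftrightarrow> ld c = prod_encode (Suc j, t) \<and> 1 \<le> t"
    using assms(3) unfolding eff_depth_def by blast
  let ?k = "ord_factor i"
  have mem: "d' c \<in> coset i (int (pr1 (pr1 c)) - int (pr2 (pr1 c)))" for c
    unfolding d'_def using K by (intro cosetI) blast
  show ?thesis
  proof (cases "?k = 0")
    case True
    \<comment> \<open>The truncated difference is 0 for a positive exponent, which is the mark for
      having no depth.\<close>
    let ?ld = "\<lambda>c. if pr1 (pr1 c) = pr2 (pr1 c) then ld (pr2 c)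
      else prod_encode (Suc i, pr2 (pr1 c) - pr1 (pr1 c))"
    have "total_rec ?ld" by (intro rec_intros total_rec_comp[OF ld(1)])
    moreover have "(d' c = \<one> \<longleftrightarrow> pr1 (?ld c) = 0) \<and>
        (depth (d' c) j t \<longleftrightarrow> ?ld c = prod_encode (Suc j, t) \<and> 1 \<le> t)" for c j t
    proof (cases "pr1 (pr1 c) = pr2 (pr1 c)")
      case True
      then show ?thesis using ld by (simp add: d'_def)
    next
      case False
      then have "\<not> int ?k dvd int (pr1 (pr1 c)) - int (pr2 (pr1 c))" using \<open>?k = 0\<close> by simp
      note dl = depth_leading[OF assms(1) mem this]
      have "int (pr1 (pr1 c)) - int (pr2 (pr1 c)) + int t = 0 \<and> 1 \<le> t \<longleftrightarrow>
          pr2 (pr1 c) - pr1 (pr1 c) = t \<and> 1 \<le> t" using False by auto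
      then show ?thesis using dl \<open>?k = 0\<close> False by auto
    qed
    ultimately show ?thesis unfolding eff_depth_def by blast
  next
    case False
    have zH: "gen i [^] (int ?k) \<in> H i" using gen_pow_mem_iff[OF assms(1)] by simp
    then obtain z where z: "d z = gen i [^] (int ?k)" using K by (metis rangeE)
    \<comment> \<open>This is the exponent plus \<open>?k\<close> times its subtrahend: a natural
      number in the same residue class. The multiple that was added is taken off again in
      \<open>?red\<close>, where \<open>z\<close> replaces the \<open>?k\<close>-th power of the
      generator.\<close>
    define s where "s c = pr1 (pr1 c) + (?k - 1) * pr2 (pr1 c)" for c
    let ?red = "\<lambda>c. mul (prod_encode (pw (prod_encode (z, prod_encode (s c div ?k, pr2 (pr1 c)))), pr2 c))"
    let ?ld = "\<lambda>c. if s c mod ?k = 0 then ld (?red c) else prod_encode (Suc i, ?k - s c mod ?k)"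
    have "total_rec ?ld" unfolding s_def
      by (intro rec_intros total_rec_comp[OF ld(1)] total_rec_comp[OF mul(1)] total_rec_comp[OF pw(1)])
    moreover have "(d' c = \<one> \<longleftrightarrow> pr1 (?ld c) = 0) \<and>
        (depth (d' c) j t \<longleftrightarrow> ?ld c = prod_encode (Suc j, t) \<and> 1 \<le> t)" for c j t
    proof -
      let ?s = "int (pr1 (pr1 c)) - int (pr2 (pr1 c))"
      have s: "?s = int (s c) - int ?k * int (pr2 (pr1 c))"
        using False by (cases "?k") (simp_all add: s_def algebra_simps)
      have s': "int (s c) = int ?k * int (s c div ?k) + int (s c mod ?k)"
        by (metis mult_div_mod_eq of_nat_add of_nat_mult)
      show ?thesis
      proof (cases "s c mod ?k = 0")
        case True
        then have "?s = int ?k * (int (s c div ?k) - int (pr2 (pr1 c)))"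
          using s s' by (simp add: algebra_simps)
        then have "d' c = d (?red c)"
          unfolding d'_def by (simp add: mul pw z int_pow_pow)
        then show ?thesis using ld True by simp
      next
        case False
        have k: "s c mod ?k < ?k" using \<open>?k \<noteq> 0\<close> by simp
        have ss: "?s = int ?k * (int (s c div ?k) - int (pr2 (pr1 c))) + int (s c mod ?k)"
          using s s' by (simp add: algebra_simps)
        have dv: "int ?k dvd ?s + x \<longleftrightarrow> int ?k dvd int (s c mod ?k) + x" for x
          unfolding ss by (metis add.assoc dvd_add_times_triv_left_iff mult.commute)
        have "\<not> int ?k dvd int (s c mod ?k)"
          using False k by (meson int_dvd_int_iff dvd_imp_le gr0I linorder_not_le)
        then have "\<not> int ?k dvd ?s" using dv[of 0] by simp
        note dl = depth_leading[OF assms(1) mem this]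
        have "int ?k dvd ?s + int t \<longleftrightarrow> t = ?k - s c mod ?k" if t: "1 \<le> t" "t < ?k"
        proof
          assume "int ?k dvd ?s + int t"
          then have "?k dvd s c mod ?k + t" unfolding dv by (metis int_dvd_int_iff of_nat_add)
          then obtain q where q: "s c mod ?k + t = ?k * q" by (auto simp: dvd_def)
          moreover have "0 < s c mod ?k + t" "s c mod ?k + t < ?k * 2" using t k by linarith+
          ultimately have "q = 1" by (metis One_nat_def less_2_cases mult_0_right mult_less_cancel1 less_irrefl)
          then show "t = ?k - s c mod ?k" using q by simp
        next
          assume "t = ?k - s c mod ?k"
          then have "int (s c mod ?k) + int t = int ?k" using k by simp
          then show "int ?k dvd ?s + int t" unfolding dv by simp
        qed
        moreover have "1 \<le> ?k - s c mod ?k" "?k - s c mod ?k < ?k" using k False by auto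
        ultimately have "depth (d' c) j t \<longleftrightarrow> i = j \<and> ?k - s c mod ?k = t \<and> 1 \<le> t"
          using dl(2)[of j t] \<open>?k \<noteq> 0\<close> by auto
        then show ?thesis using dl(1) False by simp
      qed
    qed
    ultimately show ?thesis unfolding eff_depth_def by blast
  qed
qed

lemma eff_H: "i \<le> n \<Longrightarrow> \<exists>d. eff_group (H i) d \<and> eff_homs (H i) d \<and> eff_depth d"
proof (induction i)
  case 0
  let ?d = "\<lambda>_::nat. \<one>"
  have "eff_group (H 0) ?d"
    unfolding eff_group_def using subgroup_H[of 0] total_rec_const by auto
  moreover have "eff_homs (H 0) ?d"
    unfolding eff_homs_def
  proof (intro allI impI)
    fix K' e f
    assume e: "eff_group K' e" and f: "f ` H 0 \<subseteq> K'" "\<forall>x\<in>H 0. \<forall>y\<in>H 0. f (x \<otimes> y) = f x \<otimes> f y"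
    obtain o1 where "e o1 = f \<one>" using e f(1) unfolding eff_group_def by (metis H_0 image_subset_iff rangeE singletonI)
    then show "\<exists>F. total_rec F \<and> (\<forall>c. e (F c) = f \<one>)"
      using total_rec_const[of o1] by blast
  qed
  moreover have "eff_depth ?d"
  proof -
    have "\<not> depth \<one> j t" for j t
    proof
      assume "depth \<one> j t"
      moreover from this have "j \<le> n" by (simp add: depth_def)
      ultimately show False using depth_not_H(2) subgroup.one_closed[OF subgroup_H] by blast
    qed
    then show ?thesis unfolding eff_depth_def
      using total_rec_const[of "prod_encode (0, 0)"] by (intro exI[of _ "\<lambda>_. prod_encode (0, 0)"]) simp
  qed
  ultimately show ?case by blast
next
  case (Suc i)
  then show ?case using eff_group_Suc[of i] eff_depth_Suc[of i] by (meson Suc_le_lessD less_imp_le_nat)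
qed

end

text \<open>Two numberings coexist: the exponent lists of the input and the internal numbering
  \<open>d\<close>. A translation in the direction of \<open>d\<close> is enough, since the output
  reuses exponent lists found by the search.\<close>

locale effective = polycyclic +
  fixes d :: "nat \<Rightarrow> 'a" and mul ld conv :: "nat \<Rightarrow> nat" and e1 :: nat
  assumes d_range: "range d = carrier G"
    and mul: "total_rec mul" "\<And>a b. d (mul (prod_encode (a, b))) = d a \<otimes>\<^bsub>G\<^esub> d b"
    and d_eq: "dec_pred (\<lambda>p. d (pr1 p) = d (pr2 p))"
    and ld: "total_rec ld" "\<And>c j t. depth (d c) j t \<longleftrightarrow> ld c = prod_encode (Suc j, t) \<and> 1 \<le> t"
    and conv: "total_rec conv" "\<And>m. d (conv m) = exp_prod G h (\<lambda>i. int_decode (nth_code m (i - 1))) n"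
    and e1: "d e1 = \<one>\<^bsub>G\<^esub>"

lemma (in polycyclic) effective_exists: "\<exists>d mul ld conv e1. effective G n H h d mul ld conv e1"
proof -
  obtain d where d: "eff_group (carrier G) d" "eff_depth d" using eff_H[of n] by auto
  note dc [simp] = eff_group_carrier[OF d(1)]
  obtain mul iv where mul: "total_rec mul" "\<And>a b. d (mul (prod_encode (a, b))) = d a \<otimes> d b"
    and iv: "total_rec iv" "\<And>a. d (iv a) = inv (d a)" and ran: "range d = carrier G"
    using d(1) unfolding eff_group_def by blast
  obtain ld where ld: "total_rec ld" "\<And>c. d c = \<one> \<longleftrightarrow> pr1 (ld c) = 0"
    "\<And>c j t. depth (d c) j t \<longleftrightarrow> ld c = prod_encode (Suc j, t) \<and> 1 \<le> t"
    using d(2) unfolding eff_depth_def by blast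
  obtain pw where pw: "total_rec pw"
    "\<And>c a b. d (pw (prod_encode (c, prod_encode (a, b)))) = d c [^] (int a - int b)"
    using eff_group_pow[OF d(1)] by metis
  \<comment> \<open>The word problem: two elements are equal if the quotient, formed on codes, has
    the mark of the identity.\<close>
  have eq: "d a = d b \<longleftrightarrow> pr1 (ld (mul (prod_encode (iv a, b)))) = 0" for a b
    unfolding ld(2)[symmetric] mul(2) iv(2) by (metis dc inv_closed inv_equality inv_inv l_inv)
  have dec: "dec_pred (\<lambda>p. d (pr1 p) = d (pr2 p))"
    unfolding eq
    by (intro rec_intros total_rec_comp[OF ld(1)] total_rec_comp[OF mul(1)] total_rec_comp[OF iv(1)])
  \<comment> \<open>Rewrites the standard code of an integer, nonnegative on even and negative on
    odd numbers, as a difference of naturals.\<close>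
  define ie where "ie x = (if x mod 2 = 0 then prod_encode (x div 2, 0) else prod_encode (0, Suc (x div 2)))"
    for x :: nat
  have ie: "int (pr1 (ie x)) - int (pr2 (ie x)) = int_decode x" for x
    by (auto simp: ie_def int_decode_def sum_decode_def even_iff_mod_2_eq_zero)
  have "\<exists>f. total_rec f \<and> (\<forall>m. d (f m) = exp_prod G h (\<lambda>i. int_decode (nth_code m (i - 1))) j)"
    if "j \<le> n" for j
    using that
  proof (induction j)
    case 0
    obtain o1 where "d o1 = \<one>" using ran by (metis one_closed rangeE)
    then show ?case using total_rec_const[of o1] by auto
  next
    case (Suc j)
    then obtain f where f: "total_rec f"
      "\<And>m. d (f m) = exp_prod G h (\<lambda>i. int_decode (nth_code m (i - 1))) j" by auto
    obtain w where w: "d w = gen j" using ran Suc.prems gen_carrier[of j] by (metis Suc_le_lessD rangeE)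
    let ?f = "\<lambda>m. mul (prod_encode (pw (prod_encode (w, ie (nth_code m j))), f m))"
    have "total_rec ?f" unfolding ie_def
      by (intro rec_intros total_rec_comp[OF mul(1)] total_rec_comp[OF pw(1)] total_rec_comp[OF f(1)])
    moreover have "d (?f m) = exp_prod G h (\<lambda>i. int_decode (nth_code m (i - 1))) (Suc j)" for m
      using pw(2)[of w "pr1 (ie (nth_code m j))" "pr2 (ie (nth_code m j))"]
      by (simp add: mul f w ie)
    ultimately show ?case by blast
  qed
  from this[of n] obtain conv where "total_rec conv"
    "\<And>m. d (conv m) = exp_prod G h (\<lambda>i. int_decode (nth_code m (i - 1))) n" by auto
  moreover obtain e1 where "d e1 = \<one>" using ran by (metis one_closed rangeE)
  ultimately have "effective G n H h d mul ld conv e1"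
    using ran mul dec ld(1,3) by unfold_locales
  then show ?thesis by blast
qed

lemma (in polycyclic) codes_elt_exists: "g \<in> carrier G \<Longrightarrow> \<exists>m. codes_elt G n h m g"
proof -
  have "\<exists>ts. length ts = i \<and> g = exp_prod G h (\<lambda>j. ts ! (j - 1)) i" if "i \<le> n" "g \<in> H i" for i g
    using that
  proof (induction i arbitrary: g)
    case (Suc i)
    then obtain s u where u: "u \<in> H i" "g = gen i [^] (s::int) \<otimes> u"
      using H_Suc_eq[of i] by (auto elim: cosetE)
    obtain ts where ts: "length ts = i" "u = exp_prod G h (\<lambda>j. ts ! (j - 1)) i"
      using Suc u(1) by auto
    have "exp_prod G h (\<lambda>j. ts ! (j - 1)) k = exp_prod G h (\<lambda>j. (ts @ [s]) ! (j - 1)) k" if "k \<le> i" for k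
      using that by (induction k) (auto simp: ts(1) nth_append)
    then show ?case using u ts by (intro exI[of _ "ts @ [s]"]) (simp add: nth_append)
  qed simp
  then show "g \<in> carrier G \<Longrightarrow> \<exists>m. codes_elt G n h m g" unfolding codes_elt_def by force
qed

section \<open>Compactness of configuration spaces\<close>

lemma topspace_config [simp]: "topspace (config_topology A I) = I \<rightarrow>\<^sub>E A"
  by (simp add: config_topology_def)

lemma compact_config: "finite A \<Longrightarrow> compact_space (config_topology A I)"
  unfolding config_topology_def
  by (simp add: compact_space_product_topology compact_space_discrete_topology)

lemma openin_cylinder:
  assumes "finite F" "F \<subseteq> I" "u \<in> F \<rightarrow> A"
  shows "openin (config_topology A I) {x \<in> I \<rightarrow>\<^sub>E A. \<forall>i\<in>F. x i = u i}"
proof -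
  let ?S = "\<lambda>i. if i \<in> F then {u i} else A"
  have "{x \<in> I \<rightarrow>\<^sub>E A. \<forall>i\<in>F. x i = u i} = (\<Pi>\<^sub>E i\<in>I. ?S i)"
    using assms by (auto simp: PiE_iff Pi_iff extensional_def split: if_splits)
  moreover have "finite {i \<in> I. ?S i \<noteq> topspace (discrete_topology A)}"
    using assms(1) by (rule rev_finite_subset) auto
  moreover have "openin (discrete_topology A) (?S i)" for i
    using assms by auto
  ultimately show ?thesis unfolding config_topology_def by (simp add: openin_PiE_gen)
qed

text \<open>The complement is a union of cylinders over \<open>F\<close>.\<close>

lemma closedin_finitely_determined:
  assumes "finite F" "F \<subseteq> I"
    and det: "\<And>x y. \<lbrakk>x \<in> I \<rightarrow>\<^sub>E A; y \<in> I \<rightarrow>\<^sub>E A; \<And>i. i \<in> F \<Longrightarrow> x i = y i; P x\<rbrakk> \<Longrightarrow> P y"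
  shows "closedin (config_topology A I) {x \<in> I \<rightarrow>\<^sub>E A. P x}"
proof -
  have "{x \<in> I \<rightarrow>\<^sub>E A. \<not> P x} = (\<Union>u\<in>{x \<in> I \<rightarrow>\<^sub>E A. \<not> P x}. {x \<in> I \<rightarrow>\<^sub>E A. \<forall>i\<in>F. x i = u i})"
    (is "?L = ?R")
  proof
    show "?L \<subseteq> ?R" by blast
    show "?R \<subseteq> ?L"
    proof
      fix x assume "x \<in> ?R"
      then obtain u where "u \<in> I \<rightarrow>\<^sub>E A" "\<not> P u" "x \<in> I \<rightarrow>\<^sub>E A" "\<forall>i\<in>F. x i = u i" by blast
      then show "x \<in> ?L" using det[of x u] by blast
    qed
  qed
  moreover have "openin (config_topology A I) \<dots>"
    using assms by (intro openin_Union ballI) (auto intro!: openin_cylinder)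
  ultimately have "openin (config_topology A I) {x \<in> I \<rightarrow>\<^sub>E A. \<not> P x}" by simp
  moreover have "{x \<in> I \<rightarrow>\<^sub>E A. \<not> P x} = topspace (config_topology A I) - {x \<in> I \<rightarrow>\<^sub>E A. P x}" by auto
  ultimately show ?thesis unfolding closedin_def by auto
qed

lemma config_finite_subfamily:
  assumes "finite A" and closed: "\<And>g. g \<in> S \<Longrightarrow> closedin (config_topology A I) {z \<in> I \<rightarrow>\<^sub>E A. P g z}"
    and empty: "\<And>z. z \<in> I \<rightarrow>\<^sub>E A \<Longrightarrow> \<exists>g\<in>S. \<not> P g z"
  shows "\<exists>F\<subseteq>S. finite F \<and> (\<forall>z\<in>I \<rightarrow>\<^sub>E A. \<exists>g\<in>F. \<not> P g z)"
proof (rule ccontr)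
  assume neg: "\<not> ?thesis"
  \<comment> \<open>Including the whole space keeps the points of the intersection inside it, also
    when \<open>S\<close> is empty.\<close>
  define U where "U = insert (I \<rightarrow>\<^sub>E A) ((\<lambda>g. {z \<in> I \<rightarrow>\<^sub>E A. P g z}) ` S)"
  have c1: "\<forall>C\<in>U. closedin (config_topology A I) C"
    unfolding U_def using closed closedin_topspace[of "config_topology A I"] by auto
  have c2: "\<Inter>V \<noteq> {}" if V: "finite V" "V \<subseteq> U" for V
  proof -
    have "V - {I \<rightarrow>\<^sub>E A} \<subseteq> (\<lambda>g. {z \<in> I \<rightarrow>\<^sub>E A. P g z}) ` S" using V(2) unfolding U_def by blast
    then obtain F where F: "F \<subseteq> S" "finite F" "V - {I \<rightarrow>\<^sub>E A} = (\<lambda>g. {z \<in> I \<rightarrow>\<^sub>E A. P g z}) ` F"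
      using V(1) by (meson finite_Diff finite_subset_image)
    have "\<exists>z\<in>I \<rightarrow>\<^sub>E A. \<forall>g\<in>F. P g z"
    proof (rule ccontr)
      assume "\<not> ?thesis"
      then show False using neg F(1,2) by (metis (no_types, lifting))
    qed
    then obtain z where z: "z \<in> I \<rightarrow>\<^sub>E A" "\<forall>g\<in>F. P g z" by blast
    have "z \<in> C" if C: "C \<in> V" for C
    proof (cases "C = I \<rightarrow>\<^sub>E A")
      case False
      then have "C \<in> V - {I \<rightarrow>\<^sub>E A}" using C by simp
      then show ?thesis unfolding F(3) using z by blast
    qed (use z in simp)
    then show ?thesis by blast
  qed
  have "\<Inter>U \<noteq> {}"
    by (rule compact_config[OF assms(1), of I, unfolded compact_space_fip, rule_format]) (use c1 c2 in auto)
  then obtain z where z: "z \<in> \<Inter>U" by blast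
  then have "z \<in> I \<rightarrow>\<^sub>E A" unfolding U_def by simp
  then obtain g where "g \<in> S" "\<not> P g z" using empty by blast
  then show False using z unfolding U_def by blast
qed

lemma config_nest:
  assumes "finite A" "\<And>m::nat. closedin (config_topology A I) {z \<in> I \<rightarrow>\<^sub>E A. P m z}"
    and dec: "\<And>m z. P (Suc m) z \<Longrightarrow> P m z" and ex: "\<And>m. \<exists>z\<in>I \<rightarrow>\<^sub>E A. P m z"
  shows "\<exists>z\<in>I \<rightarrow>\<^sub>E A. \<forall>m. P m z"
proof (rule ccontr)
  assume "\<not> ?thesis"
  then obtain F where F: "finite F" "\<forall>z\<in>I \<rightarrow>\<^sub>E A. \<exists>m\<in>F. \<not> P m z"
    using config_finite_subfamily[of A UNIV I P] assms(1,2) by blast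
  have mono: "P m z \<Longrightarrow> k \<le> m \<Longrightarrow> P k z" for k m z
    by (induction m rule: nat_induct) (auto simp: le_Suc_eq dest: dec)
  obtain z where "z \<in> I \<rightarrow>\<^sub>E A" "P (\<Sum>F) z" using ex by blast
  moreover have "m \<le> \<Sum>F" if "m \<in> F" for m
    using that F(1) member_le_sum[of m F "\<lambda>x. x"] by auto
  ultimately show False using F(2) mono by blast
qed

section \<open>Agreement with a globally valid configuration\<close>

text \<open>This is membership of \<open>z|S\<close> in \<open>Z|S\<close>, phrased for total
  functions so that nothing has to be restricted when \<open>S\<close> changes.\<close>

definition agrees :: "('i \<Rightarrow> 's) set \<Rightarrow> 'i set \<Rightarrow> ('i \<Rightarrow> 's) \<Rightarrow> bool" where
  "agrees Z S z \<longleftrightarrow> (\<exists>z'\<in>Z. \<forall>j\<in>S. z' j = z j)"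

lemma agrees_mono: "agrees Z S z \<Longrightarrow> S' \<subseteq> S \<Longrightarrow> agrees Z S' z"
  unfolding agrees_def by blast

lemma agrees_cong: "agrees Z S z \<Longrightarrow> (\<And>j. j \<in> S \<Longrightarrow> z j = z' j) \<Longrightarrow> agrees Z S z'"
  unfolding agrees_def by fastforce

lemma restrictions_iff_agrees:
  "(restrict z B)(c := a) \<in> restrictions Z (insert c B) \<longleftrightarrow> agrees Z (insert c B) (z(c := a))"
proof -
  have "(restrict z B)(c := a) = restrict (z(c := a)) (insert c B)" by (auto simp: fun_eq_iff)
  moreover have "restrict w S \<in> restrictions Z S \<longleftrightarrow> agrees Z S w" for w S
    unfolding restrictions_def agrees_def image_iff by (metis restrict_ext restrict_apply')
  ultimately show ?thesis by simp
qed

text \<open>For \<open>B\<close> inside \<open>D\<close> the opposite implication is trivial, so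
  only this half of the avo condition is recorded.\<close>

definition memory :: "'s set \<Rightarrow> ('i \<Rightarrow> 's) set \<Rightarrow> 'i set \<Rightarrow> 'i \<Rightarrow> 'i set \<Rightarrow> bool" where
  "memory A Z D c B \<longleftrightarrow> (\<forall>z\<in>Z. \<forall>a\<in>A.
     agrees Z (insert c B) (z(c := a)) \<longrightarrow> agrees Z (insert c D) (z(c := a)))"

lemma avo_at_iff_memory: "avo_at A Z D c \<longleftrightarrow> (\<exists>B. finite B \<and> B \<subseteq> D \<and> memory A Z D c B)"
  unfolding avo_at_def restrictions_iff_agrees memory_def
  by (meson agrees_mono insert_mono)

text \<open>The hypothesis is strengthened and the conclusion weakened. In particular a memory set
  of an infinite interval serves its finite truncations, which is the source of uniformity.\<close>

lemma memory_mono: "memory A Z D c B \<Longrightarrow> B \<subseteq> B' \<Longrightarrow> D' \<subseteq> D \<Longrightarrow> memory A Z D' c B'"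
  unfolding memory_def by (meson agrees_mono insert_mono)

lemma closedin_agrees:
  assumes "finite S" "S \<subseteq> I"
  shows "closedin (config_topology A I) {z \<in> I \<rightarrow>\<^sub>E A. agrees Z S z}"
    "closedin (config_topology A I) {z \<in> I \<rightarrow>\<^sub>E A. \<not> agrees Z S z}"
  by (rule closedin_finitely_determined[OF assms]; metis agrees_cong)+

lemma closedin_coincide: "closedin (config_topology A I) {z' \<in> I \<rightarrow>\<^sub>E A. \<forall>j\<in>S. z' j = z j}"
proof -
  have "closedin (config_topology A I) {z' \<in> I \<rightarrow>\<^sub>E A. j \<in> S \<longrightarrow> z' j = z j}" for j
  proof (cases "j \<in> I")
    case True
    then show ?thesis by (intro closedin_finitely_determined[of "{j}"]) auto
  next
    case False
    then have "z' j = undefined" if "z' \<in> I \<rightarrow>\<^sub>E A" for z' using that by auto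
    then show ?thesis by (intro closedin_finitely_determined[of "{}"]; metis empty_iff finite.emptyI empty_subsetI)
  qed
  then have "closedin (config_topology A I) (\<Inter>j. {z' \<in> I \<rightarrow>\<^sub>E A. j \<in> S \<longrightarrow> z' j = z j})"
    by (intro closedin_Inter) auto
  moreover have "(\<Inter>j. {z' \<in> I \<rightarrow>\<^sub>E A. j \<in> S \<longrightarrow> z' j = z j}) = {z' \<in> I \<rightarrow>\<^sub>E A. \<forall>j\<in>S. z' j = z j}" by auto
  ultimately show ?thesis by simp
qed

lemma agrees_limit:
  assumes "finite A" "closedin (config_topology A I) Z"
    and "\<And>m. S m \<subseteq> S (Suc m)" "\<And>m::nat. agrees Z (S m) z"
  shows "agrees Z (\<Union>m. S m) z"
proof -
  have Z: "Z \<subseteq> I \<rightarrow>\<^sub>E A" using closedin_subset[OF assms(2)] by simp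
  have "closedin (config_topology A I) {z' \<in> I \<rightarrow>\<^sub>E A. z' \<in> Z \<and> (\<forall>j\<in>S m. z' j = z j)}" for m
  proof -
    have "{z' \<in> I \<rightarrow>\<^sub>E A. z' \<in> Z \<and> (\<forall>j\<in>S m. z' j = z j)} = Z \<inter> {z' \<in> I \<rightarrow>\<^sub>E A. \<forall>j\<in>S m. z' j = z j}"
      using Z by auto
    then show ?thesis using closedin_Int[OF assms(2) closedin_coincide[of A I "S m" z]] by (simp only:)
  qed
  moreover have "\<exists>z'\<in>I \<rightarrow>\<^sub>E A. z' \<in> Z \<and> (\<forall>j\<in>S m. z' j = z j)" for m
    using assms(4)[of m] Z unfolding agrees_def by blast
  ultimately have "\<exists>z'\<in>I \<rightarrow>\<^sub>E A. \<forall>m. z' \<in> Z \<and> (\<forall>j\<in>S m. z' j = z j)"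
    using assms(1,3) by (intro config_nest) blast+
  then show ?thesis unfolding agrees_def by blast
qed

section \<open>Translations, uniform memory and validity from local validity\<close>

context polycyclic
begin

definition shift_invariant2 :: "('g \<times> nat \<Rightarrow> 's) set \<Rightarrow> bool" where
  "shift_invariant2 Z \<longleftrightarrow> (\<forall>g\<in>carrier G. \<forall>z\<in>Z. shift2 G g z \<in> Z)"

lemma agrees_translate:
  assumes "shift_invariant2 Z" "g \<in> carrier G" "S \<subseteq> carrier G \<times> {1, 2}" "agrees Z S z"
    and "\<And>k j. (k, j) \<in> S \<Longrightarrow> z' (g \<otimes> k, j) = z (k, j)"
    and "S' \<subseteq> (\<lambda>(k, j). (g \<otimes> k, j)) ` S"
  shows "agrees Z S' z'"
proof -
  obtain w where w: "w \<in> Z" "\<forall>j\<in>S. w j = z j" using assms(4) unfolding agrees_def by blast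
  have "shift2 G g w \<in> Z" using assms(1,2) w(1) by (simp add: shift_invariant2_def)
  moreover have "shift2 G g w p = z' p" if p: "p \<in> S'" for p
  proof -
    obtain k j where kj: "(k, j) \<in> S" "p = (g \<otimes> k, j)"
      using subsetD[OF assms(6) p] by auto
    have "k \<in> carrier G" "j \<in> {1, 2}" using kj(1) assms(3) by auto
    then have "shift2 G g w p = w (k, j)"
      using assms(2) by (simp add: kj(2) shift2_def m_assoc[symmetric])
    then show ?thesis using w(2) kj assms(5) by auto
  qed
  ultimately show ?thesis unfolding agrees_def by blast
qed

lemma inv_translate_cancel: "g \<in> carrier G \<Longrightarrow> k \<in> carrier G \<Longrightarrow> inv g \<otimes> (g \<otimes> k) = k"
  "g \<in> carrier G \<Longrightarrow> k \<in> carrier G \<Longrightarrow> g \<otimes> (inv g \<otimes> k) = k"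
  by (simp_all add: m_assoc[symmetric])

lemma l_coset_iff: "g \<in> carrier G \<Longrightarrow> M \<subseteq> carrier G \<Longrightarrow> k \<in> g <# M \<longleftrightarrow> k \<in> carrier G \<and> inv g \<otimes> k \<in> M"
proof
  assume g: "g \<in> carrier G" and M: "M \<subseteq> carrier G"
  assume "k \<in> g <# M"
  then obtain m where "m \<in> M" "k = g \<otimes> m" by (auto simp: l_coset_def)
  then show "k \<in> carrier G \<and> inv g \<otimes> k \<in> M" using g M inv_translate_cancel(1)[OF g] by auto
next
  assume g: "g \<in> carrier G" and "k \<in> carrier G \<and> inv g \<otimes> k \<in> M"
  moreover from this have "k = g \<otimes> (inv g \<otimes> k)" using inv_translate_cancel(2) by simp
  ultimately show "k \<in> g <# M" unfolding l_coset_def by blast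
qed

lemma depth_bound:
  assumes "finite B" obtains N where "\<And>g i t. g \<in> B \<Longrightarrow> depth g i t \<Longrightarrow> t < N"
proof -
  have "\<exists>N. \<forall>g\<in>B. \<forall>i t. depth g i t \<longrightarrow> t < N"
    using assms
  proof (induction B)
    case (insert g B)
    then obtain N where N: "\<forall>g\<in>B. \<forall>i t. depth g i t \<longrightarrow> t < N" by blast
    show ?case
    proof (cases "\<exists>i t. depth g i t")
      case True
      then obtain i t where "depth g i t" by blast
      then have "\<forall>i' t'. depth g i' t' \<longrightarrow> t' < Suc t" using depth_unique by blast
      then show ?thesis using N by (intro exI[of _ "max N (Suc t)"]) (auto simp: less_max_iff_disj)
    qed (use N in auto)
  qed auto
  then show thesis using that by blast
qed

text \<open>A neighbour \<open>mv'\<close> differs from \<open>mv\<close> only where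
  \<open>mv\<close> is infinite, and there it is at least \<open>N\<close>; so elements can only be
  lost, and none of depth below \<open>N\<close> is.\<close>

lemma near_lower:
  assumes "\<And>j. j < n \<Longrightarrow> near N (mv j) (mv' j)"
  shows "lower mv' \<subseteq> lower mv"
    and "(\<And>i t. depth g i t \<Longrightarrow> t < N) \<Longrightarrow> g \<in> lower mv' \<longleftrightarrow> g \<in> lower mv"
proof -
  have le: "mv' j \<le> mv j" if "j < n" for j
    using assms[OF that] by (auto simp: near_def split: if_splits)
  show sub: "lower mv' \<subseteq> lower mv"
  proof
    fix g assume "g \<in> lower mv'"
    then obtain i t where "depth g i t" "enat t < mv' i" by (auto simp: lower_def)
    moreover have "enat t < mv i" using calculation le[of i] by (auto simp: depth_def)
    ultimately show "g \<in> lower mv" by (auto simp: lower_def)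
  qed
  assume N: "\<And>i t. depth g i t \<Longrightarrow> t < N"
  have "g \<in> lower mv'" if g: "g \<in> lower mv"
  proof -
    obtain i t where it: "depth g i t" "enat t < mv i" using g by (auto simp: lower_def)
    have "near N (mv i) (mv' i)" using it by (intro assms) (simp add: depth_def)
    then have "enat t < mv' i" using it N[OF it(1)]
      by (auto simp: near_def split: if_splits) (meson enat_ord_simps(2) order_less_le_trans)
    then show ?thesis using it by (auto simp: lower_def)
  qed
  then show "g \<in> lower mv' \<longleftrightarrow> g \<in> lower mv" using sub by blast
qed

text \<open>\<open>T\<close> consists of the tracks that are known completely and \<open>c\<close>
  is the track to be filled. The memory is described by columns \<open>M\<close>, cut down to the
  domain, so that the same \<open>M\<close> makes sense for all \<open>mv\<close>.\<close>

lemma uniform_memory: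
  fixes T :: "('g \<times> nat) set"
  assumes "finite K" "K \<subseteq> {1, 2}" and T: "T = carrier G \<times> K"
    and avo: "\<And>mv. avo_at A Z (T \<union> lower mv \<times> {c}) (\<one>, c)"
  obtains M where "finite M" "M \<subseteq> carrier G"
    "\<And>mv. memory A Z (T \<union> lower mv \<times> {c}) (\<one>, c) ((T \<union> lower mv \<times> {c}) \<inter> M \<times> UNIV)"
proof -
  let ?Phi = "\<lambda>mv M. memory A Z (T \<union> lower mv \<times> {c}) (\<one>, c) ((T \<union> lower mv \<times> {c}) \<inter> M \<times> UNIV)"
  have "\<exists>M. finite M \<and> M \<subseteq> carrier G \<and> (\<forall>mv. ?Phi mv M)"
  proof (rule finite_uniform[where n = n])
    fix mv
    obtain B where B: "finite B" "B \<subseteq> T \<union> lower mv \<times> {c}" "memory A Z (T \<union> lower mv \<times> {c}) (\<one>, c) B"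
      using avo[of mv] unfolding avo_at_iff_memory by blast
    have fin: "finite (fst ` B)" using B(1) by simp
    obtain N where N: "\<And>g i t. g \<in> fst ` B \<Longrightarrow> depth g i t \<Longrightarrow> t < N"
      using depth_bound[OF fin] by blast
    have "?Phi mv' (fst ` B)" if near: "\<forall>j<n. near N (mv j) (mv' j)" for mv'
    proof (rule memory_mono[OF B(3)])
      show "B \<subseteq> (T \<union> lower mv' \<times> {c}) \<inter> fst ` B \<times> UNIV"
      proof
        fix p assume p: "p \<in> B"
        then have "fst p \<in> fst ` B" by simp
        then have "fst p \<in> lower mv' \<longleftrightarrow> fst p \<in> lower mv"
          using near_lower(2)[of N mv mv' "fst p"] near N by blast
        moreover have "p \<in> T \<union> lower mv \<times> {c}" using p B(2) by blast
        ultimately have "p \<in> T \<union> lower mv' \<times> {c}" by (cases p) auto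
        then show "p \<in> (T \<union> lower mv' \<times> {c}) \<inter> fst ` B \<times> UNIV" using p by (cases p) force
      qed
      show "T \<union> lower mv' \<times> {c} \<subseteq> T \<union> lower mv \<times> {c}" using near_lower(1)[of N mv mv'] near by auto
    qed
    moreover have "fst ` B \<subseteq> carrier G" using B(2) lower_carrier[of mv] unfolding T by fastforce
    ultimately show "\<exists>M N. finite M \<and> M \<subseteq> carrier G \<and> (\<forall>mv'. (\<forall>j<n. near N (mv j) (mv' j)) \<longrightarrow> ?Phi mv' M)"
      using fin by blast
  next
    fix mv M M' assume "?Phi mv M" "M \<subseteq> M'"
    then show "?Phi mv M'" by (elim memory_mono) auto
  qed
  then show thesis using that by blast
qed

text \<open>This is the argument that shows avoshifts to be of finite type.\<close>

lemma local_to_global: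
  fixes Z :: "('g \<times> nat \<Rightarrow> 's) set"
  assumes A: "finite A" and Z: "closedin (config_topology A (carrier G \<times> {1, 2})) Z" "shift_invariant2 Z"
    and T: "K \<subseteq> {1, 2}" "T = carrier G \<times> K" and c: "c \<in> {1, 2}"
    and mem: "\<And>mv. memory A Z (T \<union> lower mv \<times> {c}) (\<one>, c) ((T \<union> lower mv \<times> {c}) \<inter> M \<times> UNIV)"
    and M: "M \<subseteq> carrier G" "\<one> \<in> M"
    and E: "E = carrier G \<or> (\<exists>mv. E = lower mv)"
    and z: "z \<in> carrier G \<times> {1, 2} \<rightarrow>\<^sub>E A" "agrees Z T z"
      "\<And>g. g \<in> carrier G \<Longrightarrow> agrees Z ((T \<union> E \<times> {c}) \<inter> (g <# M) \<times> UNIV) z"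
  shows "agrees Z (T \<union> E \<times> {c}) z"
proof -
  let ?J = "carrier G \<times> {1, 2::nat}"
  define loc where "loc E z \<longleftrightarrow> (\<forall>g\<in>carrier G. agrees Z ((T \<union> E \<times> {c}) \<inter> (g <# M) \<times> UNIV) z)" for E z
  have loc_mono: "loc E z \<Longrightarrow> D \<subseteq> E \<Longrightarrow> loc D z" for D E z
    unfolding loc_def by (meson agrees_mono Int_mono Un_mono Sigma_mono order_refl)
  have tr: "(\<lambda>(k, j). (g \<otimes> k, j)) ` (T \<union> D \<times> {c}) = T \<union> (g <# D) \<times> {c}"
    if "g \<in> carrier G" "D \<subseteq> carrier G" for g D
  proof -
    have "(\<lambda>(k, j). (g \<otimes> k, j)) ` T = T"
    proof
      show "T \<subseteq> (\<lambda>(k, j). (g \<otimes> k, j)) ` T"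
      proof
        fix p assume "p \<in> T"
        then show "p \<in> (\<lambda>(k, j). (g \<otimes> k, j)) ` T"
          using that(1) inv_translate_cancel(2)[OF that(1)] unfolding T(2)
          by (intro image_eqI[of _ _ "(inv g \<otimes> fst p, snd p)"]) (auto simp: mem_Times_iff)
      qed
    qed (use that in \<open>auto simp: T(2)\<close>)
    moreover have "(\<lambda>(k, j). (g \<otimes> k, j)) ` (D \<times> {c}) = (g <# D) \<times> {c}" by (force simp: l_coset_def)
    ultimately show ?thesis by (simp add: image_Un)
  qed
  \<comment> \<open>Quantifying over all locally valid \<open>z\<close> makes the relation stable
    under translations; \<open>T\<close> is invariant and can stay fixed.\<close>
  define Psi where "Psi D E \<longleftrightarrow> (\<forall>z\<in>?J \<rightarrow>\<^sub>E A. loc E z \<longrightarrow>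
    agrees Z (T \<union> D \<times> {c}) z \<longrightarrow> agrees Z (T \<union> E \<times> {c}) z)" for D E
  interpret filling G n H h Psi UNIV
  proof unfold_locales
    fix D E F assume "D \<subseteq> E" "E \<subseteq> F" "Psi D E" "Psi E F"
    then show "Psi D F" unfolding Psi_def using loc_mono by blast
  next
    fix g D E assume g: "g \<in> carrier G" and DE: "D \<subseteq> E" "E \<subseteq> carrier G" and P: "Psi D E"
    show "Psi (g <# D) (g <# E)"
      unfolding Psi_def
    proof (intro ballI impI)
      fix z assume z: "z \<in> ?J \<rightarrow>\<^sub>E A" "loc (g <# E) z" "agrees Z (T \<union> (g <# D) \<times> {c}) z"
      let ?z = "shift2 G (inv g) z"
      have zv: "?z (k, j) = z (g \<otimes> k, j)" if "k \<in> carrier G" "j \<in> {1, 2}" for k j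
        using that g by (simp add: shift2_def)
      have zJ: "?z \<in> ?J \<rightarrow>\<^sub>E A" using z(1) g by (auto simp: shift2_def PiE_iff Pi_iff)
      have pull: "agrees Z (S \<inter> (k <# M) \<times> UNIV) ?z"
        if "agrees Z ((\<lambda>(k, j). (g \<otimes> k, j)) ` S \<inter> ((g \<otimes> k) <# M) \<times> UNIV) z" "S \<subseteq> ?J" "k \<in> carrier G" for S k
      proof (rule agrees_translate[OF Z(2) inv_closed[OF g] _ that(1)])
        show "(\<lambda>(k, j). (g \<otimes> k, j)) ` S \<inter> ((g \<otimes> k) <# M) \<times> UNIV \<subseteq> ?J" using that(2) g by auto
        show "?z (inv g \<otimes> l, j) = z (l, j)"
          if "(l, j) \<in> (\<lambda>(k, j). (g \<otimes> k, j)) ` S \<inter> ((g \<otimes> k) <# M) \<times> UNIV" for l j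
          using that \<open>S \<subseteq> ?J\<close> g zv inv_translate_cancel by auto
        show "S \<inter> (k <# M) \<times> UNIV \<subseteq>
            (\<lambda>(k, j). (inv g \<otimes> k, j)) ` ((\<lambda>(k, j). (g \<otimes> k, j)) ` S \<inter> ((g \<otimes> k) <# M) \<times> UNIV)"
        proof
          fix p assume p: "p \<in> S \<inter> (k <# M) \<times> UNIV"
          then obtain l j m where lj: "p = (l, j)" "(l, j) \<in> S" "m \<in> M" "l = k \<otimes> m" by (auto simp: l_coset_def)
          have "l \<in> carrier G" "m \<in> carrier G" using lj that(2) M(1) by auto
          then have 1: "g \<otimes> l \<in> (g \<otimes> k) <# M" "inv g \<otimes> (g \<otimes> l) = l"
            using g that(3) lj inv_translate_cancel
            by (auto simp: l_coset_def m_assoc intro!: bexI[of _ m])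
          have "(g \<otimes> l, j) \<in> (\<lambda>(k, j). (g \<otimes> k, j)) ` S" using lj(2) by (rule rev_image_eqI) simp
          then have "(g \<otimes> l, j) \<in> (\<lambda>(k, j). (g \<otimes> k, j)) ` S \<inter> ((g \<otimes> k) <# M) \<times> UNIV"
            using 1(1) by blast
          then show "p \<in> (\<lambda>(k, j). (inv g \<otimes> k, j)) ` ((\<lambda>(k, j). (g \<otimes> k, j)) ` S \<inter> ((g \<otimes> k) <# M) \<times> UNIV)"
            by (rule rev_image_eqI) (simp add: lj(1) 1(2))
        qed
      qed
      have TJ: "T \<union> D' \<times> {c} \<subseteq> ?J" if "D' \<subseteq> carrier G" for D' using that T c by auto
      have "loc E ?z"
        unfolding loc_def
      proof
        fix k assume k: "k \<in> carrier G"
        show "agrees Z ((T \<union> E \<times> {c}) \<inter> (k <# M) \<times> UNIV) ?z"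
          using z(2) g k unfolding loc_def
          by (intro pull TJ DE) (auto simp: tr DE)
      qed
      moreover have "agrees Z (T \<union> D \<times> {c}) ?z"
      proof (rule agrees_translate[OF Z(2) inv_closed[OF g] _ z(3)])
        show "T \<union> (g <# D) \<times> {c} \<subseteq> ?J" using DE g by (intro TJ l_coset_subset_G) auto
        show "?z (inv g \<otimes> k, j) = z (k, j)" if "(k, j) \<in> T \<union> (g <# D) \<times> {c}" for k j
        proof -
          have "(k, j) \<in> ?J" using that TJ[of "g <# D"] DE g l_coset_subset_G[of D g] by blast
          then show ?thesis using zv g inv_translate_cancel by auto
        qed
        have "inv g <# (g <# D) = D" using g DE by (simp add: lcos_m_assoc lcos_mult_one)
        then show "T \<union> D \<times> {c} \<subseteq> (\<lambda>(k, j). (inv g \<otimes> k, j)) ` (T \<union> (g <# D) \<times> {c})"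
          using DE g l_coset_subset_G[of D g] by (subst tr) auto
      qed
      ultimately have "agrees Z (T \<union> E \<times> {c}) ?z" using P zJ unfolding Psi_def by blast
      then show "agrees Z (T \<union> (g <# E) \<times> {c}) z"
        by (rule agrees_translate[OF Z(2) g TJ[OF DE(2)]]) (use TJ[OF DE(2)] DE g zv tr in auto)
    qed
  next
    fix C :: "nat \<Rightarrow> 'g set" and D
    assume C: "\<And>m. C m \<subseteq> C (Suc m)" "\<And>m. Psi D (C m)"
    show "Psi D (\<Union>m. C m)"
      unfolding Psi_def
    proof (intro ballI impI)
      fix z assume z: "z \<in> ?J \<rightarrow>\<^sub>E A" "loc (\<Union>m. C m) z" "agrees Z (T \<union> D \<times> {c}) z"
      have "loc (C m) z" for m using z(2) by (rule loc_mono) blast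
      then have "agrees Z (T \<union> C m \<times> {c}) z" for m using C(2)[of m] z unfolding Psi_def by blast
      then have "agrees Z (\<Union>m. T \<union> C m \<times> {c}) z"
        using C(1) by (intro agrees_limit[OF A Z(1)]) blast+
      then show "agrees Z (T \<union> (\<Union>m. C m) \<times> {c}) z" by (rule agrees_mono) blast
    qed
  next
    fix mv :: "nat \<Rightarrow> enat"
    show "Psi (lower mv) (insert \<one> (lower mv))"
      unfolding Psi_def
    proof (intro ballI impI)
      fix z assume z: "z \<in> ?J \<rightarrow>\<^sub>E A" "loc (insert \<one> (lower mv)) z" "agrees Z (T \<union> lower mv \<times> {c}) z"
      let ?D = "T \<union> lower mv \<times> {c}"
      \<comment> \<open>The memory property concerns points of \<open>Z\<close> changed at one
        place, so \<open>z\<close> is replaced by a point of \<open>Z\<close> that coincides with it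
        on the domain.\<close>
      obtain w where w: "w \<in> Z" "\<forall>j\<in>?D. w j = z j" using z(3) unfolding agrees_def by blast
      have e1: "T \<union> insert \<one> (lower mv) \<times> {c} = insert (\<one>, c) ?D" by auto
      have eq: "(w((\<one>, c) := z (\<one>, c))) j = z j" if "j \<in> insert (\<one>, c) ?D" for j
        using that w(2) by auto
      have "agrees Z (insert (\<one>, c) ?D \<inter> (\<one> <# M) \<times> UNIV) z" using z(2) unfolding loc_def e1 by blast
      then have "agrees Z (insert (\<one>, c) (?D \<inter> M \<times> UNIV)) z"
        using M by (elim agrees_mono) (auto simp: lcos_mult_one)
      then have "agrees Z (insert (\<one>, c) (?D \<inter> M \<times> UNIV)) (w((\<one>, c) := z (\<one>, c)))"
        by (rule agrees_cong) (rule eq[symmetric], blast)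
      moreover have "z (\<one>, c) \<in> A" using z(1) c by auto
      ultimately have "agrees Z (insert (\<one>, c) ?D) (w((\<one>, c) := z (\<one>, c)))"
        using mem[of mv] w(1) unfolding memory_def by blast
      then show "agrees Z (T \<union> insert \<one> (lower mv) \<times> {c}) z"
        unfolding e1 using eq by (rule agrees_cong)
    qed
  qed (auto simp: Psi_def)
  have "Psi {} E" using E fill_carrier fill_lower by auto
  then show ?thesis using z unfolding Psi_def loc_def by auto
qed

end

section \<open>Avofactors are avoshifts\<close>

definition config_pair :: "'g set \<Rightarrow> ('g \<Rightarrow> 's) \<Rightarrow> ('g \<Rightarrow> 's) \<Rightarrow> 'g \<times> nat \<Rightarrow> 's" where
  "config_pair K x y = restrict (\<lambda>(k, j). if j = 1 then x k else y k) (K \<times> {1, 2})"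

lemma config_pair_simps [simp]:
  "k \<in> K \<Longrightarrow> config_pair K x y (k, 1) = x k" "k \<in> K \<Longrightarrow> config_pair K x y (k, Suc 0) = x k"
  "k \<in> K \<Longrightarrow> config_pair K x y (k, 2) = y k"
  by (auto simp: config_pair_def)

lemma config_pair_PiE: "x \<in> K \<rightarrow> A \<Longrightarrow> y \<in> K \<rightarrow> A \<Longrightarrow> config_pair K x y \<in> K \<times> {1, 2} \<rightarrow>\<^sub>E A"
  by (auto simp: config_pair_def)

lemma graph_eq: "graph G X f = (\<lambda>x. config_pair (carrier G) x (f x)) ` X"
  by (simp add: graph_def config_pair_def)

text \<open>A continuous image of a compact set is compact, hence closed in the Hausdorff space of
  configurations.\<close>

lemma subshift_factor:
  assumes "finite A" "subshift G A X" "factor_map G A X Y f"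
  shows "subshift G A Y"
proof -
  let ?T = "config_topology A (carrier G)"
  have X: "closedin ?T X" using assms(2) by (simp add: subshift_def)
  have f: "continuous_map (subtopology ?T X) (subtopology ?T Y) f" "f ` X = Y"
    "\<And>g x. g \<in> carrier G \<Longrightarrow> x \<in> X \<Longrightarrow> f (shift G g x) = shift G g (f x)"
    using assms(3) by (auto simp: factor_map_def)
  have "compactin ?T X" using compact_config[OF assms(1)] X by (rule closedin_compact_space)
  then have "compactin (subtopology ?T X) X" by (simp add: compactin_subtopology)
  from image_compactin[OF this f(1)] have "compactin ?T Y" using f(2) by (simp add: compactin_subtopology)
  moreover have "Hausdorff_space ?T"
    unfolding config_topology_def by (simp add: Hausdorff_space_product_topology)
  ultimately have "closedin ?T Y" by (rule compactin_imp_closedin[rotated])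
  moreover have "shift G g y \<in> Y" if g: "g \<in> carrier G" and y: "y \<in> Y" for g y
  proof -
    obtain x where x: "x \<in> X" "y = f x" using y f(2) by blast
    then have "shift G g x \<in> X" using assms(2) g by (simp add: subshift_def)
    then show ?thesis using f(2) f(3)[OF g x(1)] x(2) by (metis imageI)
  qed
  ultimately show ?thesis by (simp add: subshift_def)
qed

lemma agrees_graph_snd:
  assumes "factor_map G A X Y f" "B \<subseteq> carrier G"
  shows "agrees (graph G X f) (B \<times> {2}) z \<longleftrightarrow> agrees Y B (\<lambda>k. z (k, 2))"
proof -
  have "Y = f ` X" using assms(1) by (simp add: factor_map_def)
  then show ?thesis using assms(2) unfolding agrees_def graph_eq by (fastforce simp: subset_iff)
qed

lemma (in polycyclic) II_avoshift_avofactor: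
  assumes "finite A" "II_avoshift G n H h A X" "avofactor G n H h A X Y"
  shows "II_avoshift G n H h A Y"
proof -
  obtain f where f: "factor_map G A X Y f" and Z: "avorelation G n H h A (graph G X f)"
    using assms(3) by (auto simp: avofactor_def)
  have Yf: "Y = f ` X" using f by (simp add: factor_map_def)
  have "avo_at A Y C \<one>" if C: "inductive_interval G n H h C" for C
  proof -
    have CG: "C \<subseteq> carrier G" using C by (auto simp: inductive_interval_def)
    obtain B where B: "finite B" "B \<subseteq> C \<times> {2}" "memory A (graph G X f) (C \<times> {2}) (\<one>, 2) B"
      using Z C unfolding avorelation_def avo_at_iff_memory by blast
    define B' where "B' = fst ` B"
    have B': "B = B' \<times> {2}" "finite B'" "B' \<subseteq> C" using B(1,2) by (force simp: B'_def)+
    have "memory A Y C \<one> B'"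
      unfolding memory_def
    proof (intro ballI impI)
      fix y a assume y: "y \<in> Y" "a \<in> A" and ag: "agrees Y (insert \<one> B') (y(\<one> := a))"
      obtain x where x: "x \<in> X" "y = f x" using y(1) Yf by blast
      let ?z = "config_pair (carrier G) x y"
      have z: "?z \<in> graph G X f" using x by (auto simp: graph_eq)
      have eq: "(\<lambda>k. (?z((\<one>, 2) := a)) (k, 2)) k = (y(\<one> := a)) k" if "k \<in> carrier G" for k
        using that by simp
      have i: "insert (\<one>, 2) (S \<times> {2}) = insert \<one> S \<times> {2::nat}" for S by auto
      have ins: "insert \<one> B' \<subseteq> carrier G" "insert \<one> C \<subseteq> carrier G" using B'(3) CG by auto
      have "agrees Y (insert \<one> B') (\<lambda>k. (?z((\<one>, 2) := a)) (k, 2))"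
        by (rule agrees_cong[OF ag]) (use eq ins in auto)
      then have "agrees (graph G X f) (insert (\<one>, 2) B) (?z((\<one>, 2) := a))"
        unfolding B'(1) i using agrees_graph_snd[OF f ins(1)] by blast
      then have "agrees (graph G X f) (insert (\<one>, 2) (C \<times> {2})) (?z((\<one>, 2) := a))"
        using B(3) z y(2) unfolding memory_def by blast
      then have "agrees Y (insert \<one> C) (\<lambda>k. (?z((\<one>, 2) := a)) (k, 2))"
        unfolding i using agrees_graph_snd[OF f ins(2)] by blast
      then show "agrees Y (insert \<one> C) (y(\<one> := a))"
        by (rule agrees_cong) (use eq ins in auto)
    qed
    then show ?thesis unfolding avo_at_iff_memory using B' by blast
  qed
  moreover have "subshift G A X" using assms(2) by (simp add: II_avoshift_def)
  ultimately show ?thesis using subshift_factor[OF assms(1) _ f] by (simp add: II_avoshift_def)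
qed

section \<open>Finite certificates\<close>

lemma finite_subset_chain_UN:
  assumes "finite F" "F \<subseteq> (\<Union>m. C m)" "\<And>m::nat. C m \<subseteq> C (Suc m)"
  shows "\<exists>m. F \<subseteq> C m"
  using assms(1,2)
proof (induction F)
  case (insert x F)
  then obtain m k where "F \<subseteq> C m" "x \<in> C k" by blast
  moreover have "C m \<subseteq> C (max m k)" "C k \<subseteq> C (max m k)"
    using lift_Suc_mono_le[of C] assms(3) by auto
  ultimately show ?case by blast
qed auto

locale avo_data = polycyclic G n H h
  for G :: "('g, 'b) monoid_scheme" (structure) and n H h +
  fixes A :: "'s set" and X Y :: "('g \<Rightarrow> 's) set" and f and P and N and \<phi>
  assumes finite_A: "finite A" and finite_P: "finite P" and P: "P \<subseteq> patterns G A"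
    and X: "X = subshift_forbidding G A P"
    and X_avo: "II_avoshift G n H h A X" and f: "factor_map G A X Y f"
    and Z_avo: "avorelation G n H h A (graph G X f)" and rule: "local_rule G A X f N \<phi>"
begin

definition related :: "('g \<Rightarrow> 's) \<Rightarrow> ('g \<Rightarrow> 's) \<Rightarrow> bool" where
  "related x y \<longleftrightarrow> x \<in> X \<and> y = f x"

definition valid_at :: "('g \<Rightarrow> 's) \<Rightarrow> ('g \<Rightarrow> 's) \<Rightarrow> 'g \<Rightarrow> bool" where
  "valid_at x y g \<longleftrightarrow> (\<forall>(D, p)\<in>P. \<not> (\<forall>d\<in>D. x (g \<otimes> d) = p d)) \<and>
     y g = \<phi> (restrict (\<lambda>k. x (g \<otimes> k)) N)"

lemma N: "finite N" "N \<subseteq> carrier G"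
  using rule by (auto simp: local_rule_def)

lemma P_dom: "(D, p) \<in> P \<Longrightarrow> D \<subseteq> carrier G" "(D, p) \<in> P \<Longrightarrow> finite D"
  using P by (auto simp: patterns_def)

lemma Y_subset: "Y \<subseteq> carrier G \<rightarrow>\<^sub>E A" and f_image: "f ` X = Y"
  using f by (auto simp: factor_map_def)

lemma X_iff: "x \<in> X \<longleftrightarrow> x \<in> carrier G \<rightarrow>\<^sub>E A \<and>
    (\<forall>g\<in>carrier G. \<forall>(D, p)\<in>P. \<not> (\<forall>d\<in>D. x (g \<otimes> d) = p d))"
  unfolding X subshift_forbidding_def by blast

lemma f_eq_rule:
  assumes "x \<in> X" "g \<in> carrier G"
  shows "f x g = \<phi> (restrict (\<lambda>k. x (g \<otimes> k)) N)"
proof -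
  let ?x = "shift G (inv g) x"
  have x: "?x \<in> X" using X_avo assms by (simp add: II_avoshift_def subshift_def)
  have "f ?x = shift G (inv g) (f x)" using f assms by (simp add: factor_map_def)
  then have "f ?x \<one> = f x g" using assms(2) by (simp add: shift_def)
  moreover have "f ?x \<one> = \<phi> (restrict ?x N)" using rule x by (simp add: local_rule_def)
  moreover have "restrict ?x N = restrict (\<lambda>k. x (g \<otimes> k)) N"
    using N(2) assms(2) by (auto simp: shift_def fun_eq_iff restrict_def)
  ultimately show ?thesis by simp
qed

text \<open>Forbidden patterns describe \<open>X\<close> and a local rule describes
  \<open>f\<close>, so the graph is of finite type: one bounded condition at each
  \<open>g\<close>.\<close>

lemma related_iff:
  assumes "x \<in> carrier G \<rightarrow>\<^sub>E A" "y \<in> carrier G \<rightarrow>\<^sub>E A"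
  shows "related x y \<longleftrightarrow> (\<forall>g\<in>carrier G. valid_at x y g)"
proof
  assume "related x y"
  then show "\<forall>g\<in>carrier G. valid_at x y g"
    unfolding related_def valid_at_def using X_iff f_eq_rule by blast
next
  assume v: "\<forall>g\<in>carrier G. valid_at x y g"
  then have "x \<in> X" unfolding X_iff valid_at_def using assms(1) by blast
  moreover have "y = f x"
  proof (rule PiE_ext[OF assms(2)])
    show "f x \<in> carrier G \<rightarrow>\<^sub>E A" using \<open>x \<in> X\<close> f_image Y_subset by blast
    show "y g = f x g" if "g \<in> carrier G" for g
      using v that f_eq_rule[OF \<open>x \<in> X\<close> that] by (simp add: valid_at_def)
  qed
  ultimately show "related x y" by (simp add: related_def)
qed

lemma related_PiE: "related x y \<Longrightarrow> x \<in> carrier G \<rightarrow>\<^sub>E A" "related x y \<Longrightarrow> y \<in> carrier G \<rightarrow>\<^sub>E A"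
  unfolding related_def using X_iff f_image Y_subset by blast+

definition legal :: "'g set \<Rightarrow> ('g \<Rightarrow> 's) \<Rightarrow> ('g \<Rightarrow> 's) \<Rightarrow> bool" where
  "legal M u v \<longleftrightarrow> (\<forall>m\<in>M. u m \<in> A \<and> v m \<in> A \<and>
     (\<forall>(D, p)\<in>P. \<not> (\<forall>d\<in>D. m \<otimes> d \<in> M \<and> u (m \<otimes> d) = p d)) \<and>
     ((\<forall>k\<in>N. m \<otimes> k \<in> M) \<longrightarrow> v m = \<phi> (restrict (\<lambda>k. u (m \<otimes> k)) N)))"

text \<open>\<open>S\<close> is the region in which \<open>y\<close> is visible, the whole group in
  the construction and \<open>E\<close> in a certificate; \<open>D\<close> is the region in which
  \<open>x\<close> has been chosen. Elsewhere the legal pair is free.\<close>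

definition good :: "'g set \<Rightarrow> 'g set \<Rightarrow> 'g set \<Rightarrow> ('g \<Rightarrow> 's) \<Rightarrow> ('g \<Rightarrow> 's) \<Rightarrow> 'g \<Rightarrow> bool" where
  "good M S D x y g \<longleftrightarrow> (\<exists>u v. legal M u v \<and>
     (\<forall>m\<in>M. (g \<otimes> m \<in> S \<longrightarrow> v m = y (g \<otimes> m)) \<and> (g \<otimes> m \<in> D \<longrightarrow> u m = x (g \<otimes> m))))"

text \<open>This condition is what lets one build a preimage of a configuration \<open>y\<close> symbol by symbol.\<close>

definition extendable :: "'g set \<Rightarrow> 'g set \<Rightarrow> bool" where
  "extendable M E \<longleftrightarrow> (\<forall>mv x y. (\<forall>i. mv i \<noteq> \<infinity>) \<longrightarrow> x \<in> E \<rightarrow> A \<longrightarrow> y \<in> E \<rightarrow> A \<longrightarrow>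
     (\<forall>g\<in>E. good M E (E \<inter> lower mv) x y g) \<longrightarrow>
     (\<exists>a\<in>A. \<forall>g\<in>E. good M E (insert \<one> (E \<inter> lower mv)) (x(\<one> := a)) y g))"

text \<open>A symbol at the identity affects exactly the windows \<open>gM\<close> with
  \<open>g = inv m\<close> for some \<open>m\<close> in \<open>M\<close>; the closure conditions
  place these \<open>g\<close> and their whole windows in \<open>E\<close>. The other inclusions
  ensure that legality on \<open>M\<close> yields validity at the identity.\<close>

definition certificate :: "'g set \<Rightarrow> 'g set \<Rightarrow> bool" where
  "certificate M E \<longleftrightarrow> finite M \<and> M \<subseteq> carrier G \<and> finite E \<and> E \<subseteq> carrier G \<and> \<one> \<in> M \<and>
     (\<forall>(D, p)\<in>P. D \<subseteq> M) \<and> N \<subseteq> M \<and> (\<forall>m\<in>M. inv m \<in> E \<and> (\<forall>m'\<in>M. inv m \<otimes> m' \<in> E)) \<and>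
     extendable M E"

lemma good_mono: "good M S D x y g \<Longrightarrow> S' \<subseteq> S \<Longrightarrow> D' \<subseteq> D \<Longrightarrow> good M S' D' x y g"
  unfolding good_def by (meson subsetD)

lemma good_cong:
  assumes "good M S D x y g"
    and "\<And>m. m \<in> M \<Longrightarrow> g \<otimes> m \<in> S' \<Longrightarrow> g \<otimes> m \<in> S \<and> y (g \<otimes> m) = y' (g \<otimes> m)"
    and "\<And>m. m \<in> M \<Longrightarrow> g \<otimes> m \<in> D' \<Longrightarrow> g \<otimes> m \<in> D \<and> x (g \<otimes> m) = x' (g \<otimes> m)"
  shows "good M S' D' x' y' g"
  using assms unfolding good_def by metis

lemma legal_related:
  assumes "related x y" "M \<subseteq> carrier G" "g \<in> carrier G"
  shows "legal M (\<lambda>m. x (g \<otimes> m)) (\<lambda>m. y (g \<otimes> m))"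
  unfolding legal_def
proof (intro ballI conjI impI)
  fix m assume "m \<in> M"
  then have m: "m \<in> carrier G" and gm: "g \<otimes> m \<in> carrier G" using assms by auto
  show "x (g \<otimes> m) \<in> A" "y (g \<otimes> m) \<in> A" using related_PiE[OF assms(1)] gm by auto
  have v: "valid_at x y (g \<otimes> m)"
    using related_iff[OF related_PiE[OF assms(1)]] assms(1) gm by blast
  have a: "g \<otimes> m \<otimes> k = g \<otimes> (m \<otimes> k)" if "k \<in> carrier G" for k using that m assms(3) by (simp add: m_assoc)
  show "case Dp of (D, p) \<Rightarrow> \<not> (\<forall>d\<in>D. m \<otimes> d \<in> M \<and> x (g \<otimes> (m \<otimes> d)) = p d)" if Dp: "Dp \<in> P" for Dp
  proof (cases Dp)
    case (Pair D p)
    have "\<not> (\<forall>d\<in>D. x (g \<otimes> m \<otimes> d) = p d)" using v Dp Pair unfolding valid_at_def by auto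
    then obtain d where d: "d \<in> D" "x (g \<otimes> m \<otimes> d) \<noteq> p d" by blast
    then have "x (g \<otimes> (m \<otimes> d)) \<noteq> p d" using a[of d] P_dom(1)[of D p] Dp Pair by auto
    then show ?thesis using d(1) Pair by auto
  qed
  have "restrict (\<lambda>k. x (g \<otimes> m \<otimes> k)) N = restrict (\<lambda>k. x (g \<otimes> (m \<otimes> k))) N"
    using a N(2) by (auto simp: restrict_def fun_eq_iff)
  then show "y (g \<otimes> m) = \<phi> (restrict (\<lambda>k. x (g \<otimes> (m \<otimes> k))) N)"
    using v by (simp add: valid_at_def)
qed

lemma legal_finitely_determined:
  assumes "legal M u v" "\<And>m. m \<in> M \<Longrightarrow> u m = u' m" "\<And>m. m \<in> M \<Longrightarrow> v m = v' m"
  shows "legal M u' v'"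
  unfolding legal_def
proof (intro ballI conjI impI)
  fix m assume m: "m \<in> M"
  note l = assms(1)[unfolded legal_def, rule_format, OF m]
  show "u' m \<in> A" "v' m \<in> A" using l assms(2,3) m by auto
  show "case Dp of (D, p) \<Rightarrow> \<not> (\<forall>d\<in>D. m \<otimes> d \<in> M \<and> u' (m \<otimes> d) = p d)" if "Dp \<in> P" for Dp
  proof (cases Dp)
    case (Pair D p)
    then show ?thesis using l that assms(2) by fastforce
  qed
  assume k: "\<forall>k\<in>N. m \<otimes> k \<in> M"
  then have "restrict (\<lambda>k. u (m \<otimes> k)) N = restrict (\<lambda>k. u' (m \<otimes> k)) N"
    using assms(2) by (auto simp: restrict_def fun_eq_iff)
  then show "v' m = \<phi> (restrict (\<lambda>k. u' (m \<otimes> k)) N)" using l k assms(3) m by auto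
qed

lemma closedin_good:
  assumes "finite M" "M \<subseteq> carrier G" "g \<in> carrier G"
  shows "closedin (config_topology A (carrier G)) {x \<in> carrier G \<rightarrow>\<^sub>E A. good M S D x y g}"
proof (rule closedin_finitely_determined[of "(\<lambda>m. g \<otimes> m) ` M"])
  show "good M S D x' y g" if "good M S D x y g" "\<And>i. i \<in> (\<lambda>m. g \<otimes> m) ` M \<Longrightarrow> x i = x' i" for x x'
    using that(1) by (rule good_cong) (use that(2) in auto)
qed (use assms in auto)

lemma good_translate:
  assumes "good M S D x y g" "M \<subseteq> carrier G" "g \<in> carrier G" "k \<in> carrier G"
    and "\<And>m. m \<in> M \<Longrightarrow> k \<otimes> (g \<otimes> m) \<in> S' \<Longrightarrow> g \<otimes> m \<in> S \<and> y (g \<otimes> m) = y' (k \<otimes> (g \<otimes> m))"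
    and "\<And>m. m \<in> M \<Longrightarrow> k \<otimes> (g \<otimes> m) \<in> D' \<Longrightarrow> g \<otimes> m \<in> D \<and> x (g \<otimes> m) = x' (k \<otimes> (g \<otimes> m))"
  shows "good M S' D' x' y' (k \<otimes> g)"
proof -
  have "k \<otimes> g \<otimes> m = k \<otimes> (g \<otimes> m)" if "m \<in> M" for m using that assms(2-4) by (auto simp: m_assoc)
  then show ?thesis using assms(1,5,6) unfolding good_def by metis
qed

lemma certificate_sound:
  assumes cert: "certificate M E" and y: "y \<in> carrier G \<rightarrow>\<^sub>E A"
    and ext: "\<And>g. g \<in> carrier G \<Longrightarrow> \<exists>u v. legal M u v \<and> (\<forall>m\<in>M. v m = y (g \<otimes> m))"
  shows "y \<in> Y"
proof -
  have M: "finite M" "M \<subseteq> carrier G" "\<one> \<in> M" and E: "E \<subseteq> carrier G"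
    and PN: "\<And>D p. (D, p) \<in> P \<Longrightarrow> D \<subseteq> M" "N \<subseteq> M"
    and ME: "\<And>m. m \<in> M \<Longrightarrow> inv m \<in> E" "\<And>m m'. m \<in> M \<Longrightarrow> m' \<in> M \<Longrightarrow> inv m \<otimes> m' \<in> E"
    and ext_ME: "extendable M E"
    using cert unfolding certificate_def by auto
  have step: "\<exists>a\<in>A. \<forall>g\<in>E. good M E (insert \<one> (E \<inter> lower mv)) (x(\<one> := a)) y g"
    if "\<And>i. mv i \<noteq> \<infinity>" "x \<in> E \<rightarrow> A" "y \<in> E \<rightarrow> A"
      "\<And>g. g \<in> E \<Longrightarrow> good M E (E \<inter> lower mv) x y g" for mv x y
    using ext_ME[unfolded extendable_def, rule_format] that by blast
  let ?C = "carrier G \<rightarrow>\<^sub>E A"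
  define Good where "Good D x y \<longleftrightarrow> (\<forall>g\<in>carrier G. good M (carrier G) D x y g)" for D x y
  have Good_mono: "Good E x y \<Longrightarrow> D \<subseteq> E \<Longrightarrow> Good D x y" for D E x y
    unfolding Good_def using good_mono by blast
  \<comment> \<open>Outside \<open>D\<close> the configuration \<open>x\<close> may be changed at
    will. \<open>y\<close> is quantified too, because translations move it along with
    \<open>x\<close>.\<close>
  define Psi where "Psi D E \<longleftrightarrow> (\<forall>x\<in>?C. \<forall>y\<in>?C. Good D x y \<longrightarrow>
    (\<exists>x'\<in>?C. (\<forall>d\<in>D. x' d = x d) \<and> Good E x' y))" for D E
  interpret filling G n H h Psi "{mv. \<forall>i. mv i \<noteq> \<infinity>}"
  proof unfold_locales
    fix D E F assume DE: "D \<subseteq> E" and DEF: "Psi D E" "Psi E F"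
    show "Psi D F"
      unfolding Psi_def
    proof (intro ballI impI)
      fix x y assume xy: "x \<in> ?C" "y \<in> ?C" "Good D x y"
      obtain x' where x': "x' \<in> ?C" "\<forall>d\<in>D. x' d = x d" "Good E x' y"
        using DEF(1) xy unfolding Psi_def by blast
      obtain x'' where x'': "x'' \<in> ?C" "\<forall>d\<in>E. x'' d = x' d" "Good F x'' y"
        using DEF(2) xy(2) x'(1,3) unfolding Psi_def by blast
      have "\<forall>d\<in>D. x'' d = x d" using x' x'' DE by auto
      then show "\<exists>x'\<in>?C. (\<forall>d\<in>D. x' d = x d) \<and> Good F x' y" using x'' by blast
    qed
  next
    fix g D E assume g: "g \<in> carrier G" and DE: "D \<subseteq> E" "E \<subseteq> carrier G" and Ps: "Psi D E"
    have Good_tr: "Good D' x' y'"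
      if G: "Good D x y" and k: "k \<in> carrier G" and D: "D \<subseteq> carrier G" "D' \<subseteq> k <# D"
        and eq: "\<And>l. l \<in> carrier G \<Longrightarrow> y' (k \<otimes> l) = y l" "\<And>l. l \<in> carrier G \<Longrightarrow> x' (k \<otimes> l) = x l"
      for D D' x y x' y' k
      unfolding Good_def
    proof
      fix l assume l: "l \<in> carrier G"
      have "good M (carrier G) D x y (inv k \<otimes> l)" using G k l unfolding Good_def by simp
      then have "good M (carrier G) D' x' y' (k \<otimes> (inv k \<otimes> l))"
      proof (rule good_translate[OF _ M(2)])
        fix m assume m: "m \<in> M" "k \<otimes> (inv k \<otimes> l \<otimes> m) \<in> D'"
        then have "k \<otimes> (inv k \<otimes> l \<otimes> m) \<in> k <# D" using D by blast
        then have "inv k \<otimes> (k \<otimes> (inv k \<otimes> l \<otimes> m)) \<in> D" using l_coset_iff[OF k D(1)] by blast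
        then have "inv k \<otimes> l \<otimes> m \<in> D" using inv_translate_cancel(1) k l m M by auto
        then show "inv k \<otimes> l \<otimes> m \<in> D \<and> x (inv k \<otimes> l \<otimes> m) = x' (k \<otimes> (inv k \<otimes> l \<otimes> m))"
          using eq k l m M by auto
      qed (use k l M eq in auto)
      then show "good M (carrier G) D' x' y' l" using inv_translate_cancel(2) k l by simp
    qed
    show "Psi (g <# D) (g <# E)"
      unfolding Psi_def
    proof (intro ballI impI)
      fix x y assume x: "x \<in> ?C" and y: "y \<in> ?C" and Gd: "Good (g <# D) x y"
      let ?s = "\<lambda>k x. restrict (\<lambda>l. x (k \<otimes> l)) (carrier G)"
      have s: "?s k x \<in> ?C" if "k \<in> carrier G" "x \<in> ?C" for k x using that by auto
      have DC: "D \<subseteq> carrier G" using DE by blast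
      have "inv g <# (g <# D) = D" using g DE by (simp add: lcos_m_assoc lcos_mult_one)
      then have "Good D (?s g x) (?s g y)"
        using g DC by (intro Good_tr[OF Gd, of "inv g"]) (auto simp: inv_translate_cancel l_coset_subset_G)
      then obtain x' where x': "x' \<in> ?C" "\<forall>d\<in>D. x' d = ?s g x d" "Good E x' (?s g y)"
        using Ps[unfolded Psi_def, rule_format, OF s[OF g x] s[OF g y]] by blast
      have 1: "Good (g <# E) (?s (inv g) x') y"
        using g DE by (intro Good_tr[OF x'(3), of g]) (auto simp: inv_translate_cancel)
      have 2: "?s (inv g) x' d = x d" if d: "d \<in> g <# D" for d
      proof -
        have dc: "d \<in> carrier G" "inv g \<otimes> d \<in> D" using d l_coset_iff[OF g DC] by blast+
        have "?s (inv g) x' d = x' (inv g \<otimes> d)" using dc by simp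
        also have "\<dots> = ?s g x (inv g \<otimes> d)" using x'(2) dc(2) by blast
        also have "\<dots> = x (g \<otimes> (inv g \<otimes> d))" using g dc by simp
        finally show ?thesis using inv_translate_cancel(2)[OF g dc(1)] by simp
      qed
      show "\<exists>x'\<in>?C. (\<forall>d\<in>g <# D. x' d = x d) \<and> Good (g <# E) x' y"
        by (rule bexI[OF _ s[OF inv_closed[OF g] x'(1)]]) (intro conjI ballI 1 2)
    qed
  next
    fix C :: "nat \<Rightarrow> 'g set" and D
    assume C: "\<And>m. D \<subseteq> C m" "\<And>m. C m \<subseteq> C (Suc m)" "\<And>m. Psi D (C m)"
    show "Psi D (\<Union>m. C m)"
      unfolding Psi_def
    proof (intro ballI impI)
      fix x y assume xy: "x \<in> ?C" "y \<in> ?C" "Good D x y"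
      let ?P = "\<lambda>m x'. (\<forall>d\<in>D. x' d = x d) \<and> Good (C m) x' y"
      have "closedin (config_topology A (carrier G)) {x' \<in> ?C. ?P m x'}" for m
      proof -
        have "{x' \<in> ?C. ?P m x'} = {x' \<in> ?C. \<forall>d\<in>D. x' d = x d} \<inter>
            (\<Inter>g\<in>carrier G. {x' \<in> ?C. good M (carrier G) (C m) x' y g})"
          unfolding Good_def by auto
        moreover have "closedin (config_topology A (carrier G)) (\<Inter>g\<in>carrier G. {x' \<in> ?C. good M (carrier G) (C m) x' y g})"
          using closedin_good[OF M(1,2)] one_closed by (intro closedin_Inter) blast+
        ultimately show ?thesis using closedin_Int[OF closedin_coincide] by (simp only:)
      qed
      moreover have "\<exists>x'\<in>?C. ?P m x'" for m using C(3)[of m] xy unfolding Psi_def by blast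
      moreover have "?P m x'" if "?P (Suc m) x'" for m x' using that Good_mono C(2) by blast
      \<comment> \<open>The extensions to the different \<open>C m\<close> need not be compatible;
        compactness provides one that is good for all of them.\<close>
      ultimately obtain x' where x': "x' \<in> ?C" "\<And>m. ?P m x'"
        using config_nest[of A "carrier G" ?P] finite_A by blast
      have "Good (\<Union>m. C m) x' y"
        unfolding Good_def
      proof
        fix g assume g: "g \<in> carrier G"
        \<comment> \<open>A window is finite, so its part in the union is already contained in one
          member of the chain.\<close>
        obtain m where m: "(\<lambda>m. g \<otimes> m) ` M \<inter> (\<Union>m. C m) \<subseteq> C m"
          using finite_subset_chain_UN[of "(\<lambda>m. g \<otimes> m) ` M \<inter> (\<Union>m. C m)" C] C(2) M(1) by blast
        have "good M (carrier G) (C m) x' y g" using x'(2)[of m] g unfolding Good_def by blast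
        then show "good M (carrier G) (\<Union>m. C m) x' y g" by (rule good_cong) (use m in auto)
      qed
      then show "\<exists>x'\<in>?C. (\<forall>d\<in>D. x' d = x d) \<and> Good (\<Union>m. C m) x' y" using x' by blast
    qed
  next
    fix mv :: "nat \<Rightarrow> enat" assume mv: "mv \<in> {mv. \<forall>i. mv i \<noteq> \<infinity>}"
    show "Psi (lower mv) (insert \<one> (lower mv))"
      unfolding Psi_def
    proof (intro ballI impI)
      fix x y assume xy: "x \<in> ?C" "y \<in> ?C" "Good (lower mv) x y"
      have gE: "good M E (E \<inter> lower mv) x y g" if "g \<in> E" for g
      proof -
        have "g \<in> carrier G" using that E by blast
        then have "good M (carrier G) (lower mv) x y g" using xy(3) by (simp add: Good_def)
        then show ?thesis by (rule good_mono) (use E in auto)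
      qed
      have xyE: "x \<in> E \<rightarrow> A" "y \<in> E \<rightarrow> A" using xy(1,2) E by auto
      have "\<exists>a\<in>A. \<forall>g\<in>E. good M E (insert \<one> (E \<inter> lower mv)) (x(\<one> := a)) y g"
        by (rule step[OF _ xyE gE]) (use mv in simp)
      then obtain a where a: "a \<in> A" "\<And>g. g \<in> E \<Longrightarrow> good M E (insert \<one> (E \<inter> lower mv)) (x(\<one> := a)) y g"
        by blast
      have "good M (carrier G) (insert \<one> (lower mv)) (x(\<one> := a)) y g" if g: "g \<in> carrier G" for g
      \<comment> \<open>Only a window through the identity notices the new symbol, and such a window
        lies entirely in \<open>E\<close>.\<close>
      proof (cases "\<exists>m\<in>M. g \<otimes> m = \<one>")
        case True
        then obtain m where m: "m \<in> M" "g \<otimes> m = \<one>" by blast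
        then have gm: "g = inv m" using g M(2) by (metis inv_equality subsetD)
        have "g \<otimes> m' \<in> E" if "m' \<in> M" for m' using that m gm ME(2) by blast
        moreover have "good M E (insert \<one> (E \<inter> lower mv)) (x(\<one> := a)) y g"
          using a(2) ME(1) m gm by blast
        ultimately show ?thesis by (elim good_cong) auto
      next
        case False
        have "good M (carrier G) (lower mv) x y g" using xy(3) g unfolding Good_def by blast
        then show ?thesis by (rule good_cong) (use False in auto)
      qed
      moreover have "x(\<one> := a) \<in> ?C" using xy(1) a(1) by (auto simp: PiE_iff extensional_def)
      moreover have "\<forall>d\<in>lower mv. (x(\<one> := a)) d = x d" using one_not_lower[of mv] by auto
      ultimately show "\<exists>x'\<in>?C. (\<forall>d\<in>lower mv. x' d = x d) \<and> Good (insert \<one> (lower mv)) x' y"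
        unfolding Good_def by blast
    qed
  qed (auto simp: Psi_def)
  have "Psi {} (carrier G)" by (rule fill_carrier) (simp add: zero_enat_def)
  \<comment> \<open>The first \<open>y\<close> is a dummy preimage: on the empty set nothing is
    required of it.\<close>
  moreover have "Good {} y y" unfolding Good_def good_def using ext by blast
  ultimately obtain x where x: "x \<in> ?C" "Good (carrier G) x y" using y unfolding Psi_def by blast
  have "valid_at x y g" if g: "g \<in> carrier G" for g
  proof -
    obtain u v where uv: "legal M u v" "\<And>m. m \<in> M \<Longrightarrow> v m = y (g \<otimes> m) \<and> u m = x (g \<otimes> m)"
      using x(2) g M(2) unfolding Good_def good_def by (metis m_closed subsetD)
    note l = uv(1)[unfolded legal_def, rule_format, OF M(3)]
    have Mc: "m \<in> M \<Longrightarrow> m \<in> carrier G" for m using M(2) by blast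
    have "\<not> (\<forall>d\<in>D. x (g \<otimes> d) = p d)" if Dp: "(D, p) \<in> P" for D p
    proof
      assume *: "\<forall>d\<in>D. x (g \<otimes> d) = p d"
      have "\<one> \<otimes> d \<in> M \<and> u (\<one> \<otimes> d) = p d" if "d \<in> D" for d
        using PN(1)[OF Dp] Mc * uv(2)[of d] that by auto
      then show False using l Dp by blast
    qed
    moreover have "y g = \<phi> (restrict (\<lambda>k. x (g \<otimes> k)) N)"
    proof -
      have "restrict (\<lambda>k. u (\<one> \<otimes> k)) N = restrict (\<lambda>k. x (g \<otimes> k)) N"
        using uv(2) PN(2) Mc by (auto simp: restrict_def fun_eq_iff subset_iff)
      moreover have "\<forall>k\<in>N. \<one> \<otimes> k \<in> M" using PN(2) Mc by auto
      ultimately have "v \<one> = \<phi> (restrict (\<lambda>k. x (g \<otimes> k)) N)" using l by metis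
      then show ?thesis using uv(2)[OF M(3)] g by simp
    qed
    ultimately show ?thesis unfolding valid_at_def by blast
  qed
  then have "related x y" using related_iff x(1) y by blast
  then show ?thesis using f_image by (auto simp: related_def)
qed

section \<open>Existence of a certificate\<close>

lemma graph_closed: "closedin (config_topology A (carrier G \<times> {1, 2})) (graph G X f)"
  and graph_invariant: "shift_invariant2 (graph G X f)"
  and graph_avo_2: "avo_at A (graph G X f) (lower mv \<times> {2}) (\<one>, 2)"
  and graph_avo_1: "avo_at A (graph G X f) (carrier G \<times> {2} \<union> lower mv \<times> {1}) (\<one>, 1)"
  using Z_avo inductive_interval_lower unfolding avorelation_def shift_invariant2_def by blast+

lemma graph_iff: "z \<in> graph G X f \<longleftrightarrow> (\<exists>x y. related x y \<and> z = config_pair (carrier G) x y)"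
  by (auto simp: graph_eq related_def)

definition below :: "(nat \<Rightarrow> enat) \<Rightarrow> ('g \<times> nat) set" where
  "below mv = carrier G \<times> {2} \<union> lower mv \<times> {1}"

text \<open>The tuple is quantified inside, so that \<open>M\<close> and \<open>E\<close> do not
  depend on the interval. With both \<open>E\<close> and \<open>S\<close> the whole group this is
  the passage from local to global validity; compactness then makes \<open>E\<close> finite for
  finite \<open>S\<close>.\<close>

definition determines :: "'g set \<Rightarrow> 'g set \<Rightarrow> 'g set \<Rightarrow> bool" where
  "determines M E S \<longleftrightarrow> (\<forall>mv. \<forall>z\<in>carrier G \<times> {1, 2} \<rightarrow>\<^sub>E A.
     (\<forall>g\<in>E. agrees (graph G X f) (below mv \<inter> (g <# M) \<times> UNIV) z) \<longrightarrow>
     agrees (graph G X f) (below mv \<inter> S \<times> UNIV) z)"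

text \<open>The two avo conditions act in turn: one settles the second track by itself, the other
  fills the first track once the second is known everywhere.\<close>

lemma graph_local_to_global:
  "\<exists>M. finite M \<and> M \<subseteq> carrier G \<and> determines M (carrier G) (carrier G)"
proof -
  let ?Z = "graph G X f" and ?J = "carrier G \<times> {1, 2::nat}"
  have avo2: "avo_at A ?Z ({} \<union> lower mv \<times> {2}) (\<one>, 2)" for mv using graph_avo_2 by simp
  obtain M2 where M2: "finite M2" "M2 \<subseteq> carrier G"
    "\<And>mv. memory A ?Z ({} \<union> lower mv \<times> {2}) (\<one>, 2) (({} \<union> lower mv \<times> {2}) \<inter> M2 \<times> UNIV)"
    using uniform_memory[of "{}" "{}", OF _ _ _ avo2] by auto
  obtain M1 where M1: "finite M1" "M1 \<subseteq> carrier G"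
    "\<And>mv. memory A ?Z (carrier G \<times> {2} \<union> lower mv \<times> {1}) (\<one>, 1)
       ((carrier G \<times> {2} \<union> lower mv \<times> {1}) \<inter> M1 \<times> UNIV)"
    using uniform_memory[of "{2}" "carrier G \<times> {2}", OF _ _ _ graph_avo_1] by auto
  define M where "M = insert \<one> (M1 \<union> M2)"
  have M: "M \<subseteq> carrier G" "\<one> \<in> M" "finite M" using M1 M2 by (auto simp: M_def)
  have m2: "memory A ?Z ({} \<union> lower mv \<times> {2}) (\<one>, 2) (({} \<union> lower mv \<times> {2}) \<inter> M \<times> UNIV)" for mv
    by (rule memory_mono[OF M2(3)]) (auto simp: M_def)
  have m1: "memory A ?Z (carrier G \<times> {2} \<union> lower mv \<times> {1}) (\<one>, 1)
       ((carrier G \<times> {2} \<union> lower mv \<times> {1}) \<inter> M \<times> UNIV)" for mv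
    by (rule memory_mono[OF M1(3)]) (auto simp: M_def)
  have "agrees ?Z (below mv) z"
    if z: "z \<in> ?J \<rightarrow>\<^sub>E A" and loc: "\<And>g. g \<in> carrier G \<Longrightarrow> agrees ?Z (below mv \<inter> (g <# M) \<times> UNIV) z" for mv z
  proof -
    have "agrees ?Z ({} \<union> carrier G \<times> {2}) z"
    proof (rule local_to_global[OF finite_A graph_closed graph_invariant _ _ _ m2 M(1,2) _ z])
      show "agrees ?Z {} z" using loc[OF one_closed] by (rule agrees_mono) blast
      show "agrees ?Z (({} \<union> carrier G \<times> {2}) \<inter> (g <# M) \<times> UNIV) z" if "g \<in> carrier G" for g
        using loc[OF that] by (rule agrees_mono) (auto simp: below_def)
    qed auto
    then have "agrees ?Z (carrier G \<times> {2}) z" by simp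
    then show ?thesis unfolding below_def
      using loc unfolding below_def
      by (intro local_to_global[OF finite_A graph_closed graph_invariant _ _ _ m1 M(1,2) _ z, of "{2}"]) auto
  qed
  then have "determines M (carrier G) (carrier G)"
    unfolding determines_def by (meson agrees_mono inf_le1)
  then show ?thesis using M by blast
qed

lemma near_below:
  assumes "\<forall>j<n. near b (mv j) (mv' j)" "\<And>g i t. g \<in> S \<Longrightarrow> depth g i t \<Longrightarrow> t < b"
  shows "below mv' \<inter> S \<times> UNIV = below mv \<inter> S \<times> UNIV"
  using near_lower(2)[of b mv mv'] assms unfolding below_def by blast

text \<open>Compactness gives a finite set for one \<open>mv\<close>. Nearby tuples look the same at
  the finitely many positions involved, so the same set serves them and
  \<open>finite_uniform\<close> applies.\<close>

lemma graph_local_to_finite: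
  assumes S: "finite S" "S \<subseteq> carrier G" and M: "finite M" "M \<subseteq> carrier G"
    and glob: "determines M (carrier G) (carrier G)"
  shows "\<exists>E. finite E \<and> E \<subseteq> carrier G \<and> determines M E S"
proof -
  let ?Z = "graph G X f" and ?C = "carrier G \<times> {1, 2::nat} \<rightarrow>\<^sub>E A"
  let ?T = "config_topology A (carrier G \<times> {1, 2::nat})"
  let ?Phi = "\<lambda>mv E. \<forall>z\<in>?C. (\<forall>g\<in>E. agrees ?Z (below mv \<inter> (g <# M) \<times> UNIV) z) \<longrightarrow>
    agrees ?Z (below mv \<inter> S \<times> UNIV) z"
  have fin: "finite (below mv \<inter> F \<times> UNIV)" "below mv \<inter> F \<times> UNIV \<subseteq> carrier G \<times> {1, 2}"
    if "finite F" for mv F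
  proof -
    show "below mv \<inter> F \<times> UNIV \<subseteq> carrier G \<times> {1, 2}" using lower_carrier[of mv] by (auto simp: below_def)
    have "below mv \<inter> F \<times> UNIV \<subseteq> F \<times> {1, 2}" by (auto simp: below_def)
    then show "finite (below mv \<inter> F \<times> UNIV)" by (rule finite_subset) (use that in simp)
  qed
  have finM: "finite (g <# M)" for g using M(1) by (simp add: l_coset_def)
  have "\<exists>E. finite E \<and> E \<subseteq> carrier G \<and> (\<forall>mv. ?Phi mv E)"
  proof (rule finite_uniform[where n = n])
    fix mv
    \<comment> \<open>A \<open>z\<close> satisfying \<open>?P g\<close> for every \<open>g\<close>
      would be a counterexample to the global statement, so finitely many \<open>g\<close> already
      contradict each other.\<close>
    let ?P = "\<lambda>g z. agrees ?Z (below mv \<inter> (g <# M) \<times> UNIV) z \<and> \<not> agrees ?Z (below mv \<inter> S \<times> UNIV) z"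
    have "closedin ?T {z \<in> ?C. ?P g z}" for g
    proof -
      have "{z \<in> ?C. ?P g z} = {z \<in> ?C. agrees ?Z (below mv \<inter> (g <# M) \<times> UNIV) z} \<inter>
          {z \<in> ?C. \<not> agrees ?Z (below mv \<inter> S \<times> UNIV) z}" by blast
      then show ?thesis
        using closedin_Int[OF closedin_agrees(1)[OF fin[OF finM]] closedin_agrees(2)[OF fin[OF S(1)]]]
        by (simp only:)
    qed
    moreover have "\<exists>g\<in>carrier G. \<not> ?P g z" if "z \<in> ?C" for z
    proof (rule ccontr)
      assume neg: "\<not> ?thesis"
      then have "agrees ?Z (below mv \<inter> carrier G \<times> UNIV) z"
        using glob that unfolding determines_def by blast
      then have "agrees ?Z (below mv \<inter> S \<times> UNIV) z" by (rule agrees_mono) (use S(2) in blast)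
      then show False using neg one_closed by blast
    qed
    ultimately obtain E where E: "E \<subseteq> carrier G" "finite E" "\<And>z. z \<in> ?C \<Longrightarrow> \<exists>g\<in>E. \<not> ?P g z"
      using config_finite_subfamily[OF finite_A, of "carrier G" "carrier G \<times> {1, 2}" ?P] by blast
    define B where "B = S \<union> (\<Union>g\<in>E. g <# M)"
    have "finite B" unfolding B_def using E(2) finM S(1) by blast
    then obtain b where b: "\<And>g i t. g \<in> B \<Longrightarrow> depth g i t \<Longrightarrow> t < b" using depth_bound by blast
    have "?Phi mv' E" if near: "\<forall>j<n. near b (mv j) (mv' j)" for mv'
    proof -
      have eq: "below mv' \<inter> F \<times> UNIV = below mv \<inter> F \<times> UNIV" if "F \<subseteq> B" for F
        by (rule near_below[OF near]) (use that b in blast)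
      have eqS: "below mv' \<inter> S \<times> UNIV = below mv \<inter> S \<times> UNIV" by (rule eq) (simp add: B_def)
      have eqM: "below mv' \<inter> (g <# M) \<times> UNIV = below mv \<inter> (g <# M) \<times> UNIV" if "g \<in> E" for g
        by (rule eq) (use that in \<open>auto simp: B_def\<close>)
      show ?thesis
      proof (intro ballI impI)
        fix z assume z: "z \<in> ?C" "\<forall>g\<in>E. agrees ?Z (below mv' \<inter> (g <# M) \<times> UNIV) z"
        obtain g where "g \<in> E" "\<not> ?P g z" using E(3)[OF z(1)] by blast
        then show "agrees ?Z (below mv' \<inter> S \<times> UNIV) z" using z(2) eqM eqS by simp
      qed
    qed
    then show "\<exists>E b. finite E \<and> E \<subseteq> carrier G \<and> (\<forall>mv'. (\<forall>j<n. near b (mv j) (mv' j)) \<longrightarrow> ?Phi mv' E)"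
      using E(1,2) by blast
  qed blast
  then show ?thesis unfolding determines_def by blast
qed

text \<open>Legality excludes visible violations only, so a legal pair need not extend to a point of
  the graph. By compactness its part on the given \<open>M0\<close> does, once \<open>M\<close>
  shows enough of the surroundings.\<close>

lemma legal_agrees:
  assumes M0: "finite M0" "M0 \<subseteq> carrier G"
  obtains M where "finite M" "M \<subseteq> carrier G" "M0 \<subseteq> M" "\<one> \<in> M" "\<forall>(D, p)\<in>P. D \<subseteq> M" "N \<subseteq> M"
    "\<forall>u v. legal M u v \<longrightarrow> agrees (graph G X f) (M0 \<times> {1, 2}) (\<lambda>(k, j). if j = 1 then u k else v k)"
proof -
  let ?Z = "graph G X f" and ?C = "carrier G \<times> {1, 2::nat} \<rightarrow>\<^sub>E A"
  let ?T = "config_topology A (carrier G \<times> {1, 2::nat})"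
  define B where "B = insert \<one> (N \<union> \<Union>(fst ` P))"
  have B: "finite B" "B \<subseteq> carrier G" "N \<subseteq> B" "\<one> \<in> B" "\<And>D p. (D, p) \<in> P \<Longrightarrow> D \<subseteq> B"
    using N finite_P P_dom by (force simp: B_def)+
  let ?v = "\<lambda>g z. valid_at (\<lambda>k. z (k, 1)) (\<lambda>k. z (k, 2)) g"
  let ?P = "\<lambda>g z. ?v g z \<and> \<not> agrees ?Z (M0 \<times> {1, 2}) z"
  have valid_cong: "valid_at x' y' g"
    if "valid_at x y g" "\<And>k. k \<in> B \<Longrightarrow> x (g \<otimes> k) = x' (g \<otimes> k)" "y g = y' g" for x y x' y' g
  proof -
    have "restrict (\<lambda>k. x (g \<otimes> k)) N = restrict (\<lambda>k. x' (g \<otimes> k)) N"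
      using that(2) B(3) by (auto simp: restrict_def fun_eq_iff)
    moreover have h: "(\<forall>d\<in>D. x (g \<otimes> d) = p d) \<longleftrightarrow> (\<forall>d\<in>D. x' (g \<otimes> d) = p d)" if "(D, p) \<in> P" for D p
      using B(5)[OF that] \<open>\<And>k. k \<in> B \<Longrightarrow> x (g \<otimes> k) = x' (g \<otimes> k)\<close> by (metis subsetD)
    moreover have "\<forall>(D, p)\<in>P. \<not> (\<forall>d\<in>D. x' (g \<otimes> d) = p d)"
      using that(1) h unfolding valid_at_def by blast
    ultimately show ?thesis using that(1,3) unfolding valid_at_def by simp
  qed
  have "closedin ?T {z \<in> ?C. ?P g z}" if g: "g \<in> carrier G" for g
  proof -
    have "closedin ?T {z \<in> ?C. ?v g z}"
    proof (rule closedin_finitely_determined[of "(\<lambda>k. g \<otimes> k) ` B \<times> {1, 2}"])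
      show "(\<lambda>k. g \<otimes> k) ` B \<times> {1, 2} \<subseteq> carrier G \<times> {1, 2}" using B(2) g by auto
      show "?v g z'" if "?v g z" "\<And>i. i \<in> (\<lambda>k. g \<otimes> k) ` B \<times> {1, 2} \<Longrightarrow> z i = z' i" for z z'
      proof (rule valid_cong[OF that(1)])
        show "z (g \<otimes> k, 1) = z' (g \<otimes> k, 1)" if "k \<in> B" for k
          using that \<open>\<And>i. i \<in> (\<lambda>k. g \<otimes> k) ` B \<times> {1, 2} \<Longrightarrow> z i = z' i\<close> by blast
        have "g \<in> (\<lambda>k. g \<otimes> k) ` B" using B(4) g by (intro image_eqI[of _ _ \<one>]) auto
        then show "z (g, 2) = z' (g, 2)" using that(2) by blast
      qed
    qed (use B(1) in simp)
    moreover have "closedin ?T {z \<in> ?C. \<not> agrees ?Z (M0 \<times> {1, 2}) z}"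
      using M0 by (intro closedin_agrees) auto
    moreover have "{z \<in> ?C. ?P g z} = {z \<in> ?C. ?v g z} \<inter> {z \<in> ?C. \<not> agrees ?Z (M0 \<times> {1, 2}) z}" by blast
    ultimately show ?thesis by (simp only: closedin_Int)
  qed
  moreover have "\<exists>g\<in>carrier G. \<not> ?P g z" if z: "z \<in> ?C" for z
  proof (rule ccontr)
    assume neg: "\<not> ?thesis"
    let ?x = "restrict (\<lambda>k. z (k, 1)) (carrier G)" and ?y = "restrict (\<lambda>k. z (k, 2)) (carrier G)"
    have "valid_at ?x ?y g" if g: "g \<in> carrier G" for g
    proof (rule valid_cong)
      show "?v g z" using neg g by blast
    qed (use g B(2) in auto)
    moreover have "?x \<in> carrier G \<rightarrow>\<^sub>E A" "?y \<in> carrier G \<rightarrow>\<^sub>E A" using z by auto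
    ultimately have "related ?x ?y" using related_iff by blast
    then have "config_pair (carrier G) ?x ?y \<in> ?Z" unfolding graph_iff by blast
    moreover have "config_pair (carrier G) ?x ?y j = z j" if "j \<in> M0 \<times> {1, 2}" for j
      using that M0(2) by auto
    ultimately have "agrees ?Z (M0 \<times> {1, 2}) z" unfolding agrees_def by blast
    then show False using neg one_closed by blast
  qed
  ultimately obtain F where F: "F \<subseteq> carrier G" "finite F" "\<And>z. z \<in> ?C \<Longrightarrow> \<exists>g\<in>F. \<not> ?P g z"
    using config_finite_subfamily[OF finite_A, of "carrier G" "carrier G \<times> {1, 2}" ?P] by blast
  \<comment> \<open>All that validity at the finitely many \<open>g\<close> in \<open>F\<close>
    refers to must be visible in \<open>M\<close>.\<close>
  define M where "M = B \<union> M0 \<union> F \<union> (\<Union>g\<in>F. (\<lambda>k. g \<otimes> k) ` B)"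
  have M: "finite M" "M \<subseteq> carrier G" using B(1,2) M0 F(1,2) by (auto simp: M_def)
  have L: "agrees ?Z (M0 \<times> {1, 2}) (\<lambda>(k, j). if j = 1 then u k else v k)" if l: "legal M u v" for u v
  proof -
    have 1: "\<one> \<in> M" using B(4) by (simp add: M_def)
    \<comment> \<open>Outside \<open>M\<close> any symbols will do; those at the identity are at
      hand.\<close>
    define z where "z = config_pair (carrier G) (\<lambda>k. if k \<in> M then u k else u \<one>) (\<lambda>k. if k \<in> M then v k else v \<one>)"
    have "z \<in> ?C" unfolding z_def using l 1 by (intro config_pair_PiE) (auto simp: legal_def)
    then obtain g where g: "g \<in> F" "\<not> ?P g z" using F(3) by blast
    have gM: "g \<in> M" "\<And>k. k \<in> B \<Longrightarrow> g \<otimes> k \<in> M" using g(1) by (auto simp: M_def)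
    have zM: "z (k, 1) = u k" "z (k, 2) = v k" if "k \<in> M" for k
      using that M(2) by (auto simp: z_def)
    have "valid_at u v g"
      unfolding valid_at_def
    proof (intro conjI ballI)
      note lg = l[unfolded legal_def, rule_format, OF gM(1)]
      show "v g = \<phi> (restrict (\<lambda>k. u (g \<otimes> k)) N)" using lg gM(2) B(3) by blast
      show "case Dp of (D, p) \<Rightarrow> \<not> (\<forall>d\<in>D. u (g \<otimes> d) = p d)" if Dp: "Dp \<in> P" for Dp
      proof (cases Dp)
        case (Pair D p)
        then have "D \<subseteq> B" using B(5) Dp by blast
        then show ?thesis using lg Dp Pair gM(2) by fastforce
      qed
    qed
    then have "?v g z" by (rule valid_cong) (use zM gM in auto)
    then have "agrees ?Z (M0 \<times> {1, 2}) z" using g(2) by blast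
    then show ?thesis
    proof (rule agrees_cong)
      fix j assume j: "j \<in> M0 \<times> {1, 2::nat}"
      then have "fst j \<in> M" by (auto simp: M_def)
      then show "z j = (case j of (k, j) \<Rightarrow> if j = 1 then u k else v k)"
        using zM j by auto
    qed
  qed
  have BM: "B \<subseteq> M" and M0M: "M0 \<subseteq> M" by (auto simp: M_def)
  have sub: "\<one> \<in> M" "\<forall>(D, p)\<in>P. D \<subseteq> M" "N \<subseteq> M" using BM B by blast+
  show thesis by (rule that[OF M M0M sub]) (intro allI impI L)
qed

lemma certificate_complete: "\<exists>M E. certificate M E"
proof -
  let ?Z = "graph G X f" and ?C = "carrier G \<times> {1, 2::nat} \<rightarrow>\<^sub>E A"
  obtain M0 where M0: "finite M0" "M0 \<subseteq> carrier G" and glob: "determines M0 (carrier G) (carrier G)"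
    using graph_local_to_global by blast
  obtain M where M: "finite M" "M \<subseteq> carrier G" "M0 \<subseteq> M" "\<one> \<in> M" "\<forall>(D, p)\<in>P. D \<subseteq> M" "N \<subseteq> M"
    and leg: "\<forall>u v. legal M u v \<longrightarrow> agrees ?Z (M0 \<times> {1, 2}) (\<lambda>(k, j). if j = 1 then u k else v k)"
    by (rule legal_agrees[OF M0]) (rule that)
  \<comment> \<open>The union of all windows \<open>gM\<close> that contain the identity.\<close>
  define S where "S = (\<lambda>(m, m'). inv m \<otimes> m') ` (M \<times> M)"
  have S: "finite S" "S \<subseteq> carrier G" using M(1,2) by (auto simp: S_def)
  obtain E0 where E0: "finite E0" "E0 \<subseteq> carrier G" "determines M0 E0 S"
    using graph_local_to_finite[OF S M0 glob] by blast
  \<comment> \<open>Besides what a certificate demands, \<open>E\<close> has to show the windows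
    \<open>gM0\<close> from which validity on \<open>S\<close> is inferred.\<close>
  define E where "E = E0 \<union> S \<union> m_inv G ` M \<union> (\<lambda>(g, m). g \<otimes> m) ` (E0 \<times> M0)"
  have E: "finite E" "E \<subseteq> carrier G" using E0(1,2) S M(1,2) M0 by (auto simp: E_def)
  have "extendable M E"
    unfolding extendable_def
  proof (intro allI impI)
    fix mv x y assume x: "x \<in> E \<rightarrow> A" and y: "y \<in> E \<rightarrow> A" and gd: "\<forall>g\<in>E. good M E (E \<inter> lower mv) x y g"
    have 1: "\<one> \<in> S" using M(2,4) unfolding S_def by (intro image_eqI[of _ _ "(\<one>, \<one>)"]) auto
    then have 1: "\<one> \<in> E" by (simp add: E_def)
    define z where "z = config_pair (carrier G) (\<lambda>k. if k \<in> E then x k else x \<one>) (\<lambda>k. if k \<in> E then y k else y \<one>)"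
    have zC: "z \<in> ?C" unfolding z_def using x y 1 by (intro config_pair_PiE) auto
    have zE: "z (k, 1) = x k" "z (k, 2) = y k" if "k \<in> E" for k
      using that E(2) by (auto simp: z_def)
    \<comment> \<open>The legal pair that witnesses goodness coincides with \<open>y\<close>, and
      with \<open>x\<close> where it is chosen; by the choice of \<open>M\<close> its part on
      \<open>M0\<close> comes from a point of the graph.\<close>
    have "agrees ?Z (below mv \<inter> (g <# M0) \<times> UNIV) z" if g: "g \<in> E0" for g
    proof -
      have gc: "g \<in> carrier G" using g E0 by blast
      have "g \<in> E" using g by (simp add: E_def)
      then have "good M E (E \<inter> lower mv) x y g" using gd by blast
      then obtain u v where uv: "legal M u v" "\<forall>m\<in>M. (g \<otimes> m \<in> E \<longrightarrow> v m = y (g \<otimes> m)) \<and>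
          (g \<otimes> m \<in> E \<inter> lower mv \<longrightarrow> u m = x (g \<otimes> m))"
        unfolding good_def by blast
      have gm: "g \<otimes> m \<in> E" if "m \<in> M0" for m using g that by (force simp: E_def)
      define S' where "S' = M0 \<times> {1, 2} \<inter> {(m, j). (g \<otimes> m, j) \<in> below mv}"
      have ag: "agrees ?Z S' (\<lambda>(k, j). if j = 1 then u k else v k)"
        using leg[rule_format, OF uv(1)] by (rule agrees_mono) (auto simp: S'_def)
      show ?thesis
      proof (rule agrees_translate[OF graph_invariant gc _ ag])
        show "S' \<subseteq> carrier G \<times> {1, 2}" using M0(2) by (auto simp: S'_def)
        fix m j assume mj: "(m, j) \<in> S'"
        then have m: "m \<in> M0" "m \<in> M" "j = 1 \<or> j = 2" using M(3) by (auto simp: S'_def)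
        show "z (g \<otimes> m, j) = (case (m, j) of (k, j) \<Rightarrow> if j = 1 then u k else v k)"
        proof (cases "j = 1")
          case True
          then have "g \<otimes> m \<in> lower mv" using mj by (auto simp: S'_def below_def)
          then show ?thesis using True zE(1) gm[OF m(1)] uv(2) m(2) by simp
        next
          case False
          then show ?thesis using m zE(2) gm[OF m(1)] uv(2) by simp
        qed
      next
        show "below mv \<inter> (g <# M0) \<times> UNIV \<subseteq> (\<lambda>(k, j). (g \<otimes> k, j)) ` S'"
        proof
          fix p assume p: "p \<in> below mv \<inter> (g <# M0) \<times> UNIV"
          then obtain m where m: "m \<in> M0" "fst p = g \<otimes> m" by (auto simp: l_coset_def)
          have "snd p \<in> {1, 2}" using p by (auto simp: below_def)
          then have "(m, snd p) \<in> S'" using p m by (cases p) (auto simp: S'_def)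
          then show "p \<in> (\<lambda>(k, j). (g \<otimes> k, j)) ` S'"
            by (rule rev_image_eqI) (simp add: m(2)[symmetric])
        qed
      qed
    qed
    then have "agrees ?Z (below mv \<inter> S \<times> UNIV) z" using E0(3) zC unfolding determines_def by blast
    \<comment> \<open>The symbol wanted at the identity is read off from this point of the graph,
      whose windows are all legal.\<close>
    then obtain z' where z': "z' \<in> ?Z" "\<forall>j\<in>below mv \<inter> S \<times> UNIV. z' j = z j" unfolding agrees_def by blast
    then obtain x0 y0 where R: "related x0 y0" "z' = config_pair (carrier G) x0 y0" unfolding graph_iff by blast
    have eq: "config_pair (carrier G) x0 y0 j = z j" if "j \<in> below mv \<inter> S \<times> UNIV" for j
      using z'(2) that R(2) by blast
    have SE: "S \<subseteq> E" by (auto simp: E_def)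
    have y0: "y0 k = y k" if "k \<in> S" for k
      using eq[of "(k, 2)"] that S(2) SE zE(2) by (auto simp: below_def subset_iff)
    have x0: "x0 k = x k" if "k \<in> S" "k \<in> lower mv" for k
      using eq[of "(k, 1)"] that S(2) SE zE(1) by (auto simp: below_def subset_iff)
    have "good M E (insert \<one> (E \<inter> lower mv)) (x(\<one> := x0 \<one>)) y g" if g: "g \<in> E" for g
    proof (cases "\<exists>m\<in>M. g \<otimes> m = \<one>")
      case True
      then obtain m where m: "m \<in> M" "g \<otimes> m = \<one>" by blast
      have gc: "g \<in> carrier G" using g E(2) by blast
      then have gi: "g = inv m" using m M(2) by (metis inv_equality subsetD)
      have gS: "g \<otimes> m' \<in> S" if "m' \<in> M" for m'
        unfolding gi S_def using m(1) that by force
      have "legal M (\<lambda>m. x0 (g \<otimes> m)) (\<lambda>m. y0 (g \<otimes> m))" by (rule legal_related[OF R(1) M(2) gc])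
      moreover have "\<forall>m\<in>M. (g \<otimes> m \<in> E \<longrightarrow> y0 (g \<otimes> m) = y (g \<otimes> m)) \<and>
          (g \<otimes> m \<in> insert \<one> (E \<inter> lower mv) \<longrightarrow> x0 (g \<otimes> m) = (x(\<one> := x0 \<one>)) (g \<otimes> m))"
        using gS x0 y0 one_not_lower[of mv] by auto
      ultimately show ?thesis unfolding good_def by blast
    next
      case False
      have "good M E (E \<inter> lower mv) x y g" using gd g by blast
      then show ?thesis by (rule good_cong) (use False in auto)
    qed
    moreover have "x0 \<one> \<in> A" using related_PiE(1)[OF R(1)] by auto
    ultimately show "\<exists>a\<in>A. \<forall>g\<in>E. good M E (insert \<one> (E \<inter> lower mv)) (x(\<one> := a)) y g" by blast
  qed
  moreover have "inv m \<in> E" "inv m \<otimes> m' \<in> E" if "m \<in> M" "m' \<in> M" for m m'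
    using that by (force simp: E_def S_def)+
  ultimately have "certificate M E" unfolding certificate_def using M E by blast
  then show ?thesis by blast
qed

end

context avo_data
begin

section \<open>The forbidden patterns of the factor\<close>

definition dead_patterns :: "'g set \<Rightarrow> ('g set \<times> ('g \<Rightarrow> 's)) set" where
  "dead_patterns M = {(M, v) | v. v \<in> M \<rightarrow>\<^sub>E A \<and> \<not> (\<exists>u. legal M u v)}"

lemma dead_patterns:
  assumes "certificate M E"
  shows "finite (dead_patterns M)" "dead_patterns M \<subseteq> patterns G A"
    "Y = subshift_forbidding G A (dead_patterns M)"
proof -
  have M: "finite M" "M \<subseteq> carrier G" using assms by (auto simp: certificate_def)
  have "dead_patterns M \<subseteq> {M} \<times> (M \<rightarrow>\<^sub>E A)" by (auto simp: dead_patterns_def)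
  moreover have "finite ({M} \<times> (M \<rightarrow>\<^sub>E A))" using M(1) finite_A by (simp add: finite_PiE)
  ultimately show "finite (dead_patterns M)" by (rule finite_subset)
  show "dead_patterns M \<subseteq> patterns G A" using M by (auto simp: dead_patterns_def patterns_def)
  show "Y = subshift_forbidding G A (dead_patterns M)"
  proof
    show "Y \<subseteq> subshift_forbidding G A (dead_patterns M)"
    proof
      fix y assume y: "y \<in> Y"
      then obtain x where R: "related x y" using f_image by (auto simp: related_def)
      have "\<not> (\<forall>m\<in>M. y (g \<otimes> m) = v m)" if "\<not> (\<exists>u. legal M u v)" and g: "g \<in> carrier G" for v g
        using legal_finitely_determined[OF legal_related[OF R M(2) g], of "\<lambda>m. x (g \<otimes> m)" v] that(1) by blast
      then show "y \<in> subshift_forbidding G A (dead_patterns M)"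
        using y Y_subset unfolding subshift_forbidding_def dead_patterns_def by blast
    qed
    show "subshift_forbidding G A (dead_patterns M) \<subseteq> Y"
    proof
      fix y assume y: "y \<in> subshift_forbidding G A (dead_patterns M)"
      then have yC: "y \<in> carrier G \<rightarrow>\<^sub>E A" by (simp add: subshift_forbidding_def)
      show "y \<in> Y"
      proof (rule certificate_sound[OF assms yC])
        fix g assume g: "g \<in> carrier G"
        let ?v = "restrict (\<lambda>m. y (g \<otimes> m)) M"
        have "?v \<in> M \<rightarrow>\<^sub>E A" using yC g M(2) by auto
        moreover have "(M, ?v) \<notin> dead_patterns M"
          using y g unfolding subshift_forbidding_def by fastforce
        ultimately have "\<exists>u. legal M u ?v" by (auto simp: dead_patterns_def)
        then show "\<exists>u v. legal M u v \<and> (\<forall>m\<in>M. v m = y (g \<otimes> m))" by force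
      qed
    qed
  qed
qed

end

section \<open>Codes\<close>

text \<open>Indices into the list turn statements about coded sets into bounded quantifiers, which
  are decidable.\<close>

lemma codes_set_iff: "codes_set R m S \<longleftrightarrow>
  (\<forall>l<length_code m. \<exists>s\<in>S. R (nth_code m l) s) \<and> (\<forall>s\<in>S. \<exists>l<length_code m. R (nth_code m l) s)"
proof -
  have "codes_set R m S \<longleftrightarrow> rel_set R (set (list_decode m)) S"
    unfolding codes_set_def by (metis list_decode_inverse list_encode_inverse)
  then show ?thesis unfolding rel_set_def set_list_decode by auto
qed

lemma codes_pair_iff: "codes_pair R S m p \<longleftrightarrow> R (pr1 m) (fst p) \<and> S (pr2 m) (snd p)"
  unfolding codes_pair_def by (metis fst_conv prod.collapse prod_decode_inverse prod_encode_inverse snd_conv)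

lemma exp_prod_cong: "(\<And>i. i \<in> {1..k} \<Longrightarrow> t i = t' i) \<Longrightarrow> exp_prod G h t k = exp_prod G h t' k"
  by (induction k) auto

lemma codes_elt_iff: "codes_elt G n h m g \<longleftrightarrow>
  length_code m = n \<and> g = exp_prod G h (\<lambda>i. int_decode (nth_code m (i - 1))) n"
proof
  assume "codes_elt G n h m g"
  then obtain ts where ts: "length ts = n" "m = list_encode (map int_encode ts)"
    "g = exp_prod G h (\<lambda>i. ts ! (i - 1)) n" by (auto simp: codes_elt_def)
  then show "length_code m = n \<and> g = exp_prod G h (\<lambda>i. int_decode (nth_code m (i - 1))) n"
    by (auto simp: length_code_list_encode nth_code_list_encode intro!: exp_prod_cong)
next
  assume "length_code m = n \<and> g = exp_prod G h (\<lambda>i. int_decode (nth_code m (i - 1))) n"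
  then show "codes_elt G n h m g" unfolding codes_elt_def
    by (intro exI[of _ "map int_decode (list_decode m)"])
      (auto simp: length_code_eq nth_code_eq comp_def intro!: exp_prod_cong)
qed

section \<open>The algorithm\<close>

context effective
begin

text \<open>Throughout, \<open>q\<close> is the size of the alphabet, \<open>ml\<close> and \<open>el\<close> are lists of codes of the elements
  \<^term>\<open>pos ml j\<close> of \<open>M\<close> and \<^term>\<open>d (nth_code el k)\<close> of \<open>E\<close>, and patterns on \<open>M\<close> or \<open>E\<close> are
  numbers whose digits to base \<open>q\<close> are the symbols.\<close>

definition pos :: "nat \<Rightarrow> nat \<Rightarrow> 'a" where
  "pos ml j = d (conv (nth_code ml j))"

text \<open>An entry that falls outside \<open>M\<close> makes the test fail. Hence the same test
  serves for forbidden patterns and for the arguments of the local rule, both of which count only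
  when fully visible.\<close>

definition occurs :: "nat \<Rightarrow> nat \<Rightarrow> nat \<Rightarrow> nat \<Rightarrow> nat \<Rightarrow> bool" where
  "occurs q ml i u c \<longleftrightarrow> (\<forall>l<length_code c. \<exists>j<length_code ml.
     d (mul (prod_encode (conv (nth_code ml i), conv (pr1 (nth_code c l))))) = d (conv (nth_code ml j)) \<and>
     digit q u j = pr2 (nth_code c l))"

text \<open>The local rule is consulted through its table: a row applies if its argument pattern
  occurs.\<close>

definition legal_code :: "nat \<Rightarrow> nat \<Rightarrow> nat \<Rightarrow> nat \<Rightarrow> bool" where
  "legal_code m ml u v \<longleftrightarrow> (\<forall>i<length_code ml.
     (\<forall>l<length_code (pr1 (pr2 m)). \<not> occurs (pr1 m) ml i u (nth_code (pr1 (pr2 m)) l)) \<and>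
     (\<forall>l<length_code (pr2 (pr2 m)). occurs (pr1 m) ml i u (pr1 (nth_code (pr2 (pr2 m)) l)) \<longrightarrow>
        digit (pr1 m) v i = pr2 (nth_code (pr2 (pr2 m)) l)))"

text \<open>\<open>V\<close> codes the tuple by its digits to base \<open>Suc b\<close>. The bound
  \<open>b\<close> is chosen above all depths in \<open>E\<close>, so larger entries need not be
  distinguished.\<close>

definition in_lower :: "nat \<Rightarrow> nat \<Rightarrow> nat \<Rightarrow> bool" where
  "in_lower b V c \<longleftrightarrow> 0 < pr1 (ld c) \<and> 0 < pr2 (ld c) \<and> pr2 (ld c) < digit (Suc b) V (pr1 (ld c) - 1)"

text \<open>The argument \<open>s\<close> is \<open>0\<close> or the successor of the symbol that is put at the identity.\<close>

definition good_code :: "nat \<Rightarrow> nat \<Rightarrow> nat \<Rightarrow> nat \<Rightarrow> nat \<Rightarrow> nat \<Rightarrow> nat \<Rightarrow> nat \<Rightarrow> nat \<Rightarrow> bool" where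
  "good_code m ml el b V x y i s \<longleftrightarrow> (\<exists>u<pr1 m ^ length_code ml. \<exists>v<pr1 m ^ length_code ml.
     legal_code m ml u v \<and> (\<forall>j<length_code ml.
       (\<forall>k<length_code el. d (mul (prod_encode (nth_code el i, conv (nth_code ml j)))) = d (nth_code el k) \<longrightarrow>
          digit (pr1 m) v j = digit (pr1 m) y k \<and>
          (in_lower b V (nth_code el k) \<longrightarrow> digit (pr1 m) u j = digit (pr1 m) x k)) \<and>
       (0 < s \<and> d (mul (prod_encode (nth_code el i, conv (nth_code ml j)))) = d e1 \<longrightarrow>
          Suc (digit (pr1 m) u j) = s)))"

definition extendable_code :: "nat \<Rightarrow> nat \<Rightarrow> nat \<Rightarrow> nat \<Rightarrow> bool" where
  "extendable_code m ml el b \<longleftrightarrow>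
     (\<forall>V<Suc b ^ n. \<forall>x<pr1 m ^ length_code el. \<forall>y<pr1 m ^ length_code el.
        (\<forall>i<length_code el. good_code m ml el b V x y i 0) \<longrightarrow>
        (\<exists>a<pr1 m. \<forall>i<length_code el. good_code m ml el b V x y i (Suc a)))"

definition covered :: "nat \<Rightarrow> nat \<Rightarrow> bool" where
  "covered ml c \<longleftrightarrow> (\<forall>e<length_code c. \<exists>j<length_code ml.
     d (conv (pr1 (nth_code c e))) = d (conv (nth_code ml j)))"

text \<open>The positions in \<open>ml\<close> have to be distinct for digit sequences to be the
  same as patterns on \<open>M\<close>; repetitions in \<open>el\<close> could only make the
  extension test harder to pass.\<close>

definition support_code :: "nat \<Rightarrow> nat \<Rightarrow> nat \<Rightarrow> nat \<Rightarrow> bool" where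
  "support_code m ml el b \<longleftrightarrow>
     0 < length_code ml \<and> d (conv (nth_code ml 0)) = d e1 \<and>
     (\<forall>j<length_code ml. length_code (nth_code ml j) = n) \<and>
     (\<forall>i<length_code ml. \<forall>j<length_code ml. d (conv (nth_code ml i)) = d (conv (nth_code ml j)) \<longrightarrow> i = j) \<and>
     (\<forall>l<length_code (pr1 (pr2 m)). covered ml (nth_code (pr1 (pr2 m)) l)) \<and>
     (\<forall>l<length_code (pr2 (pr2 m)). covered ml (pr1 (nth_code (pr2 (pr2 m)) l))) \<and>
     (\<forall>i<length_code ml. \<exists>k<length_code el.
        d (mul (prod_encode (nth_code el k, conv (nth_code ml i)))) = d e1 \<and>
        (\<forall>j<length_code ml. \<exists>k'<length_code el.
           d (mul (prod_encode (nth_code el k, conv (nth_code ml j)))) = d (nth_code el k'))) \<and>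
     (\<forall>k<length_code el. pr2 (ld (nth_code el k)) < b)"

definition dead_code :: "nat \<Rightarrow> nat \<Rightarrow> nat \<Rightarrow> bool" where
  "dead_code m ml v \<longleftrightarrow> \<not> (\<exists>u<pr1 m ^ length_code ml. legal_code m ml u v)"

text \<open>The exponent lists are copied from \<open>ml\<close>, so group elements never have to be
  translated back from the numbering \<open>d\<close>.\<close>

definition pattern_code :: "nat \<Rightarrow> nat \<Rightarrow> nat \<Rightarrow> nat \<Rightarrow> bool" where
  "pattern_code q ml c v \<longleftrightarrow> length_code c = length_code ml \<and>
     (\<forall>j<length_code ml. nth_code c j = prod_encode (nth_code ml j, digit q v j))"

definition output_code :: "nat \<Rightarrow> nat \<Rightarrow> nat \<Rightarrow> bool" where
  "output_code m ml out \<longleftrightarrow>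
     (\<forall>l<length_code out. \<exists>v<pr1 m ^ length_code ml. dead_code m ml v \<and> pattern_code (pr1 m) ml (nth_code out l) v) \<and>
     (\<forall>v<pr1 m ^ length_code ml. dead_code m ml v \<longrightarrow> (\<exists>l<length_code out. pattern_code (pr1 m) ml (nth_code out l) v))"

text \<open>The output is guessed together with the certificate and merely verified; no list has to
  be assembled by a recursive function.\<close>

definition check :: "nat \<Rightarrow> nat \<Rightarrow> bool" where
  "check m k \<longleftrightarrow>
     support_code m (pr1 (pr2 k)) (pr1 (pr2 (pr2 k))) (pr2 (pr2 (pr2 k))) \<and>
     extendable_code m (pr1 (pr2 k)) (pr1 (pr2 (pr2 k))) (pr2 (pr2 (pr2 k))) \<and>
     output_code m (pr1 (pr2 k)) (pr1 k)"

lemmas effective_intros = rec_intros dec_pred_comp2[OF d_eq]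
  total_rec_comp[OF mul(1)] total_rec_comp[OF conv(1)] total_rec_comp[OF ld(1)]

section \<open>Decidability of the test\<close>

lemma dec_occurs:
  assumes "total_rec q" "total_rec ml" "total_rec i" "total_rec u" "total_rec c"
  shows "dec_pred (\<lambda>p. occurs (q p) (ml p) (i p) (u p) (c p))"
  unfolding occurs_def by (intro effective_intros assms[THEN total_rec_comp])

lemma dec_legal_code:
  assumes "total_rec m" "total_rec ml" "total_rec u" "total_rec v"
  shows "dec_pred (\<lambda>p. legal_code (m p) (ml p) (u p) (v p))"
  unfolding legal_code_def by (intro effective_intros dec_occurs assms[THEN total_rec_comp])

lemma dec_in_lower:
  assumes "total_rec b" "total_rec V" "total_rec c"
  shows "dec_pred (\<lambda>p. in_lower (b p) (V p) (c p))"
  unfolding in_lower_def by (intro effective_intros assms[THEN total_rec_comp] assms)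

lemma dec_good_code:
  assumes "total_rec m" "total_rec ml" "total_rec el" "total_rec b" "total_rec V" "total_rec x"
    "total_rec y" "total_rec i" "total_rec s"
  shows "dec_pred (\<lambda>p. good_code (m p) (ml p) (el p) (b p) (V p) (x p) (y p) (i p) (s p))"
  unfolding good_code_def
  by (intro effective_intros dec_legal_code dec_in_lower assms[THEN total_rec_comp] assms)

lemma dec_check: "dec_pred (\<lambda>p. check (pr1 p) (pr2 p))"
proof -
  have ext: "dec_pred (\<lambda>p. extendable_code (m p) (ml p) (el p) (b p))"
    if "total_rec m" "total_rec ml" "total_rec el" "total_rec b" for m ml el b
    unfolding extendable_code_def
    by (intro effective_intros dec_good_code that[THEN total_rec_comp] that)
  have cov: "dec_pred (\<lambda>p. covered (ml p) (c p))" if "total_rec ml" "total_rec c" for ml c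
    unfolding covered_def by (intro effective_intros that[THEN total_rec_comp] that)
  have supp: "dec_pred (\<lambda>p. support_code (m p) (ml p) (el p) (b p))"
    if "total_rec m" "total_rec ml" "total_rec el" "total_rec b" for m ml el b
    unfolding support_code_def by (intro effective_intros cov that[THEN total_rec_comp] that)
  have dead: "dec_pred (\<lambda>p. dead_code (m p) (ml p) (v p))"
    if "total_rec m" "total_rec ml" "total_rec v" for m ml v
    unfolding dead_code_def by (intro effective_intros dec_legal_code that[THEN total_rec_comp] that)
  have pat: "dec_pred (\<lambda>p. pattern_code (q p) (ml p) (c p) (v p))"
    if "total_rec q" "total_rec ml" "total_rec c" "total_rec v" for q ml c v
    unfolding pattern_code_def by (intro effective_intros that[THEN total_rec_comp] that)
  have out: "dec_pred (\<lambda>p. output_code (m p) (ml p) (c p))"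
    if "total_rec m" "total_rec ml" "total_rec c" for m ml c
    unfolding output_code_def by (intro effective_intros dead pat that[THEN total_rec_comp] that)
  show ?thesis unfolding check_def by (intro effective_intros ext supp out)
qed

lemma codes_elt_conv: "codes_elt G n h m g \<longleftrightarrow> length_code m = n \<and> g = d (conv m)"
  unfolding codes_elt_iff conv(2) by simp

lemma in_lower_iff:
  assumes "\<And>i. i < n \<Longrightarrow> mv i = enat (digit (Suc b) V i)"
  shows "in_lower b V c \<longleftrightarrow> d c \<in> lower mv"
proof
  assume l: "in_lower b V c"
  define i where "i = pr1 (ld c) - 1"
  have "ld c = prod_encode (Suc i, pr2 (ld c))" using l by (simp add: in_lower_def i_def)
  then have "depth (d c) i (pr2 (ld c))" using l ld(2) by (simp add: in_lower_def)
  moreover from this have "i < n" by (simp add: depth_def)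
  ultimately show "d c \<in> lower mv"
    using l assms[of i] unfolding lower_def in_lower_def i_def[symmetric]
    by (intro CollectI exI[of _ i] exI[of _ "pr2 (ld c)"]) simp
next
  assume "d c \<in> lower mv"
  then obtain i t where it: "depth (d c) i t" "enat t < mv i" by (auto simp: lower_def)
  then have "ld c = prod_encode (Suc i, t)" "1 \<le> t" "i < n" using ld(2) by (auto simp: depth_def)
  then show "in_lower b V c" using it(2) assms[of i] by (simp add: in_lower_def)
qed

text \<open>Truncating entries at \<open>b\<close> does not affect elements of depth below
  \<open>b\<close>; this reduces all finite tuples to the finitely many
  \<open>V < Suc b ^ n\<close>.\<close>

lemma in_lower_min:
  assumes "\<And>i. i < n \<Longrightarrow> mv i \<noteq> \<infinity>" "\<And>i. i < n \<Longrightarrow> digit (Suc b) V i = min (the_enat (mv i)) b"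
    and "pr2 (ld c) < b"
  shows "in_lower b V c \<longleftrightarrow> d c \<in> lower mv"
proof -
  define mv' where "mv' i = enat (digit (Suc b) V i)" for i
  have "in_lower b V c \<longleftrightarrow> d c \<in> lower mv'" by (rule in_lower_iff) (simp add: mv'_def)
  also have "\<dots> \<longleftrightarrow> d c \<in> lower mv"
  proof -
    have "depth (d c) i t \<and> enat t < mv' i \<longleftrightarrow> depth (d c) i t \<and> enat t < mv i" for i t
    proof (cases "depth (d c) i t")
      case True
      then have "t < b" "i < n" using assms(3) ld(2) by (auto simp: depth_def)
      then show ?thesis using assms(1,2)[of i] by (cases "mv i") (auto simp: mv'_def)
    qed simp
    then show ?thesis by (simp add: lower_def)
  qed
  finally show ?thesis .
qed

end

locale effective_avo = effective G n H h d mul ld conv e1 + avo_data G n H h A X Y f P N \<phi>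
  for G :: "('g, 'b) monoid_scheme" (structure) and n H h d mul ld conv e1
    and A :: "'s set" and X Y f P N \<phi> +
  fixes \<sigma> :: "'s \<Rightarrow> nat" and m :: nat
  assumes \<sigma>: "bij_betw \<sigma> A {..<card A}"
    and input: "codes_input G n h A \<sigma> m (card A, P, N, \<phi>)"
begin

abbreviation q :: nat where "q \<equiv> card A"

lemma pr1_m [simp]: "pr1 m = q"
  and codes_P: "codes_patterns G n h \<sigma> (pr1 (pr2 m)) P"
  and codes_N: "codes_rule G n h A \<sigma> (pr2 (pr2 m)) (N, \<phi>)"
  using input unfolding codes_input_def codes_pair_iff by simp_all

lemma \<sigma>_less: "a \<in> A \<Longrightarrow> \<sigma> a < q"
  using \<sigma> by (auto simp: bij_betw_def)

lemma \<sigma>_eq: "a \<in> A \<Longrightarrow> a' \<in> A \<Longrightarrow> \<sigma> a = \<sigma> a' \<longleftrightarrow> a = a'"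
  using \<sigma> by (auto simp: bij_betw_def inj_on_def)

lemma \<sigma>_surj: "s < q \<Longrightarrow> \<exists>a\<in>A. \<sigma> a = s"
  using \<sigma> unfolding bij_betw_def by (metis imageE lessThan_iff)

section \<open>Comparison of digit sequences with patterns\<close>

definition represents :: "nat \<Rightarrow> (nat \<Rightarrow> 'g) \<Rightarrow> nat \<Rightarrow> ('g \<Rightarrow> 's) \<Rightarrow> bool" where
  "represents r g U u \<longleftrightarrow> (\<forall>j<r. u (g j) \<in> A \<and> digit q U j = \<sigma> (u (g j)))"

lemma represents_digits: "(\<And>j. j < r \<Longrightarrow> u (g j) \<in> A) \<Longrightarrow> \<exists>U<q ^ r. represents r g U u"
  using ex_digits[of r "\<lambda>j. \<sigma> (u (g j))" q] \<sigma>_less unfolding represents_def by auto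

lemma represents_fun:
  assumes "inj_on g {..<r}" "U < q ^ r"
  shows "\<exists>u\<in>g ` {..<r} \<rightarrow>\<^sub>E A. represents r g U u"
\<comment> \<open>For \<open>0 < r\<close> a number below \<open>q ^ r\<close> exists only over a
  nonempty alphabet; for \<open>r = 0\<close> the alphabet may be empty.\<close>
proof (cases "r = 0")
  case True
  then show ?thesis by (simp add: represents_def)
next
  case False
  then have "0 < q" using assms(2) by (metis gr0I power_0_left less_nat_zero_code)
  then have "\<forall>j. \<exists>a\<in>A. \<sigma> a = digit q U j" using \<sigma>_surj digit_less by blast
  then obtain a where a: "\<And>j. a j \<in> A" "\<And>j. \<sigma> (a j) = digit q U j" by metis
  let ?u = "restrict (\<lambda>x. a (the_inv_into {..<r} g x)) (g ` {..<r})"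
  have "?u (g j) = a j" if "j < r" for j using that assms(1) by (simp add: the_inv_into_f_f)
  then have "represents r g U ?u" using a by (simp add: represents_def)
  moreover have "?u \<in> g ` {..<r} \<rightarrow>\<^sub>E A" using a(1) by auto
  ultimately show ?thesis by blast
qed

lemma d_carrier [simp]: "d c \<in> carrier G"
  using d_range by blast

lemma codes_pattern_iff: "codes_pattern G n h \<sigma> c (D, p) \<longleftrightarrow>
    (\<forall>l<length_code c. \<exists>g\<in>D. codes_elt G n h (pr1 (nth_code c l)) g \<and> pr2 (nth_code c l) = \<sigma> (p g)) \<and>
    (\<forall>g\<in>D. \<exists>l<length_code c. codes_elt G n h (pr1 (nth_code c l)) g \<and> pr2 (nth_code c l) = \<sigma> (p g))"
  unfolding codes_pattern_def codes_set_iff by (simp add: codes_pair_iff codes_sym_def)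

lemma rule_table:
  "l < length_code (pr2 (pr2 m)) \<Longrightarrow> \<exists>w\<in>N \<rightarrow>\<^sub>E A.
     codes_pattern G n h \<sigma> (pr1 (nth_code (pr2 (pr2 m)) l)) (N, w) \<and> pr2 (nth_code (pr2 (pr2 m)) l) = \<sigma> (\<phi> w)"
  "w \<in> N \<rightarrow>\<^sub>E A \<Longrightarrow> \<exists>l<length_code (pr2 (pr2 m)).
     codes_pattern G n h \<sigma> (pr1 (nth_code (pr2 (pr2 m)) l)) (N, w) \<and> pr2 (nth_code (pr2 (pr2 m)) l) = \<sigma> (\<phi> w)"
  using codes_N unfolding codes_rule_def codes_set_iff by (simp_all add: codes_pair_iff codes_sym_def)

definition support :: "nat \<Rightarrow> 'g set" where
  "support ml = pos ml ` {..<length_code ml}"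

definition window :: "nat \<Rightarrow> 'g set" where
  "window el = (\<lambda>k. d (nth_code el k)) ` {..<length_code el}"

context
  fixes ml assumes distinct: "inj_on (pos ml) {..<length_code ml}"
begin

abbreviation r :: nat where "r \<equiv> length_code ml"

abbreviation M :: "'g set" where "M \<equiv> support ml"

lemma occurs_iff:
  assumes "codes_pattern G n h \<sigma> c (D, p)" "p ` D \<subseteq> A" "represents r (pos ml) U u"
  shows "occurs q ml i U c \<longleftrightarrow> (\<forall>g\<in>D. pos ml i \<otimes> g \<in> M \<and> u (pos ml i \<otimes> g) = p g)"
proof -
  have *: "(\<exists>j<r. pos ml i \<otimes> g = pos ml j \<and> digit q U j = \<sigma> (p g)) \<longleftrightarrow>
      pos ml i \<otimes> g \<in> M \<and> u (pos ml i \<otimes> g) = p g" if "g \<in> D" for g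
  proof -
    have "p g \<in> A" using assms(2) that by blast
    then show ?thesis using assms(3) \<sigma>_eq unfolding represents_def support_def by auto
  qed
  have "occurs q ml i U c \<longleftrightarrow> (\<forall>l<length_code c. \<exists>j<r.
      pos ml i \<otimes> d (conv (pr1 (nth_code c l))) = pos ml j \<and> digit q U j = pr2 (nth_code c l))"
    unfolding occurs_def by (simp add: mul(2) pos_def)
  also have "\<dots> \<longleftrightarrow> (\<forall>g\<in>D. \<exists>j<r. pos ml i \<otimes> g = pos ml j \<and> digit q U j = \<sigma> (p g))"
    using assms(1) unfolding codes_pattern_iff codes_elt_conv by metis
  finally show ?thesis using * by simp
qed

text \<open>If the translate of \<open>N\<close> leaves \<open>M\<close>, no row of the rule table
  occurs and both sides demand nothing; otherwise only rows for the visible argument occur, and they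
  carry the same value.\<close>

lemma legal_code_iff:
  assumes "represents r (pos ml) U u" "represents r (pos ml) V v"
  shows "legal_code m ml U V \<longleftrightarrow> legal M u v"
proof -
  have MA: "u g \<in> A" "v g \<in> A" if "g \<in> M" for g using assms that by (auto simp: represents_def support_def)
  have pat: "(\<forall>l<length_code (pr1 (pr2 m)). \<not> occurs q ml i U (nth_code (pr1 (pr2 m)) l)) \<longleftrightarrow>
      (\<forall>(D, p)\<in>P. \<not> (\<forall>g\<in>D. pos ml i \<otimes> g \<in> M \<and> u (pos ml i \<otimes> g) = p g))" (is "?L \<longleftrightarrow> ?R") for i
  proof -
    have o: "occurs q ml i U c \<longleftrightarrow> (\<forall>g\<in>fst Dp. pos ml i \<otimes> g \<in> M \<and> u (pos ml i \<otimes> g) = snd Dp g)"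
      if "codes_pattern G n h \<sigma> c Dp" "Dp \<in> P" for c Dp
      using occurs_iff[of c "fst Dp" "snd Dp" U u i] that P assms(1) by (force simp: patterns_def)
    have "?L \<longleftrightarrow> (\<forall>Dp\<in>P. \<not> (\<forall>g\<in>fst Dp. pos ml i \<otimes> g \<in> M \<and> u (pos ml i \<otimes> g) = snd Dp g))"
      using codes_P o unfolding codes_patterns_def codes_set_iff by metis
    then show ?thesis by (simp add: case_prod_unfold)
  qed
  have rul: "(\<forall>l<length_code (pr2 (pr2 m)). occurs q ml i U (pr1 (nth_code (pr2 (pr2 m)) l)) \<longrightarrow>
        digit q V i = pr2 (nth_code (pr2 (pr2 m)) l)) \<longleftrightarrow>
      ((\<forall>k\<in>N. pos ml i \<otimes> k \<in> M) \<longrightarrow> v (pos ml i) = \<phi> (restrict (\<lambda>k. u (pos ml i \<otimes> k)) N))"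
    (is "?L \<longleftrightarrow> ?R") if i: "i < r" for i
  proof -
    have o: "occurs q ml i U c \<longleftrightarrow> (\<forall>k\<in>N. pos ml i \<otimes> k \<in> M \<and> u (pos ml i \<otimes> k) = w k)"
      if "codes_pattern G n h \<sigma> c (N, w)" "w \<in> N \<rightarrow>\<^sub>E A" for c w
      using that assms(1) by (intro occurs_iff) auto
    have \<phi>A: "\<phi> w \<in> A" if "w \<in> N \<rightarrow>\<^sub>E A" for w using that rule by (auto simp: local_rule_def)
    have vi: "v (pos ml i) \<in> A" "digit q V i = \<sigma> (v (pos ml i))"
      using assms(2) i by (auto simp: represents_def)
    let ?w = "restrict (\<lambda>k. u (pos ml i \<otimes> k)) N"
    show ?thesis
    proof
      assume L: ?L
      show ?R
      proof
        assume k: "\<forall>k\<in>N. pos ml i \<otimes> k \<in> M"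
        then have w: "?w \<in> N \<rightarrow>\<^sub>E A" using MA(1) by auto
        obtain l where l: "l < length_code (pr2 (pr2 m))"
          "codes_pattern G n h \<sigma> (pr1 (nth_code (pr2 (pr2 m)) l)) (N, ?w)"
          "pr2 (nth_code (pr2 (pr2 m)) l) = \<sigma> (\<phi> ?w)" using rule_table(2)[OF w] by blast
        have "occurs q ml i U (pr1 (nth_code (pr2 (pr2 m)) l))" unfolding o[OF l(2) w] using k by simp
        then have "\<sigma> (v (pos ml i)) = \<sigma> (\<phi> ?w)" using L l(1,3) vi(2) by simp
        then show "v (pos ml i) = \<phi> ?w" using \<sigma>_eq vi(1) \<phi>A[OF w] by blast
      qed
    next
      assume R: ?R
      show ?L
      proof (intro allI impI)
        fix l assume l: "l < length_code (pr2 (pr2 m))" "occurs q ml i U (pr1 (nth_code (pr2 (pr2 m)) l))"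
        obtain w where w: "w \<in> N \<rightarrow>\<^sub>E A" "codes_pattern G n h \<sigma> (pr1 (nth_code (pr2 (pr2 m)) l)) (N, w)"
          "pr2 (nth_code (pr2 (pr2 m)) l) = \<sigma> (\<phi> w)" using rule_table(1)[OF l(1)] by blast
        have k: "\<forall>k\<in>N. pos ml i \<otimes> k \<in> M \<and> u (pos ml i \<otimes> k) = w k" using l(2) o[OF w(2,1)] by blast
        then have "?w = w" using w(1) by (intro PiE_ext[of _ N "\<lambda>_. A"]) (auto simp: MA)
        then show "digit q V i = pr2 (nth_code (pr2 (pr2 m)) l)" using R k vi(2) w(3) by simp
      qed
    qed
  qed
  have "legal_code m ml U V \<longleftrightarrow> (\<forall>i<r.
      (\<forall>(D, p)\<in>P. \<not> (\<forall>g\<in>D. pos ml i \<otimes> g \<in> M \<and> u (pos ml i \<otimes> g) = p g)) \<and>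
      ((\<forall>k\<in>N. pos ml i \<otimes> k \<in> M) \<longrightarrow> v (pos ml i) = \<phi> (restrict (\<lambda>k. u (pos ml i \<otimes> k)) N)))"
    unfolding legal_code_def by (simp add: pat rul)
  also have "\<dots> \<longleftrightarrow> (\<forall>m'\<in>M.
      (\<forall>(D, p)\<in>P. \<not> (\<forall>g\<in>D. m' \<otimes> g \<in> M \<and> u (m' \<otimes> g) = p g)) \<and>
      ((\<forall>k\<in>N. m' \<otimes> k \<in> M) \<longrightarrow> v m' = \<phi> (restrict (\<lambda>k. u (m' \<otimes> k)) N)))"
  proof -
    have "(\<forall>m'\<in>M. Q m') \<longleftrightarrow> (\<forall>i<r. Q (pos ml i))" for Q unfolding support_def by blast
    then show ?thesis by (simp only:)
  qed
  also have "\<dots> \<longleftrightarrow> legal M u v"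
    unfolding legal_def using MA by (intro ball_cong refl) simp
  finally show ?thesis .
qed

lemma dead_code_iff:
  assumes "represents r (pos ml) V v"
  shows "dead_code m ml V \<longleftrightarrow> \<not> (\<exists>u. legal M u v)"
proof -
  have "(\<exists>U<q ^ r. legal_code m ml U V) \<longleftrightarrow> (\<exists>u. legal M u v)"
  proof
    assume "\<exists>U<q ^ r. legal_code m ml U V"
    then obtain U where U: "U < q ^ r" "legal_code m ml U V" by blast
    obtain u where "represents r (pos ml) U u" using represents_fun[OF distinct U(1)] by blast
    then show "\<exists>u. legal M u v" using legal_code_iff assms U(2) by blast
  next
    assume "\<exists>u. legal M u v"
    then obtain u where u: "legal M u v" by blast
    then have "u (pos ml j) \<in> A" if "j < r" for j using that by (auto simp: legal_def support_def)
    then obtain U where "U < q ^ r" "represents r (pos ml) U u"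
      using represents_digits[of r u "pos ml"] by blast
    then show "\<exists>U<q ^ r. legal_code m ml U V" using legal_code_iff assms u by blast
  qed
  then show ?thesis by (simp add: dead_code_def)
qed

context
  fixes el :: nat
begin

abbreviation w :: nat where "w \<equiv> length_code el"
abbreviation epos :: "nat \<Rightarrow> 'g" where "epos k \<equiv> d (nth_code el k)"

abbreviation E :: "'g set" where "E \<equiv> window el"

lemma good_code_iff:
  assumes x: "represents w epos x' x" and y: "represents w epos y' y"
    and low: "\<And>k. k < w \<Longrightarrow> in_lower b V (nth_code el k) \<longleftrightarrow> epos k \<in> lower mv"
  shows "good_code m ml el b V x' y' i s \<longleftrightarrow> (\<exists>u v. legal M u v \<and>
    (\<forall>g\<in>M. (epos i \<otimes> g \<in> E \<longrightarrow> v g = y (epos i \<otimes> g)) \<and>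
       (epos i \<otimes> g \<in> E \<inter> lower mv \<longrightarrow> u g = x (epos i \<otimes> g)) \<and>
       (0 < s \<and> epos i \<otimes> g = \<one> \<longrightarrow> Suc (\<sigma> (u g)) = s)))"
    (is "_ \<longleftrightarrow> (\<exists>u v. legal M u v \<and> ?fits u v)")
proof -
  let ?fits' = "\<lambda>u' v'. \<forall>j<r.
    (\<forall>k<w. d (mul (prod_encode (nth_code el i, conv (nth_code ml j)))) = epos k \<longrightarrow>
       digit q v' j = digit q y' k \<and> (in_lower b V (nth_code el k) \<longrightarrow> digit q u' j = digit q x' k)) \<and>
    (0 < s \<and> d (mul (prod_encode (nth_code el i, conv (nth_code ml j)))) = d e1 \<longrightarrow> Suc (digit q u' j) = s)"
  have cond: "?fits' u' v' \<longleftrightarrow> ?fits u v"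
    if u: "represents r (pos ml) u' u" and v: "represents r (pos ml) v' v" for u' v' u v
  proof -
    have eq: "d (mul (prod_encode (nth_code el i, conv (nth_code ml j)))) = epos i \<otimes> pos ml j" for j
      by (simp add: mul(2) pos_def)
    have "((\<forall>k<w. epos i \<otimes> pos ml j = epos k \<longrightarrow>
          digit q v' j = digit q y' k \<and> (in_lower b V (nth_code el k) \<longrightarrow> digit q u' j = digit q x' k)) \<and>
       (0 < s \<and> epos i \<otimes> pos ml j = \<one> \<longrightarrow> Suc (digit q u' j) = s)) \<longleftrightarrow>
      ((epos i \<otimes> pos ml j \<in> E \<longrightarrow> v (pos ml j) = y (epos i \<otimes> pos ml j)) \<and>
       (epos i \<otimes> pos ml j \<in> E \<inter> lower mv \<longrightarrow> u (pos ml j) = x (epos i \<otimes> pos ml j)) \<and>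
       (0 < s \<and> epos i \<otimes> pos ml j = \<one> \<longrightarrow> Suc (\<sigma> (u (pos ml j))) = s))" if j: "j < r" for j
    proof -
      have uj: "u (pos ml j) \<in> A" "digit q u' j = \<sigma> (u (pos ml j))"
        and vj: "v (pos ml j) \<in> A" "digit q v' j = \<sigma> (v (pos ml j))"
        using u v j by (auto simp: represents_def)
      have xk: "x (epos k) \<in> A" "digit q x' k = \<sigma> (x (epos k))"
        and yk: "y (epos k) \<in> A" "digit q y' k = \<sigma> (y (epos k))" if "k < w" for k
        using x y that by (auto simp: represents_def)
      have "(\<forall>k<w. epos i \<otimes> pos ml j = epos k \<longrightarrow>
          digit q v' j = digit q y' k \<and> (in_lower b V (nth_code el k) \<longrightarrow> digit q u' j = digit q x' k)) \<longleftrightarrow>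
        (\<forall>k<w. epos i \<otimes> pos ml j = epos k \<longrightarrow>
          v (pos ml j) = y (epos k) \<and> (epos k \<in> lower mv \<longrightarrow> u (pos ml j) = x (epos k)))"
        using uj vj xk yk low \<sigma>_eq by simp
      also have "\<dots> \<longleftrightarrow> (epos i \<otimes> pos ml j \<in> E \<longrightarrow> v (pos ml j) = y (epos i \<otimes> pos ml j)) \<and>
          (epos i \<otimes> pos ml j \<in> E \<inter> lower mv \<longrightarrow> u (pos ml j) = x (epos i \<otimes> pos ml j))"
        by (auto simp: window_def)
      finally show ?thesis using uj(2) by simp
    qed
    moreover have "(\<forall>g\<in>M. Q g) \<longleftrightarrow> (\<forall>j<r. Q (pos ml j))" for Q unfolding support_def by blast
    ultimately show ?thesis unfolding eq e1 by simp
  qed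
  show ?thesis
  proof
    assume "good_code m ml el b V x' y' i s"
    then obtain u' v' where uv: "u' < q ^ r" "v' < q ^ r" "legal_code m ml u' v'" "?fits' u' v'"
      unfolding good_code_def pr1_m by blast
    obtain u where u: "represents r (pos ml) u' u" using represents_fun[OF distinct uv(1)] by blast
    obtain v where v: "represents r (pos ml) v' v" using represents_fun[OF distinct uv(2)] by blast
    have "legal M u v" using legal_code_iff[OF u v] uv(3) by blast
    then show "\<exists>u v. legal M u v \<and> ?fits u v"
      using uv(4) unfolding cond[OF u v] by (intro exI conjI)
  next
    assume "\<exists>u v. legal M u v \<and> ?fits u v"
    then obtain u v where l: "legal M u v" and c: "?fits u v" by (elim exE conjE)
    have "u (pos ml j) \<in> A" "v (pos ml j) \<in> A" if "j < r" for j using that l by (auto simp: legal_def support_def)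
    then obtain u' v' where less: "u' < q ^ r" "v' < q ^ r"
      and u: "represents r (pos ml) u' u" and v: "represents r (pos ml) v' v"
      using represents_digits[of r u "pos ml"] represents_digits[of r v "pos ml"] by metis
    have "legal_code m ml u' v'" using legal_code_iff[OF u v] l by blast
    then show "good_code m ml el b V x' y' i s"
      using less c[folded cond[OF u v]] unfolding good_code_def pr1_m
      by (intro exI[of _ u'] exI[of _ v'] conjI)
  qed
qed

lemma good_code_0_iff:
  assumes "represents w epos x' x" "represents w epos y' y"
    and "\<And>k. k < w \<Longrightarrow> in_lower b V (nth_code el k) \<longleftrightarrow> epos k \<in> lower mv"
  shows "good_code m ml el b V x' y' i 0 \<longleftrightarrow> good M E (E \<inter> lower mv) x y (epos i)"
  using good_code_iff[OF assms, of i 0] unfolding good_def by simp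

text \<open>The identity is not in \<open>lower mv\<close>, so prescribing a symbol there adds one
  condition and leaves the others unchanged.\<close>

lemma good_code_Suc_iff:
  assumes "represents w epos x' x" "represents w epos y' y"
    and "\<And>k. k < w \<Longrightarrow> in_lower b V (nth_code el k) \<longleftrightarrow> epos k \<in> lower mv" "a \<in> A"
  shows "good_code m ml el b V x' y' i (Suc (\<sigma> a)) \<longleftrightarrow>
    good M E (insert \<one> (E \<inter> lower mv)) (x(\<one> := a)) y (epos i)"
proof -
  have "(\<forall>g\<in>M. (epos i \<otimes> g \<in> E \<longrightarrow> v g = y (epos i \<otimes> g)) \<and>
       (epos i \<otimes> g \<in> E \<inter> lower mv \<longrightarrow> u g = x (epos i \<otimes> g)) \<and>
       (0 < Suc (\<sigma> a) \<and> epos i \<otimes> g = \<one> \<longrightarrow> Suc (\<sigma> (u g)) = Suc (\<sigma> a))) \<longleftrightarrow>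
     (\<forall>g\<in>M. (epos i \<otimes> g \<in> E \<longrightarrow> v g = y (epos i \<otimes> g)) \<and>
       (epos i \<otimes> g \<in> insert \<one> (E \<inter> lower mv) \<longrightarrow> u g = (x(\<one> := a)) (epos i \<otimes> g)))"
    if "legal M u v" for u v
  proof -
    have "\<sigma> (u g) = \<sigma> a \<longleftrightarrow> u g = a" if "g \<in> M" for g
      using \<sigma>_eq assms(4) that \<open>legal M u v\<close> by (simp add: legal_def)
    then show ?thesis using one_not_lower[of mv] by auto
  qed
  then show ?thesis using good_code_iff[OF assms(1-3), of i "Suc (\<sigma> a)"] unfolding good_def by blast
qed

end
end

lemma pattern_code_codes:
  assumes "\<And>j. j < length_code ml \<Longrightarrow> length_code (nth_code ml j) = n"
    and "represents (length_code ml) (pos ml) V v" "pattern_code q ml c V"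
  shows "codes_pattern G n h \<sigma> c (support ml, v)"
  unfolding codes_pattern_iff codes_elt_conv
proof (intro conjI allI ballI impI)
  fix l assume "l < length_code c"
  then have l: "l < length_code ml" using assms(3) by (simp add: pattern_code_def)
  have mem: "pos ml l \<in> support ml" using l by (simp add: support_def)
  show "\<exists>g\<in>support ml. (length_code (pr1 (nth_code c l)) = n \<and> g = d (conv (pr1 (nth_code c l)))) \<and>
      pr2 (nth_code c l) = \<sigma> (v g)"
    using assms l unfolding represents_def pattern_code_def
    by (intro bexI[OF _ mem]) (auto simp: pos_def)
next
  fix g assume "g \<in> support ml"
  then obtain l where l: "l < length_code ml" "g = pos ml l" by (auto simp: support_def)
  then show "\<exists>l<length_code c. (length_code (pr1 (nth_code c l)) = n \<and> g = d (conv (pr1 (nth_code c l)))) \<and>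
      pr2 (nth_code c l) = \<sigma> (v g)"
    using assms l unfolding represents_def pattern_code_def
    by (intro exI[of _ l]) (auto simp: pos_def)
qed

lemma output_code_codes:
  assumes "inj_on (pos ml) {..<length_code ml}"
    and "\<And>j. j < length_code ml \<Longrightarrow> length_code (nth_code ml j) = n"
    and "output_code m ml out"
  shows "codes_patterns G n h \<sigma> out (dead_patterns (support ml))"
  unfolding codes_patterns_def codes_set_iff
proof (intro conjI allI ballI impI)
  let ?r = "length_code ml"
  fix l assume "l < length_code out"
  then obtain V where V: "V < q ^ ?r" "dead_code m ml V" "pattern_code q ml (nth_code out l) V"
    using assms(3) unfolding output_code_def by auto
  obtain v where v: "v \<in> support ml \<rightarrow>\<^sub>E A" "represents ?r (pos ml) V v"
    using represents_fun[OF assms(1) V(1)] unfolding support_def by blast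
  then have "(support ml, v) \<in> dead_patterns (support ml)"
    using dead_code_iff[OF assms(1) v(2)] V(2) by (auto simp: dead_patterns_def)
  then show "\<exists>s\<in>dead_patterns (support ml). codes_pattern G n h \<sigma> (nth_code out l) s"
    using pattern_code_codes[OF assms(2) v(2) V(3)] by blast
next
  let ?r = "length_code ml"
  fix s assume "s \<in> dead_patterns (support ml)"
  then obtain v where v: "s = (support ml, v)" "v \<in> support ml \<rightarrow>\<^sub>E A" "\<not> (\<exists>u. legal (support ml) u v)"
    by (auto simp: dead_patterns_def)
  have "v (pos ml j) \<in> A" if "j < ?r" for j using v(2) that by (auto simp: support_def)
  then obtain V where V: "V < q ^ ?r" "represents ?r (pos ml) V v"
    using represents_digits[of ?r v "pos ml"] by blast
  then have "dead_code m ml V" using dead_code_iff[OF assms(1) V(2)] v(3) by blast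
  then obtain l where "l < length_code out" "pattern_code q ml (nth_code out l) V"
    using assms(3) V(1) unfolding output_code_def by auto
  then show "\<exists>l<length_code out. codes_pattern G n h \<sigma> (nth_code out l) s"
    using pattern_code_codes[OF assms(2) V(2)] v(1) by blast
qed

lemma covered_iff:
  assumes "codes_pattern G n h \<sigma> c (D, p)"
  shows "covered ml c \<longleftrightarrow> D \<subseteq> support ml"
proof -
  have "covered ml c \<longleftrightarrow> (\<forall>l<length_code c. d (conv (pr1 (nth_code c l))) \<in> support ml)"
    unfolding covered_def by (auto simp: support_def pos_def)
  also have "\<dots> \<longleftrightarrow> D \<subseteq> support ml"
  proof -
    note c = assms[unfolded codes_pattern_iff codes_elt_conv]
    have "d (conv (pr1 (nth_code c l))) \<in> D" if "l < length_code c" for l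
      using c[THEN conjunct1, rule_format, OF that] by auto
    moreover have "\<exists>l<length_code c. g = d (conv (pr1 (nth_code c l)))" if "g \<in> D" for g
      using c[THEN conjunct2, rule_format, OF that] by blast
    ultimately show ?thesis by (metis subset_iff)
  qed
  finally show ?thesis .
qed

lemma covered_patterns_iff:
  "(\<forall>l<length_code (pr1 (pr2 m)). covered ml (nth_code (pr1 (pr2 m)) l)) \<longleftrightarrow> (\<forall>(D, p)\<in>P. D \<subseteq> support ml)"
proof -
  have cov: "covered ml c \<longleftrightarrow> fst Dp \<subseteq> support ml" if "codes_pattern G n h \<sigma> c Dp" for c Dp
    using covered_iff[of c "fst Dp" "snd Dp"] that by simp
  have "(\<forall>l<length_code (pr1 (pr2 m)). covered ml (nth_code (pr1 (pr2 m)) l)) \<longleftrightarrow> (\<forall>Dp\<in>P. fst Dp \<subseteq> support ml)"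
    using codes_P cov unfolding codes_patterns_def codes_set_iff by metis
  then show ?thesis by (simp add: case_prod_unfold)
qed

lemma covered_rule:
  assumes "N \<subseteq> support ml" "l < length_code (pr2 (pr2 m))"
  shows "covered ml (pr1 (nth_code (pr2 (pr2 m)) l))"
  using rule_table(1)[OF assms(2)] covered_iff assms(1) by blast

text \<open>Every row of the rule table lists all of \<open>N\<close>, and a nonempty alphabet
  guarantees that there is a row.\<close>

lemma covered_rule_subset:
  assumes "A \<noteq> {}" "\<forall>l<length_code (pr2 (pr2 m)). covered ml (pr1 (nth_code (pr2 (pr2 m)) l))"
  shows "N \<subseteq> support ml"
proof -
  obtain a where "a \<in> A" using assms(1) by blast
  then have "restrict (\<lambda>_. a) N \<in> N \<rightarrow>\<^sub>E A" by auto
  then obtain l where "l < length_code (pr2 (pr2 m))"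
    "codes_pattern G n h \<sigma> (pr1 (nth_code (pr2 (pr2 m)) l)) (N, restrict (\<lambda>_. a) N)"
    using rule_table(2) by blast
  then show ?thesis using assms(2) covered_iff by blast
qed

lemma distinct_pos:
  assumes "support_code m ml el b" shows "inj_on (pos ml) {..<length_code ml}"
  using assms unfolding support_code_def inj_on_def pos_def by simp

section \<open>Correctness and termination of the search\<close>

lemma extendable_code_sound:
  assumes inj: "inj_on (pos ml) {..<length_code ml}"
    and b: "\<And>k. k < length_code el \<Longrightarrow> pr2 (ld (nth_code el k)) < b"
    and ext: "extendable_code m ml el b"
  shows "extendable (support ml) (window el)"
  unfolding extendable_def
proof (intro allI impI)
  fix mv :: "nat \<Rightarrow> enat" and x y
  assume mv: "\<forall>i. mv i \<noteq> \<infinity>" and x: "x \<in> window el \<rightarrow> A" and y: "y \<in> window el \<rightarrow> A"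
    and gd: "\<forall>g\<in>window el. good (support ml) (window el) (window el \<inter> lower mv) x y g"
  let ?w = "length_code el" and ?e = "\<lambda>k. d (nth_code el k)"
  have "\<exists>V<Suc b ^ n. \<forall>i<n. digit (Suc b) V i = min (the_enat (mv i)) b"
    by (rule ex_digits) (simp add: less_Suc_eq_le)
  then obtain V where V: "V < Suc b ^ n" "\<And>i. i < n \<Longrightarrow> digit (Suc b) V i = min (the_enat (mv i)) b"
    by blast
  have eE: "?e k \<in> window el" if "k < ?w" for k using that by (auto simp: window_def)
  obtain X' where X': "X' < q ^ ?w" "represents ?w ?e X' x"
    using represents_digits[of ?w x ?e] x eE by blast
  obtain Y' where Y': "Y' < q ^ ?w" "represents ?w ?e Y' y"
    using represents_digits[of ?w y ?e] y eE by blast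
  have low: "in_lower b V (nth_code el k) \<longleftrightarrow> ?e k \<in> lower mv" if "k < ?w" for k
    using in_lower_min[of mv b V "nth_code el k"] mv V(2) b[OF that] by blast
  have "good_code m ml el b V X' Y' i 0" if "i < ?w" for i
    using good_code_0_iff[OF inj X'(2) Y'(2) low] gd eE[OF that] by blast
  then obtain a' where a': "a' < q" "\<And>i. i < ?w \<Longrightarrow> good_code m ml el b V X' Y' i (Suc a')"
    using ext V(1) X'(1) Y'(1) unfolding extendable_code_def pr1_m by blast
  obtain a where a: "a \<in> A" "\<sigma> a = a'" using \<sigma>_surj[OF a'(1)] by blast
  have "good (support ml) (window el) (insert \<one> (window el \<inter> lower mv)) (x(\<one> := a)) y (?e i)" if "i < ?w" for i
    using good_code_Suc_iff[OF inj X'(2) Y'(2) low a(1)] a'(2)[OF that] a(2) by blast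
  then show "\<exists>a\<in>A. \<forall>g\<in>window el. good (support ml) (window el) (insert \<one> (window el \<inter> lower mv)) (x(\<one> := a)) y g"
    using a(1) by (auto simp: window_def)
qed

text \<open>Every digit sequence has to come from a function on the window, so here
  \<open>el\<close> must be free of repetitions as well.\<close>

lemma extendable_code_complete:
  assumes inj: "inj_on (pos ml) {..<length_code ml}" "inj_on (\<lambda>k. d (nth_code el k)) {..<length_code el}"
    and ext: "extendable (support ml) (window el)"
  shows "extendable_code m ml el b"
  unfolding extendable_code_def pr1_m
proof (intro allI impI)
  let ?w = "length_code el" and ?e = "\<lambda>k. d (nth_code el k)"
  fix V X' Y' assume X': "X' < q ^ ?w" and Y': "Y' < q ^ ?w"
    and gd: "\<forall>i<?w. good_code m ml el b V X' Y' i 0"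
  define mv where "mv i = enat (digit (Suc b) V i)" for i
  have low: "in_lower b V (nth_code el k) \<longleftrightarrow> ?e k \<in> lower mv" for k
    by (rule in_lower_iff) (simp add: mv_def)
  obtain x where x: "x \<in> window el \<rightarrow> A" "represents ?w ?e X' x"
    using represents_fun[OF inj(2) X'] unfolding window_def by (metis PiE_iff Pi_I)
  obtain y where y: "y \<in> window el \<rightarrow> A" "represents ?w ?e Y' y"
    using represents_fun[OF inj(2) Y'] unfolding window_def by (metis PiE_iff Pi_I)
  have gE: "good (support ml) (window el) (window el \<inter> lower mv) x y g" if "g \<in> window el" for g
    using that gd good_code_0_iff[OF inj(1) x(2) y(2) low] by (auto simp: window_def)
  have "\<exists>a\<in>A. \<forall>g\<in>window el. good (support ml) (window el) (insert \<one> (window el \<inter> lower mv)) (x(\<one> := a)) y g"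
    by (rule ext[unfolded extendable_def, rule_format, OF _ x(1) y(1) gE]) (simp add: mv_def)
  then obtain a where a: "a \<in> A"
    "\<And>g. g \<in> window el \<Longrightarrow> good (support ml) (window el) (insert \<one> (window el \<inter> lower mv)) (x(\<one> := a)) y g"
    by blast
  have "good_code m ml el b V X' Y' i (Suc (\<sigma> a))" if "i < ?w" for i
    using good_code_Suc_iff[OF inj(1) x(2) y(2) low a(1)] a(2)[of "?e i"] that by (auto simp: window_def)
  then show "\<exists>a<q. \<forall>i<?w. good_code m ml el b V X' Y' i (Suc a)" using \<sigma>_less[OF a(1)] by blast
qed

lemma check_sound:
  assumes "check m k"
  shows "\<exists>Q. codes_patterns G n h \<sigma> (pr1 k) Q \<and> finite Q \<and> Q \<subseteq> patterns G A \<and> Y = subshift_forbidding G A Q"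
proof -
  define ml where "ml = pr1 (pr2 k)"
  define el where "el = pr1 (pr2 (pr2 k))"
  define b where "b = pr2 (pr2 (pr2 k))"
  have c: "support_code m ml el b" "extendable_code m ml el b" "output_code m ml (pr1 k)"
    using assms unfolding check_def ml_def el_def b_def by blast+
  note inj = distinct_pos[OF c(1)]
  have s: "0 < length_code ml" "pos ml 0 = \<one>" "\<And>j. j < length_code ml \<Longrightarrow> length_code (nth_code ml j) = n"
    "\<And>k. k < length_code el \<Longrightarrow> pr2 (ld (nth_code el k)) < b"
    using c(1) by (simp_all add: support_code_def pos_def e1)
  have s5: "\<forall>i<length_code ml. \<exists>k<length_code el. d (nth_code el k) \<otimes> pos ml i = \<one> \<and>
      (\<forall>j<length_code ml. \<exists>k'<length_code el. d (nth_code el k) \<otimes> pos ml j = d (nth_code el k'))"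
    using c(1) unfolding support_code_def mul(2) e1 pos_def by (elim conjE)
  have codes: "codes_patterns G n h \<sigma> (pr1 k) (dead_patterns (support ml))"
    by (rule output_code_codes[OF inj s(3) c(3)])
  have oneM: "\<one> \<in> support ml" using s(1,2) by (force simp: support_def)
  show ?thesis
  \<comment> \<open>Over the empty alphabet the rule table gives no information on \<open>N\<close>;
    but then there are no configurations at all and the output is the empty set of patterns.\<close>
  proof (cases "A = {}")
    case True
    have "support ml \<rightarrow>\<^sub>E A = {}" "carrier G \<rightarrow>\<^sub>E A = {}"
      using oneM True one_closed by (simp_all only: PiE_eq_empty_iff) blast+
    then have "dead_patterns (support ml) = {}" "Y = {}" "subshift_forbidding G A {} = {}"
      using Y_subset unfolding dead_patterns_def subshift_forbidding_def by blast+
    then show ?thesis using codes by auto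
  next
    case False
    have PN: "\<forall>(D, p)\<in>P. D \<subseteq> support ml" "N \<subseteq> support ml"
      using c(1) covered_patterns_iff covered_rule_subset[OF False] unfolding support_code_def by blast+
    have "certificate (support ml) (window el)"
      unfolding certificate_def
    proof (intro conjI)
      show "\<forall>m'\<in>support ml. inv m' \<in> window el \<and> (\<forall>m''\<in>support ml. inv m' \<otimes> m'' \<in> window el)"
      proof
        fix m' assume "m' \<in> support ml"
        then obtain i where i: "i < length_code ml" "m' = pos ml i" by (auto simp: support_def)
        then obtain k where k: "k < length_code el" "d (nth_code el k) \<otimes> pos ml i = \<one>"
          "\<And>j. j < length_code ml \<Longrightarrow> \<exists>k'<length_code el. d (nth_code el k) \<otimes> pos ml j = d (nth_code el k')"
          using s5[rule_format, OF i(1)] by blast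
        have "inv m' = d (nth_code el k)" using k(2) i(2) by (intro inv_equality) (simp_all add: pos_def)
        then show "inv m' \<in> window el \<and> (\<forall>m''\<in>support ml. inv m' \<otimes> m'' \<in> window el)"
          using k(1,3) by (auto simp: support_def window_def)
      qed
      show "extendable (support ml) (window el)" by (rule extendable_code_sound[OF inj s(4) c(2)])
    qed (use oneM PN in \<open>auto simp: support_def window_def pos_def\<close>)
    then show ?thesis using dead_patterns codes by blast
  qed
qed

lemma check_complete: "\<exists>k. check m k"
proof -
  obtain M0 E0 where cert: "certificate M0 E0" using certificate_complete by blast
  then have M0: "finite M0" "M0 \<subseteq> carrier G" "\<one> \<in> M0" and E0: "finite E0" "E0 \<subseteq> carrier G"
    and ME: "\<And>m. m \<in> M0 \<Longrightarrow> inv m \<in> E0" "\<And>m m'. m \<in> M0 \<Longrightarrow> m' \<in> M0 \<Longrightarrow> inv m \<otimes> m' \<in> E0"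
    and PN: "\<forall>(D, p)\<in>P. D \<subseteq> M0" "N \<subseteq> M0" and ext: "extendable M0 E0"
    unfolding certificate_def by auto
  obtain gs where gs: "set gs = M0 - {\<one>}" "distinct gs" using finite_distinct_list[of "M0 - {\<one>}"] M0(1) by blast
  obtain es where es: "set es = E0" "distinct es" using finite_distinct_list[OF E0(1)] by blast
  have "\<exists>c. codes_elt G n h c g" if "g \<in> carrier G" for g using codes_elt_exists that by blast
  then obtain code where code: "\<And>g. g \<in> carrier G \<Longrightarrow> length_code (code g) = n \<and> d (conv (code g)) = g"
    unfolding codes_elt_conv by metis
  have "\<exists>c. d c = g" if "g \<in> carrier G" for g using d_range that by (metis rangeE)
  then obtain ecode where ecode: "\<And>g. g \<in> carrier G \<Longrightarrow> d (ecode g) = g" by metis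
  \<comment> \<open>The identity comes first, where \<open>support_code\<close> looks for
    it.\<close>
  define ms where "ms = \<one> # gs"
  have ms: "set ms = M0" "distinct ms" "ms ! 0 = \<one>" "0 < length ms" using gs M0(3) by (auto simp: ms_def)
  define ml where "ml = list_encode (map code ms)"
  define el where "el = list_encode (map ecode es)"
  have len: "length_code ml = length ms" "length_code el = length es"
    by (simp_all add: ml_def el_def length_code_list_encode)
  have msc: "ms ! j \<in> carrier G" if "j < length ms" for j using that ms(1) M0(2) nth_mem by blast
  have esc: "es ! k \<in> carrier G" if "k < length es" for k using that es(1) E0(2) nth_mem by blast
  have pos: "d (conv (nth_code ml j)) = ms ! j" "length_code (nth_code ml j) = n" if "j < length ms" for j
    using code[OF msc[OF that]] that by (simp_all add: ml_def nth_code_list_encode)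
  have epos: "d (nth_code el k) = es ! k" if "k < length es" for k
    using ecode[OF esc[OF that]] that by (simp add: el_def nth_code_list_encode)
  have M: "support ml = M0"
  proof -
    have "support ml = (\<lambda>j. ms ! j) ` {..<length ms}" unfolding support_def pos_def len using pos(1) by (intro image_cong) auto
    also have "\<dots> = set ms" by (auto simp: set_conv_nth)
    finally show ?thesis using ms(1) by simp
  qed
  have E: "window el = E0"
  proof -
    have "window el = (\<lambda>j. es ! j) ` {..<length es}" unfolding window_def len using epos by (intro image_cong) auto
    also have "\<dots> = set es" by (auto simp: set_conv_nth)
    finally show ?thesis using es(1) by simp
  qed
  have inj: "inj_on (pos ml) {..<length_code ml}"
    unfolding inj_on_def pos_def len using pos(1) ms(2) by (simp add: nth_eq_iff_index_eq)
  have einj: "inj_on (\<lambda>k. d (nth_code el k)) {..<length_code el}"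
    unfolding inj_on_def len using epos es(2) by (simp add: nth_eq_iff_index_eq)
  define b where "b = Suc (\<Sum>k<length_code el. pr2 (ld (nth_code el k)))"
  have b: "pr2 (ld (nth_code el k)) < b" if "k < length_code el" for k
    unfolding b_def using that member_le_sum[of k "{..<length_code el}" "\<lambda>k. pr2 (ld (nth_code el k))"] by simp
  have cov: "\<forall>l<length_code (pr1 (pr2 m)). covered ml (nth_code (pr1 (pr2 m)) l)"
    "\<forall>l<length_code (pr2 (pr2 m)). covered ml (pr1 (nth_code (pr2 (pr2 m)) l))"
    using covered_patterns_iff covered_rule PN M by simp_all
  have supp: "support_code m ml el b"
    unfolding support_code_def len
  proof (intro conjI)
    show "\<forall>i<length ms. \<exists>k<length es. d (mul (prod_encode (nth_code el k, conv (nth_code ml i)))) = d e1 \<and>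
        (\<forall>j<length ms. \<exists>k'<length es. d (mul (prod_encode (nth_code el k, conv (nth_code ml j)))) = d (nth_code el k'))"
    proof (intro allI impI)
      fix i assume i: "i < length ms"
      then have mi: "ms ! i \<in> M0" using ms(1) nth_mem by blast
      then obtain k where k: "k < length es" "es ! k = inv (ms ! i)"
        using ME(1) es(1) by (metis in_set_conv_nth)
      have "\<exists>k'<length es. es ! k \<otimes> ms ! j = d (nth_code el k')" if "j < length ms" for j
      proof -
        have "ms ! j \<in> M0" using that ms(1) nth_mem by blast
        then have "es ! k \<otimes> ms ! j \<in> set es" using ME(2)[OF mi] k(2) es(1) by simp
        then show ?thesis by (metis in_set_conv_nth epos)
      qed
      then show "\<exists>k<length es. d (mul (prod_encode (nth_code el k, conv (nth_code ml i)))) = d e1 \<and>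
          (\<forall>j<length ms. \<exists>k'<length es. d (mul (prod_encode (nth_code el k, conv (nth_code ml j)))) = d (nth_code el k'))"
        using k msc i by (intro exI[of _ k]) (auto simp: mul(2) pos epos e1)
    qed
    show "\<forall>k<length es. pr2 (ld (nth_code el k)) < b" using b len by simp
  qed (use ms pos cov e1 in \<open>simp_all add: nth_eq_iff_index_eq\<close>)
  have exc: "extendable_code m ml el b"
    by (rule extendable_code_complete[OF inj einj]) (simp add: M E ext)
  define pc where "pc v = list_encode (map (\<lambda>j. prod_encode (nth_code ml j, digit q v j)) [0..<length_code ml])" for v
  have pc: "pattern_code q ml (pc v) v" for v
    by (simp add: pattern_code_def pc_def length_code_list_encode nth_code_list_encode)
  define vs where "vs = filter (dead_code m ml) [0..<q ^ length_code ml]"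
  have "output_code m ml (list_encode (map pc vs))"
    unfolding output_code_def pr1_m
  proof (intro conjI allI impI)
    fix l assume "l < length_code (list_encode (map pc vs))"
    then have l: "l < length vs" by (simp add: length_code_list_encode)
    then have "vs ! l \<in> set vs" by simp
    then have "vs ! l < q ^ length_code ml" "dead_code m ml (vs ! l)" by (auto simp: vs_def)
    then show "\<exists>v<q ^ length_code ml. dead_code m ml v \<and>
        pattern_code q ml (nth_code (list_encode (map pc vs)) l) v"
      using pc l by (intro exI[of _ "vs ! l"]) (simp add: nth_code_list_encode)
  next
    fix v assume "v < q ^ length_code ml" "dead_code m ml v"
    then have "v \<in> set vs" by (simp add: vs_def)
    then obtain l where "l < length vs" "vs ! l = v" by (metis in_set_conv_nth)
    then show "\<exists>l<length_code (list_encode (map pc vs)). pattern_code q ml (nth_code (list_encode (map pc vs)) l) v"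
      using pc by (intro exI[of _ l]) (simp add: nth_code_list_encode length_code_list_encode)
  qed
  then have "check m (prod_encode (list_encode (map pc vs), prod_encode (ml, prod_encode (el, b))))"
    using supp exc by (simp add: check_def)
  then show ?thesis by blast
qed

end

theorem theorem9p2:
  fixes G :: "('g, 'b) monoid_scheme" and n :: nat
    and H :: "nat \<Rightarrow> 'g set" and h :: "nat \<Rightarrow> 'g"
  assumes "polycycle G n H h"
  shows
    "(\<forall>(A :: 's set) X Y.
        finite A \<longrightarrow> II_avoshift G n H h A X \<longrightarrow> avofactor G n H h A X Y \<longrightarrow>
        II_avoshift G n H h A Y) \<and>
     (\<exists>F. partial_recursive F \<and>
        (\<forall>(A :: 's set) \<sigma> X Y f P N \<phi> m.
           finite A \<longrightarrow> bij_betw \<sigma> A {..<card A} \<longrightarrow>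
           finite P \<longrightarrow> P \<subseteq> patterns G A \<longrightarrow> X = subshift_forbidding G A P \<longrightarrow>
           II_avoshift G n H h A X \<longrightarrow>
           factor_map G A X Y f \<longrightarrow> avorelation G n H h A (graph G X f) \<longrightarrow>
           local_rule G A X f N \<phi> \<longrightarrow>
           codes_input G n h A \<sigma> m (card A, P, N, \<phi>) \<longrightarrow>
           (\<exists>Q m'. F m = Some m' \<and> codes_patterns G n h \<sigma> m' Q \<and>
                   finite Q \<and> Q \<subseteq> patterns G A \<and> Y = subshift_forbidding G A Q)))"
proof
  interpret polycyclic G n H h by unfold_locales (rule assms)
  show "\<forall>(A :: 's set) X Y.
        finite A \<longrightarrow> II_avoshift G n H h A X \<longrightarrow> avofactor G n H h A X Y \<longrightarrow>
        II_avoshift G n H h A Y"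
    using II_avoshift_avofactor by blast
  \<comment> \<open>These functions depend on the group alone, so the algorithm is fixed before the
    alphabet, the patterns and the rule are given.\<close>
  obtain d mul ld conv e1 where "effective G n H h d mul ld conv e1" using effective_exists by blast
  then interpret effective G n H h d mul ld conv e1 .
  obtain F0 where F0: "partial_recursive F0" "\<And>m. \<exists>k. check m k \<Longrightarrow> \<exists>k. check m k \<and> F0 m = Some k"
    using partial_recursive_search[OF dec_check] by blast
  let ?F = "\<lambda>m. Option.bind (F0 m) (\<lambda>k. Some (pr1 k))"
  have "\<exists>Q m'. ?F m = Some m' \<and> codes_patterns G n h \<sigma> m' Q \<and> finite Q \<and> Q \<subseteq> patterns G A \<and>
      Y = subshift_forbidding G A Q"
    if "finite A" "bij_betw \<sigma> A {..<card A}" "finite P" "P \<subseteq> patterns G A"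
      "X = subshift_forbidding G A P" "II_avoshift G n H h A X" "factor_map G A X Y f"
      "avorelation G n H h A (graph G X f)" "local_rule G A X f N \<phi>"
      "codes_input G n h A \<sigma> m (card A, P, N, \<phi>)"
    for A :: "'s set" and \<sigma> X Y f P N \<phi> m
  proof -
    interpret effective_avo G n H h d mul ld conv e1 A X Y f P N \<phi> \<sigma> m
      by unfold_locales (fact that)+
    obtain k where "check m k" "F0 m = Some k" using F0(2) check_complete by blast
    then show ?thesis using check_sound by fastforce
  qed
  moreover have "partial_recursive ?F" by (rule pr_comp[OF pr_fst F0(1)])
  ultimately show "\<exists>F. partial_recursive F \<and>
        (\<forall>(A :: 's set) \<sigma> X Y f P N \<phi> m.
           finite A \<longrightarrow> bij_betw \<sigma> A {..<card A} \<longrightarrow>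
           finite P \<longrightarrow> P \<subseteq> patterns G A \<longrightarrow> X = subshift_forbidding G A P \<longrightarrow>
           II_avoshift G n H h A X \<longrightarrow>
           factor_map G A X Y f \<longrightarrow> avorelation G n H h A (graph G X f) \<longrightarrow>
           local_rule G A X f N \<phi> \<longrightarrow>
           codes_input G n h A \<sigma> m (card A, P, N, \<phi>) \<longrightarrow>
           (\<exists>Q m'. F m = Some m' \<and> codes_patterns G n h \<sigma> m' Q \<and>
                   finite Q \<and> Q \<subseteq> patterns G A \<and> Y = subshift_forbidding G A Q))"
    by (intro exI[of _ ?F]) blast
qed

end
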